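(* Fix $d\geq 2$ and $P$ a probability measure on $\mathbb{R}^d$. Assume that $P$ admits a density $f_P$ with respect to the Lebesgue measure. Fix $\beta\in[0,1)$. (i) If $f_P\in L^p_{\mathrm{loc}}(\mathbb{R}^d)$ for some $p\in(d/(d-\ell),\infty]$ and an integer $\ell\in[1,d-1]$, then $\mathcal{C}_P^{\mathrm g}(\beta)$ is a $(d-1)$-dimensional manifold of class $\mathcal{C}^\ell$. (ii) If $f_P\in\mathcal{C}^{k,\alpha}_{\mathrm{loc}}(\mathbb{R}^d)$ for some $k\in\mathbb{N}$ and $\alpha\in(0,1)$, then $\mathcal{C}_P^{\mathrm g}(\beta)$ is a $(d-1)$-dimensional manifold of class $\mathcal{C}^{k+d}$.
   Context: For a probability measure $P$ on $\mathbb{R}^d$ ($d\ge2$) not supported on a single line (which holds automatically when $P$ has a density), $\beta\in[0,1)$ and $u\in\mathbb{S}^{d-1}$ (the unit sphere of $\mathbb{R}^d$), the geometric quantile $Q_P^{\mathrm g}(\beta u)$ of order $\beta$ in direction $u$ is the unique minimizer over $x\in\mathbb{R}^d$ of $x\mapsto\mathbb{E}[\|x-Z\|-\|Z\|]-\langle\beta u,x\rangle$, where $Z$ is a random vector with law $P$ (uniqueness is known). The geometric depth contour of order $\beta$ for $P$ is $\mathcal{C}_P^{\mathrm g}(\beta)=\{Q_P^{\mathrm g}(\beta u):u\in\mathbb{S}^{d-1}\}\subset\mathbb{R}^d$. $f\in L^p_{\mathrm{loc}}(\mathbb{R}^d)$ means that the restriction of $f$ to every compact set is in $L^p$. $f\in\mathcal{C}^{k,\alpha}_{\mathrm{loc}}(\mathbb{R}^d)$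 means $f\in\mathcal{C}^k(\mathbb{R}^d)$ and, on every compact set, all partial derivatives of order $\le k$ are bounded and those of order $k$ are $\alpha$-Hölder continuous. $\mathbb{N}=\{0,1,2,\dots\}$.
   Formalization: The order β is taken in (0,1) instead of [0,1): at β = 0 the quantile does not depend on u, so the contour is a single point, which is never a (d−1)-dimensional manifold for d ≥ 2. *)

theory Defs
  imports "HOL-Probability.Probability"
begin

section \<open>Geometric quantiles and depth contours\<close>

text \<open>Subtracting \<^term>\<open>norm z\<close> makes the integrand bounded (by \<^term>\<open>norm x\<close>), so that no moment
  assumption on \<^term>\<open>P\<close> is needed.\<close>

definition geometric_objective ::
    "'a::euclidean_space measure \<Rightarrow> real \<Rightarrow> 'a \<Rightarrow> 'a \<Rightarrow> real"
  where "geometric_objective P \<beta> u x =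
    (\<integral>z. (norm (x - z) - norm z) \<partial>P) - (\<beta> *\<^sub>R u) \<bullet> x"

definition geometric_quantile ::
    "'a::euclidean_space measure \<Rightarrow> real \<Rightarrow> 'a \<Rightarrow> 'a"
  where "geometric_quantile P \<beta> u =
    (THE x. is_arg_min (geometric_objective P \<beta> u) (\<lambda>_. True) x)"

text \<open>For \<open>\<beta> = 0\<close> the direction \<open>u\<close> plays no role, and the contour degenerates to
  a single point (the geometric median).\<close>

definition geometric_contour :: "'a::euclidean_space measure \<Rightarrow> real \<Rightarrow> 'a set"
  where "geometric_contour P \<beta> = geometric_quantile P \<beta> ` sphere 0 1"


section \<open>Function spaces\<close>

definition Lp_loc :: "ereal \<Rightarrow> ('a::euclidean_space \<Rightarrow> real) \<Rightarrow> bool"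
  where "Lp_loc p f \<longleftrightarrow> f \<in> borel_measurable borel \<and>
    (\<forall>K. compact K \<longrightarrow>
      (if p = \<infinity> then \<exists>C. AE x in lborel. x \<in> K \<longrightarrow> \<bar>f x\<bar> \<le> C
       else set_integrable lborel K (\<lambda>x. \<bar>f x\<bar> powr real_of_ereal p)))"

text \<open>Iterated partial derivatives: \<open>iterated_partial [b\<^sub>1, \<dots>, b\<^sub>k] f\<close> is
  \<open>\<partial>\<^bsub>b\<^sub>1\<^esub> \<dots> \<partial>\<^bsub>b\<^sub>k\<^esub> f\<close> for basis vectors \<open>b\<^sub>i\<close>. It is meaningful only
  where the functions being differentiated are differentiable, which is required
  separately in \<open>Ck_on\<close>.\<close>

primrec iterated_partial ::
    "'a list \<Rightarrow> ('a::euclidean_space \<Rightarrow> 'b::real_normed_vector) \<Rightarrow> 'a \<Rightarrow> 'b"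
  where
    "iterated_partial [] f = f"
  | "iterated_partial (b # bs) f = (\<lambda>x. frechet_derivative (iterated_partial bs f) (at x) b)"

text \<open>Class \<open>C\<^sup>k\<close> on a set \<open>U\<close>, to be used for open \<open>U\<close> only.\<close>

definition Ck_on ::
    "nat \<Rightarrow> ('a::euclidean_space \<Rightarrow> 'b::real_normed_vector) \<Rightarrow> 'a set \<Rightarrow> bool"
  where "Ck_on k f U \<longleftrightarrow>
    (\<forall>bs. set bs \<subseteq> Basis \<and> length bs < k \<longrightarrow>
      (\<forall>x\<in>U. iterated_partial bs f differentiable (at x))) \<and>
    (\<forall>bs. set bs \<subseteq> Basis \<and> length bs \<le> k \<longrightarrow> continuous_on U (iterated_partial bs f))"

definition Ck_Holder_loc :: "nat \<Rightarrow> real \<Rightarrow> ('a::euclidean_space \<Rightarrow> real) \<Rightarrow> bool"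
  where "Ck_Holder_loc k \<alpha> f \<longleftrightarrow> Ck_on k f UNIV \<and>
    (\<forall>K. compact K \<longrightarrow>
      (\<forall>bs. set bs \<subseteq> Basis \<and> length bs \<le> k \<longrightarrow> bounded (iterated_partial bs f ` K)) \<and>
      (\<forall>bs. set bs \<subseteq> Basis \<and> length bs = k \<longrightarrow>
        (\<exists>C. \<forall>x\<in>K. \<forall>y\<in>K.
          \<bar>iterated_partial bs f x - iterated_partial bs f y\<bar> \<le> C * norm (x - y) powr \<alpha>)))"


section \<open>Submanifolds of Euclidean space\<close>

text \<open>For \<open>k = 0\<close> this is just a homeomorphism.\<close>

definition Ck_diffeomorphism ::
    "nat \<Rightarrow> 'a::euclidean_space set \<Rightarrow> 'a set \<Rightarrow> ('a \<Rightarrow> 'a) \<Rightarrow> ('a \<Rightarrow> 'a) \<Rightarrow> bool"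
  where "Ck_diffeomorphism k U V \<phi> \<psi> \<longleftrightarrow>
    open U \<and> open V \<and> homeomorphism U V \<phi> \<psi> \<and> Ck_on k \<phi> U \<and> Ck_on k \<psi> V"

text \<open>\<open>m\<close>-dimensional embedded submanifold of class \<open>C\<^sup>k\<close>: around each of its points the
  ambient space can be straightened by a \<open>C\<^sup>k\<close>-diffeomorphism onto an open set that carries
  \<open>M\<close> to an \<open>m\<close>-dimensional linear subspace.\<close>

definition Ck_submanifold :: "nat \<Rightarrow> nat \<Rightarrow> 'a::euclidean_space set \<Rightarrow> bool"
  where "Ck_submanifold k m M \<longleftrightarrow>
    (\<forall>x\<in>M. \<exists>U V \<phi> \<psi> L. x \<in> U \<and> Ck_diffeomorphism k U V \<phi> \<psi> \<and>
       subspace L \<and> dim L = m \<and> \<phi> ` (M \<inter> U) = V \<inter> L)"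

end

theory Submission
  imports Defs
begin

text \<open>
  The quantile of order \<open>\<beta>\<close> in direction \<open>u\<close> minimizes the convex function
  \<open>E(\<bar>x - Z\<bar> - \<bar>Z\<bar>) - \<beta> u \<bullet> x\<close>, with gradient \<open>F x - \<beta> u\<close>, where \<open>F x = E (sgn (x - Z))\<close> is the spatial rank
  map. In dimension at least 2 a distribution with a density gives no mass to lines, and therefore \<open>F\<close> is strictly monotone. Hence \<open>x\<close>
  is the quantile in direction \<open>u\<close> exactly if \<open>F x = \<beta> u\<close>, and the contour is the level set \<open>\<bar>F x\<bar> = \<beta>\<close>
  (\<open>geometric_contour_eq_level_set\<close>). For the same reason the derivative of \<open>F\<close> is positive
  definite, so \<open>\<bar>F\<bar>\<^sup>2\<close> increases at \<open>x\<close> in the direction \<open>F x\<close>, which is nonzero for \<open>\<beta> > 0\<close>. The level set is thus regular, and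
  it is as smooth as \<open>F\<close> by the inverse function theorem (\<open>Ck_submanifold_level_set\<close>).

  It remains to find the smoothness of \<open>F\<close>, the convolution of the density \<open>f\<close> with the kernel
  \<open>y / \<bar>y\<bar>\<close>, whose derivatives of order \<open>m\<close> have size \<open>\<bar>y\<bar>\<^sup>-\<^sup>m\<close>. When \<open>\<bar>y\<bar>\<close> is replaced by \<open>sqrt (\<bar>y\<bar>\<^sup>2 + \<epsilon>\<^sup>2)\<close>, all
  derivatives pass under the integral, and \<open>F\<close> is of class \<open>C\<^sup>n\<close> if the partial derivatives of order at most
  \<open>n\<close> of the regularized convolutions converge locally uniformly as \<open>\<epsilon> \<longlongrightarrow> 0\<close> (\<open>Ck_on_kernel_limit\<close>).
  Away from the diagonal \<open>z = x\<close> this is clear. Near it, it suffices that the integral of \<open>\<bar>x - z\<bar>\<^sup>-\<^sup>m \<bar>f z\<bar>\<close> over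
  \<open>\<bar>x - z\<bar> < \<delta>\<close> is uniformly small (\<open>uniform_limit_kernel_integral\<close>).

  Let \<open>d\<close> be the dimension. If \<open>f\<close> is locally in \<open>L\<^sup>p\<close>, this smallness is Young's inequality, as long as
  \<open>m p / (p - 1) < d\<close>, that is \<open>p > d / (d - m)\<close> (\<open>small_near_Lp\<close>). If \<open>f\<close> is Hoelder continuous, also the critical
  order \<open>m = d\<close> is within reach: the Hoelder condition compensates the singularity after subtraction of \<open>f x\<close> times
  a cutoff function, and the subtracted term has order \<open>d - 1\<close> after an integration by parts
  (\<open>kernel_convergent_critical_order\<close>). If \<open>f\<close> has \<open>k\<close> further derivatives, they are used to absorb
  \<open>k\<close> derivatives of the kernel, again by parts (\<open>kernel_convergent_above_critical_order\<close>).
\<close>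

section \<open>Calculus of continuously differentiable maps\<close>

lemma iterated_partial_snoc:
  "iterated_partial (bs @ [b]) f = iterated_partial bs (\<lambda>x. frechet_derivative f (at x) b)"
  by (induction bs) auto

lemma Ck_on_0: "Ck_on 0 f U \<longleftrightarrow> continuous_on U f"
  by (auto simp: Ck_on_def)

text \<open>This peels off the derivative that is taken first, the last entry of the list in
  \<^const>\<open>iterated_partial\<close>, and so opens the way to induction on the order: the partial
  derivatives of a \<open>C\<^sup>n\<^sup>+\<^sup>1\<close> map are again maps to which an induction hypothesis applies.\<close>

lemma Ck_on_Suc:
  "Ck_on (Suc n) f U \<longleftrightarrow> continuous_on U f \<and> (\<forall>x\<in>U. f differentiable at x) \<and>
     (\<forall>b\<in>Basis. Ck_on n (\<lambda>x. frechet_derivative f (at x) b) U)"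
proof -
  have all_lists: "(\<forall>bs. Q bs) \<longleftrightarrow> Q [] \<and> (\<forall>bs b. Q (bs @ [b]))" for Q :: "'a list \<Rightarrow> bool"
    by (metis rev_exhaust)
  have 1: "(\<forall>bs. set bs \<subseteq> Basis \<and> length bs < Suc n \<longrightarrow>
      (\<forall>x\<in>U. iterated_partial bs f differentiable (at x))) \<longleftrightarrow>
      (\<forall>x\<in>U. f differentiable at x) \<and>
      (\<forall>b\<in>Basis. \<forall>bs. set bs \<subseteq> Basis \<and> length bs < n \<longrightarrow>
      (\<forall>x\<in>U. iterated_partial bs (\<lambda>x. frechet_derivative f (at x) b) differentiable (at x)))"
    by (subst all_lists) (auto simp: iterated_partial_snoc)
  have 2: "(\<forall>bs. set bs \<subseteq> Basis \<and> length bs \<le> Suc n \<longrightarrow> continuous_on U (iterated_partial bs f)) \<longleftrightarrow>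
      continuous_on U f \<and>
      (\<forall>b\<in>Basis. \<forall>bs. set bs \<subseteq> Basis \<and> length bs \<le> n \<longrightarrow>
      continuous_on U (iterated_partial bs (\<lambda>x. frechet_derivative f (at x) b)))"
    by (subst all_lists) (auto simp: iterated_partial_snoc)
  show ?thesis unfolding Ck_on_def 1 2 by blast
qed

lemma Ck_on_continuous: "Ck_on n f U \<Longrightarrow> continuous_on U f"
  by (cases n) (auto simp: Ck_on_0 Ck_on_Suc)

lemma Ck_on_mono: "Ck_on n f U \<Longrightarrow> m \<le> n \<Longrightarrow> Ck_on m f U"
  unfolding Ck_on_def by (meson less_le_trans order_trans)

lemma Ck_on_subset: "Ck_on n f U \<Longrightarrow> V \<subseteq> U \<Longrightarrow> Ck_on n f V"
  unfolding Ck_on_def by (meson continuous_on_subset subsetD)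

lemma Ck_on_has_derivative:
  "Ck_on (Suc n) f U \<Longrightarrow> x \<in> U \<Longrightarrow> (f has_derivative frechet_derivative f (at x)) (at x)"
  by (auto simp: Ck_on_Suc frechet_derivative_works)

lemma frechet_derivative_cong_open:
  assumes "open U" "x \<in> U" "\<And>y. y \<in> U \<Longrightarrow> f y = g y"
  shows "frechet_derivative f (at x) = frechet_derivative g (at x)"
proof -
  have "(f has_derivative D) (at x) \<longleftrightarrow> (g has_derivative D) (at x)" for D
    using has_derivative_transform_within_open[OF _ assms(1,2)] assms(3) by metis
  then show ?thesis by (simp add: frechet_derivative_def)
qed

lemma Ck_on_cong:
  assumes "open U" "\<And>y. y \<in> U \<Longrightarrow> f y = g y"
  shows "Ck_on n f U \<longleftrightarrow> Ck_on n g U"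
  using assms(2)
proof (induction n arbitrary: f g)
  case 0
  then show ?case by (simp add: Ck_on_0)
next
  case (Suc n)
  have "f differentiable at x \<longleftrightarrow> g differentiable at x" if "x \<in> U" for x
    unfolding differentiable_def
    using has_derivative_transform_within_open[OF _ assms(1) that] Suc.prems by metis
  moreover have "Ck_on n (\<lambda>x. frechet_derivative f (at x) b) U \<longleftrightarrow>
     Ck_on n (\<lambda>x. frechet_derivative g (at x) b) U" for b
    by (rule Suc.IH) (simp add: frechet_derivative_cong_open[OF assms(1) _ Suc.prems])
  ultimately show ?case using Suc.prems by (simp add: Ck_on_Suc)
qed

text \<open>A formula for the derivative on \<open>U\<close> may replace \<^const>\<open>frechet_derivative\<close>, since \<open>U\<close> is open and
  derivatives only see germs. The basic closure properties are inductions through this rule.\<close>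

lemma Ck_on_SucI:
  assumes "open U" "\<And>x. x \<in> U \<Longrightarrow> (f has_derivative (\<lambda>v. D v x)) (at x)"
    and "\<And>b. b \<in> Basis \<Longrightarrow> Ck_on n (D b) U"
  shows "Ck_on (Suc n) f U"
proof -
  have "Ck_on n (\<lambda>x. frechet_derivative f (at x) b) U" if "b \<in> Basis" for b
  proof (subst Ck_on_cong[OF assms(1), of _ "D b"])
    show "frechet_derivative f (at y) b = D b y" if "y \<in> U" for y
      using frechet_derivative_at[OF assms(2)[OF that]] by metis
  qed (rule assms(3)[OF that])
  moreover have "continuous_on U f"
    using assms(2) by (meson continuous_at_imp_continuous_on has_derivative_continuous)
  ultimately show ?thesis using assms(2) by (auto simp: Ck_on_Suc differentiable_def)
qed

lemma Ck_on_const: "open U \<Longrightarrow> Ck_on n (\<lambda>x. c) U"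
proof (induction n arbitrary: c)
  case (Suc n)
  then show ?case by (intro Ck_on_SucI[where D="\<lambda>_ _. 0"]) auto
qed (simp add: Ck_on_0)

lemma Ck_on_add:
  "open U \<Longrightarrow> Ck_on n f U \<Longrightarrow> Ck_on n g U \<Longrightarrow> Ck_on n (\<lambda>x. f x + g x) U"
proof (induction n arbitrary: f g)
  case (Suc n)
  show ?case
    by (rule Ck_on_SucI[where D="\<lambda>v x. frechet_derivative f (at x) v + frechet_derivative g (at x) v"])
      (use Suc in \<open>auto intro!: has_derivative_add simp: Ck_on_Suc frechet_derivative_works[symmetric]\<close>)
qed (simp add: Ck_on_0 continuous_on_add)

lemma Ck_on_bounded_linear:
  "bounded_linear L \<Longrightarrow> open U \<Longrightarrow> Ck_on n f U \<Longrightarrow> Ck_on n (\<lambda>x. L (f x)) U"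
proof (induction n arbitrary: f)
  case (Suc n)
  show ?case
    by (rule Ck_on_SucI[where D="\<lambda>v x. L (frechet_derivative f (at x) v)"])
      (use Suc in \<open>auto intro!: bounded_linear.has_derivative[OF Suc.prems(1)]
        simp: Ck_on_Suc frechet_derivative_works[symmetric]\<close>)
qed (simp add: Ck_on_0 bounded_linear.continuous_on)

lemma Ck_on_scaleR:
  fixes f :: "'a::euclidean_space \<Rightarrow> real" and g :: "'a \<Rightarrow> 'b::real_normed_vector"
  shows "open U \<Longrightarrow> Ck_on n f U \<Longrightarrow> Ck_on n g U \<Longrightarrow> Ck_on n (\<lambda>x. f x *\<^sub>R g x) U"
proof (induction n arbitrary: f g)
  case (Suc n)
  have "Ck_on n f U" "Ck_on n g U" using Suc.prems Ck_on_mono[of "Suc n" _ U n] by auto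
  with Suc show ?case
    by (intro Ck_on_SucI[where D="\<lambda>v x. f x *\<^sub>R frechet_derivative g (at x) v
          + frechet_derivative f (at x) v *\<^sub>R g x"] Ck_on_add)
      (auto simp: Ck_on_Suc intro!: has_derivative_scaleR simp: frechet_derivative_works[symmetric])
qed (simp add: Ck_on_0 continuous_on_scaleR)

lemma Ck_on_sum:
  "finite I \<Longrightarrow> open U \<Longrightarrow> (\<And>i. i \<in> I \<Longrightarrow> Ck_on n (f i) U) \<Longrightarrow> Ck_on n (\<lambda>x. \<Sum>i\<in>I. f i x) U"
  by (induction I rule: finite_induct) (auto intro: Ck_on_const Ck_on_add)

lemma Ck_on_id: "open U \<Longrightarrow> Ck_on n (\<lambda>x. x) U"
proof (cases n)
  case (Suc m)
  assume "open U"
  then show ?thesis unfolding Suc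
    by (intro Ck_on_SucI[where D="\<lambda>v x. v"] Ck_on_const) (auto intro: has_derivative_ident)
qed (auto simp: Ck_on_0)

lemma Ck_on_mult:
  fixes f :: "'a::euclidean_space \<Rightarrow> real"
  shows "open U \<Longrightarrow> Ck_on n f U \<Longrightarrow> Ck_on n g U \<Longrightarrow> Ck_on n (\<lambda>x. f x * g x) U"
  using Ck_on_scaleR[of U n f g] by simp

lemma Ck_on_inner_left: "open U \<Longrightarrow> Ck_on n f U \<Longrightarrow> Ck_on n (\<lambda>x. f x \<bullet> c) U"
  by (rule Ck_on_bounded_linear[OF bounded_linear_inner_left])

lemma Ck_on_euclidean_iff:
  fixes f :: "'a::euclidean_space \<Rightarrow> 'b::euclidean_space"
  assumes "open U"
  shows "Ck_on n f U \<longleftrightarrow> (\<forall>b\<in>Basis. Ck_on n (\<lambda>x. f x \<bullet> b) U)"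
proof
  assume *: "\<forall>b\<in>Basis. Ck_on n (\<lambda>x. f x \<bullet> b) U"
  have "Ck_on n (\<lambda>x. \<Sum>b\<in>Basis. (f x \<bullet> b) *\<^sub>R b) U"
    using * assms by (intro Ck_on_sum Ck_on_scaleR Ck_on_const) auto
  then show "Ck_on n f U" by (simp add: euclidean_representation)
qed (use Ck_on_inner_left assms in blast)

text \<open>Reduces a derivative in an arbitrary direction to partial derivatives.\<close>

lemma linear_basis_expansion:
  fixes v :: "'a::euclidean_space"
  assumes "linear L"
  shows "L v = (\<Sum>i\<in>Basis. (v \<bullet> i) *\<^sub>R L i)"
  by (metis (no_types, lifting) assms euclidean_representation linear_cmul linear_sum sum.cong)

text \<open>By the chain rule the partial derivatives of \<open>f \<circ> g\<close> are sums of products of partial derivatives of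
  \<open>g\<close> with functions \<open>\<partial>\<^sub>i f \<circ> g\<close>, and the latter fall under the induction hypothesis.\<close>

lemma Ck_on_compose:
  fixes g :: "'a::euclidean_space \<Rightarrow> 'b::euclidean_space" and f :: "'b \<Rightarrow> 'c::real_normed_vector"
  assumes "open U" "open V" "g ` U \<subseteq> V"
  shows "Ck_on n f V \<Longrightarrow> Ck_on n g U \<Longrightarrow> Ck_on n (\<lambda>x. f (g x)) U"
proof (induction n arbitrary: f)
  case 0
  then show ?case using assms(3)
    by (auto simp: Ck_on_0 intro: continuous_on_compose2)
next
  case (Suc n)
  let ?f = "\<lambda>i y. frechet_derivative f (at y) i" and ?g = "\<lambda>v x. frechet_derivative g (at x) v"
  have gn: "Ck_on n g U" using Suc.prems Ck_on_mono[of "Suc n" g U n] by auto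
  show ?case
  proof (rule Ck_on_SucI[OF assms(1), where D="\<lambda>v x. \<Sum>i\<in>Basis. (?g v x \<bullet> i) *\<^sub>R ?f i (g x)"])
    fix x assume x: "x \<in> U"
    have df: "(f has_derivative frechet_derivative f (at (g x))) (at (g x))"
      using Suc.prems x assms(3) by (intro Ck_on_has_derivative) auto
    have "((\<lambda>x. f (g x)) has_derivative (\<lambda>v. frechet_derivative f (at (g x)) (?g v x))) (at x)"
      using diff_chain_at[OF Ck_on_has_derivative[OF Suc.prems(2) x] df] by (simp add: o_def)
    then show "((\<lambda>x. f (g x)) has_derivative (\<lambda>v. \<Sum>i\<in>Basis. (?g v x \<bullet> i) *\<^sub>R ?f i (g x))) (at x)"
      by (simp only: linear_basis_expansion[OF has_derivative_linear[OF df], symmetric])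
  next
    fix b :: 'a assume "b \<in> Basis"
    then show "Ck_on n (\<lambda>x. \<Sum>i\<in>Basis. (?g b x \<bullet> i) *\<^sub>R ?f i (g x)) U"
      using Suc.prems gn assms(1)
      by (intro Ck_on_sum Ck_on_scaleR Ck_on_inner_left Suc.IH) (auto simp: Ck_on_Suc)
  qed
qed

section \<open>Inverse functions and regular level sets\<close>

text \<open>At a zero of \<open>g\<close> the product rule needs only continuity of the other factor. This makes it
  possible to differentiate expressions that contain a function not yet known to be differentiable.\<close>

lemma has_derivative_mult_vanishing:
  fixes h :: "'a::real_normed_vector \<Rightarrow> 'b::real_normed_vector" and g :: "'a \<Rightarrow> real"
  assumes "(g has_derivative g') (at x)" "g x = 0" "isCont h x"
  shows "((\<lambda>y. g y *\<^sub>R h y) has_derivative (\<lambda>v. g' v *\<^sub>R h x)) (at x)"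
proof -
  have g': "bounded_linear g'" using assms(1) by (rule has_derivative_bounded_linear)
  have 1: "((\<lambda>y. (g y - g x - g' (y - x)) /\<^sub>R norm (y - x)) \<longlongrightarrow> 0) (at x)"
    using assms(1) by (simp add: has_derivative_at_within)
  have 2: "((\<lambda>y. (h y - h x)) \<longlongrightarrow> 0) (at x)"
    using assms(3) by (simp add: isCont_def LIM_zero)
  obtain K where K: "\<And>v. norm (g' v) \<le> norm v * K" using bounded_linear.bounded[OF g'] by auto
  have 3: "((\<lambda>y. (g' (y - x) / norm (y - x)) *\<^sub>R (h y - h x)) \<longlongrightarrow> 0) (at x)"
  proof (rule Lim_null_comparison[OF _ tendsto_mult_left_zero])
    show "\<forall>\<^sub>F y in at x. norm ((g' (y - x) / norm (y - x)) *\<^sub>R (h y - h x)) \<le> norm (h y - h x) * \<bar>K\<bar>"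
    proof (rule always_eventually, rule allI)
      fix y
      have "\<bar>g' (y - x)\<bar> / norm (y - x) \<le> \<bar>K\<bar>"
      proof (cases "y = x")
        case False
        then show ?thesis using K[of "y - x"]
          by (simp add: divide_simps) (smt (verit) mult.commute mult_left_mono norm_ge_zero)
      qed simp
      then show "norm ((g' (y - x) / norm (y - x)) *\<^sub>R (h y - h x)) \<le> norm (h y - h x) * \<bar>K\<bar>"
        using mult_right_mono[of "\<bar>g' (y - x)\<bar> / norm (y - x)" "\<bar>K\<bar>" "norm (h y - h x)"]
        by (simp add: mult.commute)
    qed
    show "((\<lambda>y. norm (h y - h x)) \<longlongrightarrow> 0) (at x)"
      using 2 by (simp add: tendsto_norm_zero)
  qed
  have "((\<lambda>y. ((g y - g x - g' (y - x)) /\<^sub>R norm (y - x)) *\<^sub>R h y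
      + (g' (y - x) / norm (y - x)) *\<^sub>R (h y - h x)) \<longlongrightarrow> 0 *\<^sub>R h x + 0) (at x)"
    using assms(3) by (intro tendsto_add tendsto_scaleR 1 3) (simp add: isCont_def)
  moreover have "((g y - g x - g' (y - x)) /\<^sub>R norm (y - x)) *\<^sub>R h y
      + (g' (y - x) / norm (y - x)) *\<^sub>R (h y - h x) =
      (g y *\<^sub>R h y - g x *\<^sub>R h x - g' (y - x) *\<^sub>R h x) /\<^sub>R norm (y - x)" for y
    using assms(2) by (simp add: algebra_simps divide_inverse)
  ultimately have "((\<lambda>y. (g y *\<^sub>R h y - g x *\<^sub>R h x - g' (y - x) *\<^sub>R h x) /\<^sub>R norm (y - x)) \<longlongrightarrow> 0) (at x)"
    by simp
  moreover have "bounded_linear (\<lambda>v. g' v *\<^sub>R h x)"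
    using bounded_linear_compose[OF bounded_linear_scaleR_left g', of "h x"] by simp
  ultimately show ?thesis unfolding has_derivative_at_within by simp
qed

text \<open>If \<open>\<delta>\<close> bounds \<open>A x - A x0\<close> and \<open>K\<close> bounds \<open>B x0\<close>, then \<open>K \<delta> \<le> 1/2\<close> gives the lower bound
  \<open>norm v \<le> 2 K norm (A x v)\<close>. Applied to \<open>v = B x w - B x0 w\<close>, whose image under \<open>A x\<close> is
  \<open>(A x0 - A x) (B x0 w)\<close>, it bounds the increment of the inverse by a multiple of \<open>\<delta>\<close>.\<close>

lemma continuous_on_linear_inverse:
  fixes A B :: "'a::t2_space \<Rightarrow> 'b::euclidean_space \<Rightarrow> 'b"
  assumes U: "open U"
    and lin: "\<And>x. x \<in> U \<Longrightarrow> linear (A x)" "\<And>x. x \<in> U \<Longrightarrow> linear (B x)"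
    and inv: "\<And>x v. x \<in> U \<Longrightarrow> A x (B x v) = v" "\<And>x v. x \<in> U \<Longrightarrow> B x (A x v) = v"
    and A: "\<And>b. b \<in> Basis \<Longrightarrow> continuous_on U (\<lambda>x. A x b)"
  shows "continuous_on U (\<lambda>x. B x w)"
proof (rule continuous_at_imp_continuous_on, rule ballI)
  fix x0 assume x0: "x0 \<in> U"
  obtain K where K: "K > 0" "\<And>v. norm (B x0 v) \<le> K * norm v"
    using linear_bounded_pos[OF lin(2)[OF x0]] by blast
  define \<delta> where "\<delta> x = (\<Sum>i\<in>Basis. norm (A x i - A x0 i))" for x
  have "continuous_on U \<delta>" unfolding \<delta>_def by (intro continuous_intros A)
  then have "isCont \<delta> x0" using U x0 continuous_on_eq_continuous_at by blast
  then have \<delta>0: "(\<delta> \<longlongrightarrow> 0) (at x0)" by (simp add: isCont_def \<delta>_def)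
  have \<delta>: "norm (A x v - A x0 v) \<le> \<delta> x * norm v" if x: "x \<in> U" for x v
  proof -
    have e: "A x v = (\<Sum>i\<in>Basis. (v \<bullet> i) *\<^sub>R A x i)" if "x \<in> U" for x
      by (rule linear_basis_expansion[OF lin(1)[OF that]])
    have "A x v - A x0 v = (\<Sum>i\<in>Basis. (v \<bullet> i) *\<^sub>R (A x i - A x0 i))"
      by (simp add: e[OF x] e[OF x0] sum_subtractf scaleR_diff_right)
    also have "norm \<dots> \<le> (\<Sum>i\<in>Basis. \<bar>v \<bullet> i\<bar> * norm (A x i - A x0 i))"
      by (rule sum_norm_le) simp
    also have "\<dots> \<le> (\<Sum>i\<in>Basis. norm v * norm (A x i - A x0 i))"
      by (intro sum_mono mult_right_mono) (auto simp: Basis_le_norm)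
    finally show ?thesis by (simp add: \<delta>_def sum_distrib_left mult.commute)
  qed
  have "\<forall>\<^sub>F x in at x0. \<delta> x < 1 / (2 * K)"
    using K(1) by (intro order_tendstoD[OF \<delta>0]) auto
  moreover have "\<forall>\<^sub>F x in at x0. x \<in> U"
    using U x0 by (simp add: eventually_at_in_open')
  ultimately have "\<forall>\<^sub>F x in at x0. norm (B x w - B x0 w) \<le> \<delta> x * (2 * K * norm (B x0 w))"
  proof eventually_elim
    case (elim x)
    let ?v = "B x w - B x0 w"
    have Kd: "K * \<delta> x \<le> 1 / 2" using elim K(1) by (simp add: field_simps)
    have "norm ?v = norm (B x0 (A x0 ?v))" using inv[OF x0] by simp
    also have "\<dots> \<le> K * norm (A x0 ?v)" by (rule K)
    also have "\<dots> \<le> K * (norm (A x ?v) + \<delta> x * norm ?v)"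
      using \<delta>[OF elim(2), of ?v] K(1) norm_triangle_ineq2[of "A x0 ?v" "A x ?v"]
      by (intro mult_left_mono) (auto simp: norm_minus_commute)
    also have "\<dots> \<le> K * norm (A x ?v) + 1 / 2 * norm ?v"
      using mult_right_mono[OF Kd, of "norm ?v"] by (simp add: algebra_simps)
    finally have "norm ?v \<le> 2 * K * norm (A x ?v)" by simp
    also have "A x ?v = - (A x (B x0 w) - A x0 (B x0 w))"
      using inv[OF elim(2)] inv[OF x0] by (simp add: linear_diff[OF lin(1)[OF elim(2)]])
    also have "2 * K * norm \<dots> \<le> 2 * K * (\<delta> x * norm (B x0 w))"
      using \<delta>[OF elim(2), of "B x0 w"] K(1) by (simp only: norm_minus_cancel) simp
    finally show ?case by (simp add: mult_ac)
  qed
  moreover have "((\<lambda>x. \<delta> x * (2 * K * norm (B x0 w))) \<longlongrightarrow> 0) (at x0)"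
    by (rule tendsto_mult_left_zero[OF \<delta>0])
  ultimately have "((\<lambda>x. B x w - B x0 w) \<longlongrightarrow> 0) (at x0)"
    by (rule Lim_null_comparison)
  then show "isCont (\<lambda>x. B x w) x0" by (simp add: isCont_def LIM_zero_iff)
qed

text \<open>The identity \<open>B x - B x0 = - B x (A x - A x0) B x0\<close> yields the derivative \<open>- B (\<partial>A) B\<close>. It expresses
  the derivative of the inverse by the inverse itself, so that each step of the induction gains
  one order.\<close>

lemma Ck_on_linear_inverse:
  fixes A B :: "'a::euclidean_space \<Rightarrow> 'b::euclidean_space \<Rightarrow> 'b"
  assumes U: "open U"
    and lin: "\<And>x. x \<in> U \<Longrightarrow> linear (A x)" "\<And>x. x \<in> U \<Longrightarrow> linear (B x)"
    and inv: "\<And>x v. x \<in> U \<Longrightarrow> A x (B x v) = v" "\<And>x v. x \<in> U \<Longrightarrow> B x (A x v) = v"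
    and A: "\<And>b. b \<in> Basis \<Longrightarrow> Ck_on n (\<lambda>x. A x b) U"
  shows "b \<in> Basis \<Longrightarrow> Ck_on n (\<lambda>x. B x b) U"
  using A
proof (induction n arbitrary: b)
  case 0
  then show ?case using continuous_on_linear_inverse[OF U lin inv] by (auto simp: Ck_on_0)
next
  case (Suc n)
  let ?A = "\<lambda>i c x. frechet_derivative (\<lambda>x. A x i) (at x) c"
  have Bn: "Ck_on n (\<lambda>x. B x b) U" if "b \<in> Basis" for b
    using Suc.IH[OF that] Suc.prems(2) Ck_on_mono[of "Suc n" _ U n] by auto
  have AS: "Ck_on (Suc n) (\<lambda>x. A x i) U" if "i \<in> Basis" for i
    using Suc.prems that by auto
  define D where "D = (\<lambda>c x. - (\<Sum>i\<in>Basis. \<Sum>j\<in>Basis. ((B x b \<bullet> i) * (?A i c x \<bullet> j)) *\<^sub>R B x j))"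
  show ?case
  proof (rule Ck_on_SucI[OF U, where D=D])
    fix x0 assume x0: "x0 \<in> U"
    have key: "B x b = B x0 b - (\<Sum>i\<in>Basis. \<Sum>j\<in>Basis. (((B x0 b \<bullet> i) * (A x i \<bullet> j - A x0 i \<bullet> j)) *\<^sub>R B x j))"
      if x: "x \<in> U" for x
    proof -
      have e1: "B x w = (\<Sum>j\<in>Basis. (w \<bullet> j) *\<^sub>R B x j)" for w
        by (rule linear_basis_expansion[OF lin(2)[OF x]])
      have e2: "A x v = (\<Sum>i\<in>Basis. (v \<bullet> i) *\<^sub>R A x i)" if "x \<in> U" for v x
        by (rule linear_basis_expansion[OF lin(1)[OF that]])
      have "B x b - B x0 b = - B x (A x (B x0 b) - A x0 (B x0 b))"
        using inv[OF x] inv[OF x0] by (simp add: linear_diff[OF lin(2)[OF x]])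
      also have "A x (B x0 b) - A x0 (B x0 b) = (\<Sum>i\<in>Basis. (B x0 b \<bullet> i) *\<^sub>R (A x i - A x0 i))"
        by (subst (1 2) e2) (use x x0 in \<open>simp_all add: sum_subtractf[symmetric] scaleR_diff_right\<close>)
      also have "B x \<dots> = (\<Sum>i\<in>Basis. (B x0 b \<bullet> i) *\<^sub>R B x (A x i - A x0 i))"
        by (simp add: linear_sum[OF lin(2)[OF x]] linear_cmul[OF lin(2)[OF x]])
      also have "\<dots> = (\<Sum>i\<in>Basis. \<Sum>j\<in>Basis. (((B x0 b \<bullet> i) * (A x i \<bullet> j - A x0 i \<bullet> j)) *\<^sub>R B x j))"
        by (subst e1) (simp add: scaleR_sum_right inner_diff_left)
      finally show ?thesis by (simp add: algebra_simps)
    qed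
    have "((\<lambda>x. B x0 b - (\<Sum>i\<in>Basis. \<Sum>j\<in>Basis. (((B x0 b \<bullet> i) * (A x i \<bullet> j - A x0 i \<bullet> j)) *\<^sub>R B x j)))
      has_derivative (\<lambda>v. 0 - (\<Sum>i\<in>Basis. \<Sum>j\<in>Basis. ((B x0 b \<bullet> i) * (?A i v x0 \<bullet> j)) *\<^sub>R B x0 j))) (at x0)"
    proof (intro has_derivative_diff has_derivative_const has_derivative_sum has_derivative_mult_vanishing)
      fix i j :: 'b assume i: "i \<in> Basis" "j \<in> Basis"
      have "((\<lambda>x. A x i) has_derivative (\<lambda>v. ?A i v x0)) (at x0)"
        using Ck_on_has_derivative[OF AS[OF i(1)] x0] .
      then have "((\<lambda>x. A x i \<bullet> j - A x0 i \<bullet> j) has_derivative (\<lambda>v. ?A i v x0 \<bullet> j - 0)) (at x0)"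
        by (intro has_derivative_diff has_derivative_inner_left has_derivative_const)
      from has_derivative_mult_right[OF this]
      show "((\<lambda>x. (B x0 b \<bullet> i) * (A x i \<bullet> j - A x0 i \<bullet> j)) has_derivative
          (\<lambda>v. (B x0 b \<bullet> i) * (?A i v x0 \<bullet> j))) (at x0)" by simp
      show "isCont (\<lambda>x. B x j) x0" using Ck_on_continuous[OF Bn[OF i(2)]] U x0 continuous_on_eq_continuous_at by blast
    qed simp
    then show "((\<lambda>x. B x b) has_derivative (\<lambda>v. D v x0)) (at x0)"
      unfolding D_def using has_derivative_transform_within_open[OF _ U x0 key[symmetric]] by auto
  next
    fix c :: 'a assume c: "c \<in> Basis"
    have "Ck_on n (\<lambda>x. - D c x) U" unfolding D_def
      using c AS Bn Suc.prems(1) U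
      by (auto intro!: Ck_on_sum Ck_on_scaleR Ck_on_mult Ck_on_inner_left simp: Ck_on_Suc)
    from Ck_on_bounded_linear[OF bounded_linear_minus[OF bounded_linear_ident] U this]
    show "Ck_on n (D c) U" by simp
  qed
qed

text \<open>The derivative of the local inverse \<open>\<psi>\<close> at \<open>y\<close> is the inverse of the derivative of \<open>\<phi>\<close> at \<open>\<psi> y\<close>;
  hence if \<open>\<psi>\<close> is of class \<open>C\<^sup>m\<close> then so is its derivative, as long as \<open>m \<le> n\<close>.\<close>

theorem Ck_inverse_function:
  fixes \<phi> :: "'a::euclidean_space \<Rightarrow> 'a"
  assumes W: "open W" "x0 \<in> W" and C: "Ck_on (Suc n) \<phi> W"
    and inj: "\<And>v. frechet_derivative \<phi> (at x0) v = 0 \<Longrightarrow> v = 0"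
  obtains U V \<psi> where "x0 \<in> U" "U \<subseteq> W" "Ck_diffeomorphism (Suc n) U V \<phi> \<psi>"
proof -
  let ?D = "\<lambda>x. frechet_derivative \<phi> (at x)"
  have hd: "(\<phi> has_derivative ?D x) (at x)" if "x \<in> W" for x
    by (rule Ck_on_has_derivative[OF C that])
  define f' where "f' x = Blinfun (?D x)" for x
  have f': "blinfun_apply (f' x) = ?D x" if "x \<in> W" for x
    unfolding f'_def using has_derivative_bounded_linear[OF hd[OF that]] by (rule bounded_linear_Blinfun_apply)
  have "linear (?D x0)" by (rule has_derivative_linear[OF hd[OF W(2)]])
  moreover from this have "inj (?D x0)"
    using linear_injective_0 inj by blast
  ultimately obtain g where g: "linear g" "\<And>v. g (?D x0 v) = v"
    using linear_injective_left_inverse[of "?D x0"] by (metis comp_apply id_apply)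
  have gb: "bounded_linear g" using g(1) by (simp add: linear_conv_bounded_linear)
  have f'_cont: "continuous_on W f'"
  proof (rule continuous_on_blinfun_componentwise)
    fix i :: 'a assume "i \<in> Basis"
    then have "continuous_on W (\<lambda>x. ?D x i)"
      using C by (auto simp: Ck_on_Suc intro: Ck_on_continuous)
    then show "continuous_on W (\<lambda>x. f' x i)" by (simp add: f' cong: continuous_on_cong)
  qed
  have left_inv: "Blinfun g o\<^sub>L f' x0 = id_blinfun"
    by (rule blinfun_eqI) (simp add: f' W g bounded_linear_Blinfun_apply[OF gb])
  obtain U V \<psi> g' where UV: "open U" "U \<subseteq> W" "x0 \<in> U" "open V" "\<phi> x0 \<in> V" "homeomorphism U V \<phi> \<psi>"
    and g': "\<And>y. y \<in> V \<Longrightarrow> (\<psi> has_derivative g' y) (at y)"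
    and g'_eq: "\<And>y. y \<in> V \<Longrightarrow> g' y = inv (f' (\<psi> y))" and bij: "\<And>y. y \<in> V \<Longrightarrow> bij (f' (\<psi> y))"
  proof (rule inverse_function_theorem[OF W(1) _ f'_cont W(2) left_inv, of \<phi>])
    show "(\<phi> has_derivative blinfun_apply (f' x)) (at x)" if "x \<in> W" for x
      using hd f' that by simp
  qed auto
  have \<psi>V: "\<psi> y \<in> U" if "y \<in> V" for y using UV(6) that by (auto simp: homeomorphism_def)
  have \<psi>C: "Ck_on m \<psi> V" if "m \<le> Suc n" for m using that
  proof (induction m)
    case 0
    then show ?case using UV(6) by (simp add: Ck_on_0 homeomorphism_def)
  next
    case (Suc m)
    have cA: "Ck_on m (\<lambda>y. ?D (\<psi> y) b) V" if "b \<in> Basis" for b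
    proof (rule Ck_on_compose[OF UV(4) W(1), of \<psi> m "\<lambda>x. ?D x b"])
      show "Ck_on m (\<lambda>x. ?D x b) W" using C that Suc.prems by (auto simp: Ck_on_Suc intro: Ck_on_mono)
      show "Ck_on m \<psi> V" using Suc by simp
    qed (use \<psi>V UV in auto)
    have fD: "blinfun_apply (f' (\<psi> y)) = ?D (\<psi> y)" if "y \<in> V" for y using f' \<psi>V[OF that] UV by auto
    have inv: "?D (\<psi> y) (g' y v) = v" "g' y (?D (\<psi> y) v) = v" if "y \<in> V" for y v
      using bij[OF that] g'_eq[OF that] fD[OF that]
      by (auto simp: bij_is_surj surj_f_inv_f bij_is_inj)
    have lin: "linear (?D (\<psi> y))" "linear (g' y)" if "y \<in> V" for y
      using has_derivative_linear g'[OF that] hd \<psi>V[OF that] UV by blast+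
    show ?case
      by (rule Ck_on_SucI[OF UV(4), where D="\<lambda>v y. g' y v"], rule g', assumption)
        (rule Ck_on_linear_inverse[OF UV(4), of "\<lambda>y. ?D (\<psi> y)"], use lin inv cA in auto)
  qed
  have "Ck_diffeomorphism (Suc n) U V \<phi> \<psi>"
    using UV \<psi>C[of "Suc n"] Ck_on_subset[OF C] by (auto simp: Ck_diffeomorphism_def)
  with UV that show ?thesis by blast
qed

text \<open>Near a point with gradient \<open>N \<noteq> 0\<close> the chart keeps the coordinates orthogonal to \<open>N\<close> and takes
  \<open>G - c\<close> as the coordinate along \<open>N\<close>. It carries the level set to the hyperplane orthogonal to \<open>N\<close>.\<close>

theorem Ck_submanifold_level_set:
  fixes G :: "'a::euclidean_space \<Rightarrow> real"
  assumes G: "Ck_on (Suc n) G UNIV"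
    and reg: "\<And>x. G x = c \<Longrightarrow> \<exists>v. frechet_derivative G (at x) v \<noteq> 0"
  shows "Ck_submanifold (Suc n) (DIM('a) - 1) {x. G x = c}"
  unfolding Ck_submanifold_def
proof (intro ballI)
  fix x0 assume "x0 \<in> {x. G x = c}"
  then have x0: "G x0 = c" by simp
  let ?D = "frechet_derivative G (at x0)"
  have hdG: "(G has_derivative ?D) (at x0)" by (rule Ck_on_has_derivative[OF G]) simp
  define N where "N = (\<Sum>b\<in>Basis. ?D b *\<^sub>R b)"
  have N: "?D v = v \<bullet> N" for v
    by (subst linear_basis_expansion[OF has_derivative_linear[OF hdG]])
      (simp add: N_def inner_sum_right mult.commute)
  have N0: "N \<noteq> 0" using reg[OF x0] N by auto
  define M where "M = (1 / (N \<bullet> N)) *\<^sub>R N"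
  have MN: "M \<bullet> N = 1" using N0 by (simp add: M_def)
  define \<phi> where "\<phi> x = (x - x0) - ((x - x0) \<bullet> N) *\<^sub>R M + (G x - c) *\<^sub>R N" for x
  have \<phi>N: "\<phi> x \<bullet> N = (G x - c) * (N \<bullet> N)" for x
    by (simp add: \<phi>_def inner_diff_left inner_add_left MN)
  have "Ck_on (Suc n) (\<lambda>x. (x + - x0) + (-1) *\<^sub>R (((x + - x0) \<bullet> N) *\<^sub>R M) + (G x + - c) *\<^sub>R N) UNIV"
    using G by (intro Ck_on_add Ck_on_scaleR Ck_on_inner_left Ck_on_const Ck_on_id) auto
  then have C\<phi>: "Ck_on (Suc n) \<phi> UNIV" by (simp add: \<phi>_def[abs_def])
  have "(\<phi> has_derivative (\<lambda>v. (v - 0) - ((v - 0) \<bullet> N) *\<^sub>R M + (?D v - 0) *\<^sub>R N)) (at x0)"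
    unfolding \<phi>_def[abs_def]
    by (intro has_derivative_add has_derivative_diff has_derivative_scaleR_left
        has_derivative_inner_left has_derivative_ident has_derivative_const hdG)
  then have hd\<phi>: "(\<phi> has_derivative (\<lambda>v. v - (v \<bullet> N) *\<^sub>R M + (v \<bullet> N) *\<^sub>R N)) (at x0)"
    by (simp add: N)
  obtain U V \<psi> where UV: "x0 \<in> U" "Ck_diffeomorphism (Suc n) U V \<phi> \<psi>"
  proof (rule Ck_inverse_function[OF open_UNIV UNIV_I C\<phi>])
    fix v assume "frechet_derivative \<phi> (at x0) v = 0"
    then have *: "v - (v \<bullet> N) *\<^sub>R M + (v \<bullet> N) *\<^sub>R N = 0"
      using fun_cong[OF frechet_derivative_at[OF hd\<phi>], of v] by simp
    have "(v - (v \<bullet> N) *\<^sub>R M + (v \<bullet> N) *\<^sub>R N) \<bullet> N = (v \<bullet> N) * (N \<bullet> N)"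
      by (simp add: inner_diff_left inner_add_left MN)
    with * N0 have "v \<bullet> N = 0" by simp
    with * show "v = 0" by simp
  qed (rule that)
  let ?L = "{y. N \<bullet> y = 0}"
  have "\<phi> ` ({x. G x = c} \<inter> U) = V \<inter> ?L"
  proof -
    have "\<phi> x \<in> ?L \<longleftrightarrow> G x = c" for x
      using \<phi>N[of x] N0 by (simp add: inner_commute)
    moreover have "\<phi> ` U = V" using UV(2) by (auto simp: Ck_diffeomorphism_def homeomorphism_def)
    ultimately show ?thesis by blast
  qed
  then show "\<exists>U V \<phi> \<psi> L. x0 \<in> U \<and> Ck_diffeomorphism (Suc n) U V \<phi> \<psi> \<and> subspace L \<and>
      dim L = DIM('a) - 1 \<and> \<phi> ` ({x. G x = c} \<inter> U) = V \<inter> L"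
    using UV subspace_hyperplane[of N] dim_hyperplane[OF N0] by blast
qed

section \<open>Regularized homogeneous kernels\<close>

text \<open>A smooth substitute for the norm, which it approaches from above as \<open>\<epsilon> \<longlongrightarrow> 0\<close>. All kernels below are
  regularized by replacing the norm with it.\<close>

definition regnorm :: "real \<Rightarrow> 'a::euclidean_space \<Rightarrow> real"
  where "regnorm \<epsilon> y = sqrt ((norm y)\<^sup>2 + \<epsilon>\<^sup>2)"

lemma regnorm_0 [simp]: "regnorm 0 y = norm y"
  by (simp add: regnorm_def)

lemma norm_le_regnorm: "norm y \<le> regnorm \<epsilon> y"
  unfolding regnorm_def by (rule real_le_rsqrt) simp

lemma abs_le_regnorm: "\<bar>\<epsilon>\<bar> \<le> regnorm \<epsilon> y"
  unfolding regnorm_def by (rule real_le_rsqrt) simp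

lemma regnorm_nonneg [simp]: "0 \<le> regnorm \<epsilon> y"
  by (simp add: regnorm_def)

lemma regnorm_pos: "\<epsilon> \<noteq> 0 \<or> y \<noteq> 0 \<Longrightarrow> 0 < regnorm \<epsilon> y"
  using norm_le_regnorm[of y \<epsilon>] abs_le_regnorm[of \<epsilon> y] by (metis abs_le_zero_iff less_eq_real_def
      norm_le_zero_iff regnorm_nonneg)

lemma regnorm_le: "regnorm \<epsilon> y \<le> norm y + \<bar>\<epsilon>\<bar>"
  unfolding regnorm_def using sqrt_sum_squares_le_sum_abs[of "norm y" \<epsilon>] by simp

lemma has_derivative_regnorm:
  assumes "\<epsilon> \<noteq> 0"
  shows "(regnorm \<epsilon> has_derivative (\<lambda>v. (y \<bullet> v) / regnorm \<epsilon> y)) (at y)"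
proof -
  have pos: "0 < y \<bullet> y + \<epsilon>\<^sup>2" using assms by (simp add: add_nonneg_pos)
  have "((\<lambda>y. sqrt (y \<bullet> y + \<epsilon>\<^sup>2)) has_derivative
      (\<lambda>v. (y \<bullet> v + v \<bullet> y + 0) * (inverse (sqrt (y \<bullet> y + \<epsilon>\<^sup>2)) / 2))) (at y)"
    using pos by (intro has_derivative_real_sqrt has_derivative_add has_derivative_const
        has_derivative_inner[OF has_derivative_ident has_derivative_ident])
  then show ?thesis
    by (simp add: regnorm_def[abs_def] power2_norm_eq_inner inner_commute field_simps)
qed

text \<open>With \<open>N\<close> the regularized norm of \<open>y\<close>, the functions \<open>(y \<bullet> b) / N\<close> (\<open>KDir b\<close>) and \<open>1 / N\<close> (\<open>KInv\<close>) generate an algebra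
  that is closed under differentiation. Its elements are represented as syntactic expressions so
  that one expression stands at once for a smooth kernel for every \<open>\<epsilon> \<noteq> 0\<close> and for its singular limit
  at \<open>\<epsilon> = 0\<close>, and so that derivatives can be computed uniformly in \<open>\<epsilon>\<close>.\<close>

datatype 'a kernel = KConst real | KDir 'a | KInv | KAdd "'a kernel" "'a kernel" | KMul "'a kernel" "'a kernel"

primrec keval :: "'a::euclidean_space kernel \<Rightarrow> real \<Rightarrow> 'a \<Rightarrow> real" where
  "keval (KConst c) \<epsilon> y = c"
| "keval (KDir b) \<epsilon> y = (y \<bullet> b) / regnorm \<epsilon> y"
| "keval KInv \<epsilon> y = 1 / regnorm \<epsilon> y"
| "keval (KAdd k l) \<epsilon> y = keval k \<epsilon> y + keval l \<epsilon> y"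
| "keval (KMul k l) \<epsilon> y = keval k \<epsilon> y * keval l \<epsilon> y"

primrec kderiv :: "'a::euclidean_space \<Rightarrow> 'a kernel \<Rightarrow> 'a kernel" where
  "kderiv v (KConst c) = KConst 0"
| "kderiv v (KDir b) = KMul (KAdd (KConst (v \<bullet> b)) (KMul (KConst (-1)) (KMul (KDir b) (KDir v)))) KInv"
| "kderiv v KInv = KMul (KMul (KConst (-1)) (KDir v)) (KMul KInv KInv)"
| "kderiv v (KAdd k l) = KAdd (kderiv v k) (kderiv v l)"
| "kderiv v (KMul k l) = KAdd (KMul (kderiv v k) l) (KMul k (kderiv v l))"

text \<open>An expression of order \<open>m\<close> is bounded by a multiple of \<open>1 / N\<^sup>m\<close>. The zero constant has every
  order because it arises as the derivative of constants, which must raise the order by one.\<close>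

primrec has_order :: "'a kernel \<Rightarrow> nat \<Rightarrow> bool" where
  "has_order (KConst c) m \<longleftrightarrow> m = 0 \<or> c = 0"
| "has_order (KDir b) m \<longleftrightarrow> m = 0"
| "has_order KInv m \<longleftrightarrow> m = 1"
| "has_order (KAdd k l) m \<longleftrightarrow> has_order k m \<and> has_order l m"
| "has_order (KMul k l) m \<longleftrightarrow> (\<exists>i j. m = i + j \<and> has_order k i \<and> has_order l j)"

lemma has_order_kderiv: "has_order k m \<Longrightarrow> has_order (kderiv v k) (Suc m)"
proof (induction k arbitrary: m)
  case (KMul k l)
  then obtain i j where "m = i + j" "has_order k i" "has_order l j" by auto
  with KMul.IH show ?case by simp (metis add_Suc add_Suc_right)
qed auto

lemma keval_bound:
  assumes "has_order k m"
  obtains C where "C \<ge> 0" "\<And>\<epsilon> y. \<epsilon> \<noteq> 0 \<or> y \<noteq> 0 \<Longrightarrow> \<bar>keval k \<epsilon> y\<bar> \<le> C * (1 / regnorm \<epsilon> y) ^ m"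
proof -
  have "\<exists>C\<ge>0. \<forall>\<epsilon> y. \<epsilon> \<noteq> 0 \<or> y \<noteq> 0 \<longrightarrow> \<bar>keval k \<epsilon> y\<bar> \<le> C * (1 / regnorm \<epsilon> y) ^ m"
    using assms
  proof (induction k arbitrary: m)
    case (KConst c)
    then show ?case by (intro exI[of _ "\<bar>c\<bar>"]) auto
  next
    case (KDir b)
    have "\<bar>y \<bullet> b\<bar> / regnorm \<epsilon> y \<le> norm b" if "\<epsilon> \<noteq> 0 \<or> y \<noteq> 0" for \<epsilon> y
    proof -
      have "\<bar>y \<bullet> b\<bar> \<le> norm y * norm b" by (rule Cauchy_Schwarz_ineq2)
      also have "\<dots> \<le> regnorm \<epsilon> y * norm b" by (simp add: mult_right_mono norm_le_regnorm)
      finally show ?thesis using regnorm_pos[OF that] by (simp add: pos_divide_le_eq mult.commute)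
    qed
    then show ?case using KDir by (intro exI[of _ "norm b"]) auto
  next
    case KInv
    then show ?case by (intro exI[of _ 1]) auto
  next
    case (KAdd k l)
    from KAdd.prems KAdd.IH obtain C D
      where C: "C \<ge> 0" "\<And>\<epsilon> y. \<epsilon> \<noteq> 0 \<or> y \<noteq> 0 \<Longrightarrow> \<bar>keval k \<epsilon> y\<bar> \<le> C * (1 / regnorm \<epsilon> y) ^ m"
        and D: "D \<ge> 0" "\<And>\<epsilon> y. \<epsilon> \<noteq> 0 \<or> y \<noteq> 0 \<Longrightarrow> \<bar>keval l \<epsilon> y\<bar> \<le> D * (1 / regnorm \<epsilon> y) ^ m"
      by simp metis
    show ?case
    proof (intro exI[of _ "C + D"] conjI allI impI)
      fix \<epsilon> :: real and y :: 'a assume "\<epsilon> \<noteq> 0 \<or> y \<noteq> 0"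
      from C(2)[OF this] D(2)[OF this]
      show "\<bar>keval (KAdd k l) \<epsilon> y\<bar> \<le> (C + D) * (1 / regnorm \<epsilon> y) ^ m"
        unfolding keval.simps distrib_right by linarith
    qed (use C D in simp)
  next
    case (KMul k l)
    then obtain i j where ij: "m = i + j" "has_order k i" "has_order l j" by auto
    with KMul.IH obtain C D
      where C: "C \<ge> 0" "\<And>\<epsilon> y. \<epsilon> \<noteq> 0 \<or> y \<noteq> 0 \<Longrightarrow> \<bar>keval k \<epsilon> y\<bar> \<le> C * (1 / regnorm \<epsilon> y) ^ i"
        and D: "D \<ge> 0" "\<And>\<epsilon> y. \<epsilon> \<noteq> 0 \<or> y \<noteq> 0 \<Longrightarrow> \<bar>keval l \<epsilon> y\<bar> \<le> D * (1 / regnorm \<epsilon> y) ^ j"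
      by metis
    show ?case
    proof (intro exI[of _ "C * D"] conjI allI impI)
      fix \<epsilon> :: real and y :: 'a assume "\<epsilon> \<noteq> 0 \<or> y \<noteq> 0"
      from mult_mono[OF C(2)[OF this] D(2)[OF this]] C(1)
      show "\<bar>keval (KMul k l) \<epsilon> y\<bar> \<le> (C * D) * (1 / regnorm \<epsilon> y) ^ m"
        by (simp add: abs_mult ij(1) power_add mult_ac)
    qed (use C D in simp)
  qed
  then show ?thesis using that by blast
qed

lemma keval_bound_norm:
  assumes "has_order k m"
  obtains C where "C \<ge> 0" "\<And>\<epsilon> y. y \<noteq> 0 \<Longrightarrow> \<bar>keval k \<epsilon> y\<bar> \<le> C * (1 / norm y) ^ m"
proof -
  obtain C where C: "C \<ge> 0" "\<And>\<epsilon> y. \<epsilon> \<noteq> 0 \<or> y \<noteq> 0 \<Longrightarrow> \<bar>keval k \<epsilon> y\<bar> \<le> C * (1 / regnorm \<epsilon> y) ^ m"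
    using keval_bound[OF assms] by blast
  have "\<bar>keval k \<epsilon> y\<bar> \<le> C * (1 / norm y) ^ m" if "y \<noteq> 0" for \<epsilon> y
  proof -
    have "(1 / regnorm \<epsilon> y) ^ m \<le> (1 / norm y) ^ m"
      using that norm_le_regnorm[of y \<epsilon>] by (intro power_mono divide_left_mono mult_pos_pos) (auto simp: regnorm_pos)
    then show ?thesis using C(2)[of \<epsilon> y] that C(1) by (meson mult_left_mono order_trans)
  qed
  with C(1) that show ?thesis by blast
qed

lemma keval_bounded:
  assumes "has_order k m" "\<epsilon> \<noteq> 0"
  obtains C where "C \<ge> 0" "\<And>y. \<bar>keval k \<epsilon> y\<bar> \<le> C"
proof -
  obtain C where C: "C \<ge> 0" "\<And>\<epsilon> y. \<epsilon> \<noteq> 0 \<or> y \<noteq> 0 \<Longrightarrow> \<bar>keval k \<epsilon> y\<bar> \<le> C * (1 / regnorm \<epsilon> y) ^ m"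
    using keval_bound[OF assms(1)] by blast
  have "\<bar>keval k \<epsilon> y\<bar> \<le> C * (1 / \<bar>\<epsilon>\<bar>) ^ m" for y
  proof -
    have "(1 / regnorm \<epsilon> y) ^ m \<le> (1 / \<bar>\<epsilon>\<bar>) ^ m"
      using assms abs_le_regnorm[of \<epsilon> y] by (intro power_mono divide_left_mono mult_pos_pos) (auto simp: regnorm_pos)
    then show ?thesis using C(2)[of \<epsilon> y] assms C(1) by (meson mult_left_mono order_trans)
  qed
  with C(1) that[of "C * (1 / \<bar>\<epsilon>\<bar>) ^ m"] show ?thesis by simp
qed

lemma keval_has_derivative:
  assumes "\<epsilon> \<noteq> 0"
  shows "(keval k \<epsilon> has_derivative (\<lambda>v. keval (kderiv v k) \<epsilon> y)) (at y)"
proof (induction k)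
  case (KConst c)
  show ?case by simp
next
  case (KDir b)
  have pos: "regnorm \<epsilon> y > 0" using assms by (simp add: regnorm_pos)
  have "((\<lambda>y. (y \<bullet> b) / regnorm \<epsilon> y) has_derivative
    (\<lambda>v. ((v \<bullet> b) * regnorm \<epsilon> y - (y \<bullet> b) * ((y \<bullet> v) / regnorm \<epsilon> y)) / (regnorm \<epsilon> y * regnorm \<epsilon> y))) (at y)"
    using pos by (intro has_derivative_divide' has_derivative_inner_left has_derivative_ident
        has_derivative_regnorm assms) auto
  then show ?case using pos by (simp add: field_simps)
next
  case KInv
  have pos: "regnorm \<epsilon> y > 0" using assms by (simp add: regnorm_pos)
  have "((\<lambda>y. 1 / regnorm \<epsilon> y) has_derivative
    (\<lambda>v. (0 * regnorm \<epsilon> y - 1 * ((y \<bullet> v) / regnorm \<epsilon> y)) / (regnorm \<epsilon> y * regnorm \<epsilon> y))) (at y)"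
    using pos by (intro has_derivative_divide' has_derivative_const
        has_derivative_regnorm assms) auto
  then show ?case using pos by (simp add: field_simps)
next
  case (KAdd k l)
  then show ?case by (simp add: has_derivative_add)
next
  case (KMul k l)
  from has_derivative_mult[OF this] show ?case by (simp add: add.commute)
qed

lemma keval_measurable [measurable]: "keval k \<epsilon> \<in> borel_measurable borel"
proof (induction k)
  case (KDir b)
  show ?case by (simp add: regnorm_def[abs_def])
next
  case KInv
  show ?case by (simp add: regnorm_def[abs_def])
qed auto

lemma keval_bounded_away:
  assumes "\<delta> > 0"
  shows "\<exists>C. \<forall>y. norm y \<ge> \<delta> \<longrightarrow> \<bar>keval k 0 y\<bar> \<le> C"
proof (induction k)
  case (KDir b)
  have "\<bar>y \<bullet> b\<bar> / norm y \<le> norm b" for y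
    using Cauchy_Schwarz_ineq2[of y b] by (cases "y = 0") (auto simp: field_simps)
  then show ?case by (auto intro!: exI[of _ "norm b"])
next
  case KInv
  show ?case using assms by (intro exI[of _ "1 / \<delta>"]) (auto intro: frac_le)
next
  case (KAdd k l)
  then obtain C D where "\<And>y. norm y \<ge> \<delta> \<Longrightarrow> \<bar>keval k 0 y\<bar> \<le> C" "\<And>y. norm y \<ge> \<delta> \<Longrightarrow> \<bar>keval l 0 y\<bar> \<le> D" by metis
  then show ?case by (intro exI[of _ "C + D"]) (smt (verit) keval.simps(4))
next
  case (KMul k l)
  then obtain C D where "\<And>y. norm y \<ge> \<delta> \<Longrightarrow> \<bar>keval k 0 y\<bar> \<le> C" "\<And>y. norm y \<ge> \<delta> \<Longrightarrow> \<bar>keval l 0 y\<bar> \<le> D" by metis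
  then have "norm y \<ge> \<delta> \<Longrightarrow> \<bar>keval (KMul k l) 0 y\<bar> \<le> C * D" for y
    unfolding keval.simps abs_mult by (intro mult_mono) (auto intro: order_trans[OF abs_ge_zero])
  then show ?case by blast
qed auto

definition eps :: "nat \<Rightarrow> real" where "eps n = inverse (real (Suc n))"

lemma eps_pos: "eps n > 0" by (simp add: eps_def)

lemma eps_neq [simp]: "eps n \<noteq> 0" by (simp add: eps_def)

lemma eps_tendsto: "eps \<longlonglongrightarrow> 0"
  unfolding eps_def by (rule LIMSEQ_inverse_real_of_nat)

lemma uniform_limit_of_eps_bound:
  fixes u :: "nat \<Rightarrow> 'a \<Rightarrow> real"
  assumes "\<And>n y. y \<in> S \<Longrightarrow> \<bar>u n y - l y\<bar> \<le> K * eps n"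
  shows "uniform_limit S u l sequentially"
  unfolding uniform_limit_iff
proof (intro allI impI)
  fix e :: real assume "e > 0"
  with tendsto_mult_right_zero[OF eps_tendsto, of K]
  have "\<forall>\<^sub>F n in sequentially. K * eps n < e" by (rule order_tendstoD)
  then show "\<forall>\<^sub>F n in sequentially. \<forall>y\<in>S. dist (u n y) (l y) < e"
    by eventually_elim (auto simp: dist_real_def intro: le_less_trans[OF assms])
qed

text \<open>Only the region near the origin can obstruct uniform convergence of the regularized kernels.\<close>

lemma keval_uniform_limit_away:
  fixes k :: "'a::euclidean_space kernel"
  assumes "\<delta> > 0"
  shows "uniform_limit {y. norm y \<ge> \<delta>} (\<lambda>n. keval k (eps n)) (keval k 0) sequentially"
proof (induction k)
  case (KConst c)
  show ?case by (simp add: uniform_limit_iff)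
next
  case (KDir b)
  have *: "\<bar>keval (KDir b) (eps n) y - keval (KDir b) 0 y\<bar> \<le> norm b * (eps n / \<delta>)" if "norm y \<ge> \<delta>" for n and y :: 'a
  proof -
    have y: "norm y > 0" using that assms by linarith
    have r: "regnorm (eps n) y > 0" by (simp add: regnorm_pos)
    have "keval (KDir b) (eps n) y - keval (KDir b) 0 y = (y \<bullet> b) / norm y * ((norm y - regnorm (eps n) y) / regnorm (eps n) y)"
      using y r by (simp add: field_simps)
    moreover have "\<bar>(y \<bullet> b) / norm y\<bar> \<le> norm b"
      using Cauchy_Schwarz_ineq2[of y b] y by (simp add: field_simps)
    moreover have "\<bar>(norm y - regnorm (eps n) y) / regnorm (eps n) y\<bar> \<le> eps n / \<delta>"
      unfolding abs_divide
      using r that assms norm_le_regnorm[of y "eps n"] regnorm_le[of "eps n" y] eps_pos[of n]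
      by (intro frac_le) auto
    ultimately show ?thesis by (simp only: abs_mult) (intro mult_mono, auto)
  qed
  show ?case
    by (rule uniform_limit_of_eps_bound[of _ _ _ "norm b / \<delta>"]) (use * in simp)
next
  case KInv
  have *: "\<bar>keval KInv (eps n) y - keval KInv 0 y\<bar> \<le> eps n / (\<delta> * \<delta>)" if "norm y \<ge> \<delta>" for n and y :: 'a
  proof -
    have y: "norm y > 0" using that assms by linarith
    have r: "regnorm (eps n) y > 0" by (simp add: regnorm_pos)
    have "keval KInv (eps n) y - keval KInv 0 y = (norm y - regnorm (eps n) y) / (norm y * regnorm (eps n) y)"
      using y r by (simp add: field_simps)
    moreover have "\<bar>(norm y - regnorm (eps n) y) / (norm y * regnorm (eps n) y)\<bar> \<le> eps n / (\<delta> * \<delta>)"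
      unfolding abs_divide abs_mult
      using y r that assms norm_le_regnorm[of y "eps n"] regnorm_le[of "eps n" y] eps_pos[of n]
      by (intro frac_le mult_mono) auto
    ultimately show ?thesis by simp
  qed
  show ?case
    by (rule uniform_limit_of_eps_bound[of _ _ _ "1 / (\<delta> * \<delta>)"]) (use * in simp)
next
  case (KAdd k l)
  from uniform_limit_add[OF this] show ?case by simp
next
  case (KMul k l)
  have bd: "bounded (keval k 0 ` {y. norm y \<ge> \<delta>})" for k
    using keval_bounded_away[OF assms, of k] by (auto simp: bounded_iff)
  from uniform_lim_mult[OF KMul bd bd] show ?case by simp
qed

section \<open>Differentiation under the integral sign\<close>

definition kconv :: "'a::euclidean_space kernel \<Rightarrow> real \<Rightarrow> ('a \<Rightarrow> real) \<Rightarrow> 'a \<Rightarrow> real"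
  where "kconv k \<epsilon> f x = (\<integral>z. keval k \<epsilon> (x - z) * f z \<partial>lborel)"

text \<open>The kernel is Lipschitz, so the difference quotients are dominated by a multiple of \<open>\<bar>f\<bar>\<close>.\<close>

lemma has_derivative_convolution:
  fixes G :: "'a::euclidean_space \<Rightarrow> real"
  assumes G: "\<And>y. (G has_derivative (\<lambda>v. D v y)) (at y)"
    and Gb: "\<And>y. \<bar>G y\<bar> \<le> C0"
    and Dm: "\<And>b. b \<in> Basis \<Longrightarrow> D b \<in> borel_measurable borel"
    and Db: "\<And>b y. b \<in> Basis \<Longrightarrow> \<bar>D b y\<bar> \<le> C"
    and f: "integrable lborel f"
  shows "((\<lambda>x. \<integral>z. G (x - z) * f z \<partial>lborel) has_derivative
           (\<lambda>v. \<integral>z. D v (x - z) * f z \<partial>lborel)) (at x)"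
proof -
  have fm [measurable]: "f \<in> borel_measurable lborel" using f by simp
  have Gm [measurable]: "G \<in> borel_measurable borel"
    using G by (intro borel_measurable_continuous_onI continuous_at_imp_continuous_on ballI)
      (rule has_derivative_continuous)
  have lin: "linear (\<lambda>v. D v y)" for y by (rule has_derivative_linear[OF G])
  have De: "D v = (\<lambda>y. \<Sum>b\<in>Basis. (v \<bullet> b) * D b y)" for v
    by (rule ext, subst linear_basis_expansion[OF lin]) simp
  have Dvm [measurable]: "D v \<in> borel_measurable borel" for v
    by (subst De) (use Dm in auto)
  have C: "C \<ge> 0" using Db[OF SOME_Basis] abs_ge_zero order_trans by blast
  define K where "K = C * DIM('a)"
  have K: "K \<ge> 0" using C by (simp add: K_def)
  have DK: "\<bar>D v y\<bar> \<le> K * norm v" for v y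
  proof -
    have "\<bar>D v y\<bar> \<le> (\<Sum>b\<in>Basis. \<bar>(v \<bullet> b) * D b y\<bar>)" by (subst De) (rule sum_abs)
    also have "\<dots> \<le> (\<Sum>b\<in>(Basis::'a set). norm v * C)"
      using Db by (intro sum_mono) (auto simp: abs_mult Basis_le_norm intro!: mult_mono)
    finally show ?thesis by (simp add: K_def mult_ac)
  qed
  have lip: "\<bar>G a - G b\<bar> \<le> K * norm (a - b)" for a b
  proof -
    have "onorm (\<lambda>v. D v y) \<le> K" for y by (rule onorm_le) (use DK in simp)
    then show ?thesis
      using differentiable_bound[OF convex_UNIV, of G "\<lambda>y v. D v y" K a b] G by (auto simp: has_derivative_at_withinI)
  qed
  have Dint: "integrable lborel (\<lambda>z. D v (x - z) * f z)" for v
  proof (rule Bochner_Integration.integrable_bound[of _ "\<lambda>z. (K * norm v) * f z"])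
    show "AE z in lborel. norm (D v (x - z) * f z) \<le> norm (K * norm v * f z)"
      using DK K by (auto simp: abs_mult intro!: mult_right_mono)
  qed (use f in auto)
  have Gint: "integrable lborel (\<lambda>z. G (x - z) * f z)" for x
  proof (rule Bochner_Integration.integrable_bound[of _ "\<lambda>z. C0 * f z"])
    have "C0 \<ge> 0" using Gb abs_ge_zero order_trans by blast
    then show "AE z in lborel. norm (G (x - z) * f z) \<le> norm (C0 * f z)"
      using Gb by (auto simp: abs_mult intro!: mult_right_mono)
  qed (use f in auto)
  have bl: "bounded_linear (\<lambda>v. \<integral>z. D v (x - z) * f z \<partial>lborel)"
  proof (rule bounded_linear_intro)
    fix v w :: 'a and r :: real
    show "(\<integral>z. D (v + w) (x - z) * f z \<partial>lborel) = (\<integral>z. D v (x - z) * f z \<partial>lborel) + (\<integral>z. D w (x - z) * f z \<partial>lborel)"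
      using Dint by (simp add: linear_add[OF lin] distrib_right)
    show "(\<integral>z. D (r *\<^sub>R v) (x - z) * f z \<partial>lborel) = r *\<^sub>R (\<integral>z. D v (x - z) * f z \<partial>lborel)"
      by (simp add: linear_cmul[OF lin] mult.assoc)
    have "norm (\<integral>z. D v (x - z) * f z \<partial>lborel) \<le> (\<integral>z. norm (D v (x - z) * f z) \<partial>lborel)"
      by (rule integral_norm_bound)
    also have "\<dots> \<le> (\<integral>z. (K * norm v) * \<bar>f z\<bar> \<partial>lborel)"
      using Dint f DK by (intro integral_mono integrable_norm) (auto simp: abs_mult intro!: mult_right_mono)
    finally show "norm (\<integral>z. D v (x - z) * f z \<partial>lborel) \<le> norm v * (K * (\<integral>z. \<bar>f z\<bar> \<partial>lborel))"
      by (simp add: mult_ac)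
  qed
  have "((\<lambda>h. norm ((\<integral>z. G (x + h - z) * f z \<partial>lborel) - (\<integral>z. G (x - z) * f z \<partial>lborel) - (\<integral>z. D h (x - z) * f z \<partial>lborel)) / norm h)
      \<longlongrightarrow> 0) (at 0)"
    unfolding tendsto_at_iff_sequentially
  proof (intro allI impI)
    fix X :: "nat \<Rightarrow> 'a" assume X: "\<forall>i. X i \<in> UNIV - {0}" "X \<longlonglongrightarrow> 0"
    define r where "r i z = (G (x + X i - z) - G (x - z) - D (X i) (x - z)) / norm (X i) * f z" for i z
    have [measurable]: "r i \<in> borel_measurable lborel" for i unfolding r_def by measurable
    have "(\<lambda>i. \<integral>z. r i z \<partial>lborel) \<longlonglongrightarrow> (\<integral>(z::'a). 0 \<partial>lborel)"
    proof (rule integral_dominated_convergence[where f="\<lambda>_. 0" and s=r and w="\<lambda>z. 2 * K * \<bar>f z\<bar>"])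
      show "AE z in lborel. (\<lambda>i. r i z) \<longlonglongrightarrow> 0"
      proof (rule AE_I2)
        fix z
        have "((\<lambda>h. norm (G ((x - z) + h) - G (x - z) - D h (x - z)) / norm h) \<longlongrightarrow> 0) (at 0)"
          using G[of "x - z"] by (simp add: has_derivative_at)
        then have "(\<lambda>i. norm (G ((x - z) + X i) - G (x - z) - D (X i) (x - z)) / norm (X i)) \<longlonglongrightarrow> 0"
          using X by (auto simp: tendsto_at_iff_sequentially o_def)
        then have "(\<lambda>i. (norm (G ((x - z) + X i) - G (x - z) - D (X i) (x - z)) / norm (X i)) * \<bar>f z\<bar>) \<longlonglongrightarrow> 0"
          by (rule tendsto_mult_left_zero)
        moreover have "(norm (G ((x - z) + X i) - G (x - z) - D (X i) (x - z)) / norm (X i)) * \<bar>f z\<bar> = norm (r i z)" for i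
          by (simp add: r_def abs_mult diff_add_eq)
        ultimately show "(\<lambda>i. r i z) \<longlonglongrightarrow> 0" by (simp add: tendsto_rabs_zero_iff)
      qed
      show "AE z in lborel. norm (r i z) \<le> 2 * K * \<bar>f z\<bar>" for i
      proof (rule AE_I2)
        fix z
        have "\<bar>G (x + X i - z) - G (x - z) - D (X i) (x - z)\<bar> \<le> 2 * K * norm (X i)"
          using lip[of "x + X i - z" "x - z"] DK[of "X i" "x - z"] by (simp add: algebra_simps)
        moreover have "norm (X i) > 0" using X by auto
        ultimately have "\<bar>(G (x + X i - z) - G (x - z) - D (X i) (x - z)) / norm (X i)\<bar> \<le> 2 * K"
          by (simp add: pos_divide_le_eq)
        then show "norm (r i z) \<le> 2 * K * \<bar>f z\<bar>"
          unfolding r_def real_norm_def abs_mult by (rule mult_right_mono) simp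
      qed
    qed (use f in auto)
    moreover have "norm (\<integral>z. r i z \<partial>lborel) = norm ((\<integral>z. G (x + X i - z) * f z \<partial>lborel) - (\<integral>z. G (x - z) * f z \<partial>lborel)
       - (\<integral>z. D (X i) (x - z) * f z \<partial>lborel)) / norm (X i)" for i
    proof -
      have "(\<integral>z. r i z \<partial>lborel) = (\<integral>z. (G (x + X i - z) * f z - G (x - z) * f z - D (X i) (x - z) * f z) / norm (X i) \<partial>lborel)"
        unfolding r_def by (intro Bochner_Integration.integral_cong) (auto simp: algebra_simps diff_divide_distrib)
      also have "\<dots> = ((\<integral>z. G (x + X i - z) * f z \<partial>lborel) - (\<integral>z. G (x - z) * f z \<partial>lborel)
       - (\<integral>z. D (X i) (x - z) * f z \<partial>lborel)) / norm (X i)"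
        using Gint Dint by simp
      finally show ?thesis by simp
    qed
    ultimately show "((\<lambda>h. norm ((\<integral>z. G (x + h - z) * f z \<partial>lborel) - (\<integral>z. G (x - z) * f z \<partial>lborel)
       - (\<integral>z. D h (x - z) * f z \<partial>lborel)) / norm h) \<circ> X) \<longlonglongrightarrow> 0"
      using tendsto_norm_zero by (fastforce simp: o_def)
  qed
  with bl show ?thesis by (simp add: has_derivative_at)
qed

lemma kconv_has_derivative:
  assumes "has_order k m" "\<epsilon> \<noteq> 0" "integrable lborel f"
  shows "(kconv k \<epsilon> f has_derivative (\<lambda>v. kconv (kderiv v k) \<epsilon> f x)) (at x)"
proof -
  obtain C0 where C0: "\<And>y. \<bar>keval k \<epsilon> y\<bar> \<le> C0" using keval_bounded[OF assms(1,2)] by blast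
  have "\<exists>C. \<forall>y. \<bar>keval (kderiv b k) \<epsilon> y\<bar> \<le> C" for b
    using keval_bounded[OF has_order_kderiv[OF assms(1)] assms(2), of b] by blast
  then obtain C where C: "\<And>b y. \<bar>keval (kderiv b k) \<epsilon> y\<bar> \<le> C b" by metis
  have "\<bar>keval (kderiv b k) \<epsilon> y\<bar> \<le> (\<Sum>b\<in>Basis. \<bar>C b\<bar>)" if "b \<in> Basis" for b y
    using C[of b y] member_le_sum[OF that, of "\<lambda>b. \<bar>C b\<bar>"] by fastforce
  note Cb = this
  show ?thesis unfolding kconv_def[abs_def]
    by (rule has_derivative_convolution[OF keval_has_derivative[OF assms(2)] C0 _ Cb assms(3)]) simp_all
qed

section \<open>Uniform convergence of the regularized integrals\<close>

definition inv_norm_pow :: "nat \<Rightarrow> 'a::euclidean_space \<Rightarrow> real" where "inv_norm_pow m y = (1 / norm y) ^ m"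

lemma inv_norm_pow_nonneg [simp]: "0 \<le> inv_norm_pow m y" by (simp add: inv_norm_pow_def)

lemma inv_norm_pow_eq_powr: "y \<noteq> 0 \<Longrightarrow> inv_norm_pow m y = norm y powr - real m"
  by (simp add: inv_norm_pow_def powr_minus powr_realpow power_one_over inverse_eq_divide)

lemma inv_norm_pow_measurable [measurable]: "inv_norm_pow m \<in> borel_measurable borel"
  by (simp add: inv_norm_pow_def[abs_def])

text \<open>The part of \<open>\<integral> \<bar>x - z\<bar>\<^sup>-\<^sup>m \<bar>h x z\<bar> dz\<close> that comes from \<open>\<bar>x - z\<bar> < \<delta>\<close> tends to zero with \<open>\<delta>\<close>, uniformly in
  \<open>x \<in> B\<close>: a condition of Kato type. The density may depend on \<open>x\<close>, since at the critical order one has to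
  subtract a multiple of a cutoff function that involves its value at \<open>x\<close>.\<close>

definition small_near :: "nat \<Rightarrow> 'a::euclidean_space set \<Rightarrow> ('a \<Rightarrow> 'a \<Rightarrow> real) \<Rightarrow> bool"
  where "small_near m B h \<longleftrightarrow> (\<forall>\<eta>>0. \<exists>\<delta>>0. \<forall>x\<in>B.
    integrable lborel (\<lambda>z. indicator (ball x \<delta>) z * (inv_norm_pow m (x - z) * \<bar>h x z\<bar>)) \<and>
    (\<integral>z. indicator (ball x \<delta>) z * (inv_norm_pow m (x - z) * \<bar>h x z\<bar>) \<partial>lborel) \<le> \<eta>)"

lemma AE_neq_lborel: "AE z in lborel. z \<noteq> (x::'a::euclidean_space)"
  by (rule AE_I'[of "{x}"]) auto

lemma integrable_kernel:
  assumes k: "has_order k m" and sm: "small_near m B h" and x: "x \<in> B" and h: "integrable lborel (h x)"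
  shows "integrable lborel (\<lambda>z. keval k \<epsilon> (x - z) * h x z)"
proof -
  obtain C where C: "C \<ge> 0" "\<And>\<epsilon> y. y \<noteq> 0 \<Longrightarrow> \<bar>keval k \<epsilon> y\<bar> \<le> C * inv_norm_pow m y"
    using keval_bound_norm[OF k] unfolding inv_norm_pow_def by blast
  obtain \<delta> where \<delta>: "\<delta> > 0" "integrable lborel (\<lambda>z. indicator (ball x \<delta>) z * (inv_norm_pow m (x - z) * \<bar>h x z\<bar>))"
    using sm x unfolding small_near_def by (meson zero_less_one)
  have [measurable]: "h x \<in> borel_measurable lborel" using h by simp
  show ?thesis
  proof (rule Bochner_Integration.integrable_bound[where f="\<lambda>z. C * (indicator (ball x \<delta>) z * (inv_norm_pow m (x - z) * \<bar>h x z\<bar>)) + (C * (1 / \<delta>) ^ m) * \<bar>h x z\<bar>"])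
    show "AE z in lborel. norm (keval k \<epsilon> (x - z) * h x z)
        \<le> norm (C * (indicator (ball x \<delta>) z * (inv_norm_pow m (x - z) * \<bar>h x z\<bar>)) + (C * (1 / \<delta>) ^ m) * \<bar>h x z\<bar>)"
      using AE_neq_lborel[of x]
    proof eventually_elim
      case (elim z)
      have b: "\<bar>keval k \<epsilon> (x - z)\<bar> \<le> C * inv_norm_pow m (x - z)" using elim by (intro C) auto
      show ?case
      proof (cases "z \<in> ball x \<delta>")
        case True
        have "\<bar>keval k \<epsilon> (x - z)\<bar> * \<bar>h x z\<bar> \<le> C * inv_norm_pow m (x - z) * \<bar>h x z\<bar>" using b by (rule mult_right_mono) simp
        also have "\<dots> \<le> C * inv_norm_pow m (x - z) * \<bar>h x z\<bar> + (C * (1 / \<delta>) ^ m) * \<bar>h x z\<bar>"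
          using C \<delta> by simp
        finally show ?thesis using True C \<delta> by (simp add: abs_mult mult_ac)
      next
        case False
        then have "norm (x - z) \<ge> \<delta>" by (simp add: dist_norm)
        then have "inv_norm_pow m (x - z) \<le> (1 / \<delta>) ^ m" unfolding inv_norm_pow_def
          using \<delta>(1) by (intro power_mono divide_left_mono mult_pos_pos) (auto simp: elim)
        then have "\<bar>keval k \<epsilon> (x - z)\<bar> \<le> C * (1 / \<delta>) ^ m" using b C(1) by (meson mult_left_mono order_trans)
        then have "\<bar>keval k \<epsilon> (x - z)\<bar> * \<bar>h x z\<bar> \<le> C * (1 / \<delta>) ^ m * \<bar>h x z\<bar>" by (rule mult_right_mono) simp
        then show ?thesis using False C \<delta> by (simp add: abs_mult)
      qed
    qed
  qed (use \<delta> h in auto)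
qed

text \<open>Near the diagonal both the regularized and the singular kernel are bounded by the same multiple
  of \<open>\<bar>x - z\<bar>\<^sup>-\<^sup>m\<close>, whose contribution is uniformly small by hypothesis; away from the diagonal the
  kernels converge uniformly and the densities are uniformly bounded in \<open>L\<^sup>1\<close>.\<close>

theorem uniform_limit_kernel_integral:
  fixes h :: "'a::euclidean_space \<Rightarrow> 'a \<Rightarrow> real"
  assumes k: "has_order k m" and sm: "small_near m B h"
    and h: "\<And>x. x \<in> B \<Longrightarrow> integrable lborel (h x)"
    and M: "\<And>x. x \<in> B \<Longrightarrow> (\<integral>z. \<bar>h x z\<bar> \<partial>lborel) \<le> M"
  shows "uniform_limit B (\<lambda>n x. \<integral>z. keval k (eps n) (x - z) * h x z \<partial>lborel)
           (\<lambda>x. \<integral>z. keval k 0 (x - z) * h x z \<partial>lborel) sequentially"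
  unfolding uniform_limit_iff
proof (intro allI impI)
  fix \<eta> :: real assume \<eta>: "\<eta> > 0"
  obtain C where C: "C \<ge> 0" "\<And>\<epsilon> y. y \<noteq> 0 \<Longrightarrow> \<bar>keval k \<epsilon> y\<bar> \<le> C * inv_norm_pow m y"
    using keval_bound_norm[OF k] unfolding inv_norm_pow_def by blast
  have \<eta>1: "\<eta> / (4 * (C + 1)) > 0" and \<eta>2: "\<eta> / (4 * (\<bar>M\<bar> + 1)) > 0"
    using \<eta> C by (auto intro!: divide_pos_pos)
  obtain \<delta> where \<delta>: "\<delta> > 0"
      "\<And>x. x \<in> B \<Longrightarrow> integrable lborel (\<lambda>z. indicator (ball x \<delta>) z * (inv_norm_pow m (x - z) * \<bar>h x z\<bar>))"
      "\<And>x. x \<in> B \<Longrightarrow> (\<integral>z. indicator (ball x \<delta>) z * (inv_norm_pow m (x - z) * \<bar>h x z\<bar>) \<partial>lborel) \<le> \<eta> / (4 * (C + 1))"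
    using sm \<eta>1 unfolding small_near_def by meson
  have "\<forall>\<^sub>F n in sequentially. \<forall>y\<in>{y. norm y \<ge> \<delta>}. dist (keval k (eps n) y) (keval k 0 y) < \<eta> / (4 * (\<bar>M\<bar> + 1))"
    using keval_uniform_limit_away[OF \<delta>(1), of k] \<eta>2 unfolding uniform_limit_iff by blast
  then show "\<forall>\<^sub>F n in sequentially. \<forall>x\<in>B.
      dist (\<integral>z. keval k (eps n) (x - z) * h x z \<partial>lborel) (\<integral>z. keval k 0 (x - z) * h x z \<partial>lborel) < \<eta>"
  proof eventually_elim
    case (elim n)
    show ?case
    proof
      fix x assume x: "x \<in> B"
      have [measurable]: "h x \<in> borel_measurable lborel" using h[OF x] by simp
      let ?g = "\<lambda>z. (2 * C) * (indicator (ball x \<delta>) z * (inv_norm_pow m (x - z) * \<bar>h x z\<bar>)) + (\<eta> / (4 * (\<bar>M\<bar> + 1))) * \<bar>h x z\<bar>"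
      note int = integrable_kernel[where h=h, OF k sm x h[OF x]]
      have "\<bar>(\<integral>z. keval k (eps n) (x - z) * h x z \<partial>lborel) - (\<integral>z. keval k 0 (x - z) * h x z \<partial>lborel)\<bar>
          = \<bar>\<integral>z. keval k (eps n) (x - z) * h x z - keval k 0 (x - z) * h x z \<partial>lborel\<bar>"
        using int by simp
      also have "\<dots> \<le> (\<integral>z. \<bar>keval k (eps n) (x - z) * h x z - keval k 0 (x - z) * h x z\<bar> \<partial>lborel)"
        by (rule integral_abs_bound)
      also have "\<dots> \<le> (\<integral>z. ?g z \<partial>lborel)"
      proof (rule integral_mono_AE)
        show "integrable lborel (\<lambda>z. \<bar>keval k (eps n) (x - z) * h x z - keval k 0 (x - z) * h x z\<bar>)"
          using int by simp
        show "integrable lborel ?g" using \<delta>(2)[OF x] h[OF x] by simp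
        show "AE z in lborel. \<bar>keval k (eps n) (x - z) * h x z - keval k 0 (x - z) * h x z\<bar> \<le> ?g z"
          using AE_neq_lborel[of x]
        proof eventually_elim
          case el: (elim z)
          have e: "\<bar>keval k (eps n) (x - z) * h x z - keval k 0 (x - z) * h x z\<bar>
              = \<bar>keval k (eps n) (x - z) - keval k 0 (x - z)\<bar> * \<bar>h x z\<bar>"
            by (simp add: abs_mult[symmetric] left_diff_distrib)
          show ?case
          proof (cases "z \<in> ball x \<delta>")
            case True
            have "\<bar>keval k (eps n) (x - z) - keval k 0 (x - z)\<bar> \<le> \<bar>keval k (eps n) (x - z)\<bar> + \<bar>keval k 0 (x - z)\<bar>"
              by (rule abs_triangle_ineq4)
            also have "\<dots> \<le> 2 * C * inv_norm_pow m (x - z)"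
              using C(2)[of "x - z" "eps n"] C(2)[of "x - z" 0] el by simp
            finally have "\<bar>keval k (eps n) (x - z) - keval k 0 (x - z)\<bar> * \<bar>h x z\<bar> \<le> 2 * C * inv_norm_pow m (x - z) * \<bar>h x z\<bar>"
              by (rule mult_right_mono) simp
            also have "\<dots> \<le> ?g z" using True \<eta>2 by (simp add: mult_ac del: times_divide_eq_left times_divide_eq_right)
            finally show ?thesis unfolding e .
          next
            case False
            then have "\<bar>keval k (eps n) (x - z) - keval k 0 (x - z)\<bar> \<le> \<eta> / (4 * (\<bar>M\<bar> + 1))"
              using elim by (auto simp: dist_norm intro: less_imp_le)
            then have "\<bar>keval k (eps n) (x - z) - keval k 0 (x - z)\<bar> * \<bar>h x z\<bar> \<le> \<eta> / (4 * (\<bar>M\<bar> + 1)) * \<bar>h x z\<bar>"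
              by (rule mult_right_mono) simp
            then show ?thesis unfolding e using False by simp
          qed
        qed
      qed
      also have "\<dots> = 2 * C * (\<integral>z. indicator (ball x \<delta>) z * (inv_norm_pow m (x - z) * \<bar>h x z\<bar>) \<partial>lborel)
          + (\<eta> / (4 * (\<bar>M\<bar> + 1))) * (\<integral>z. \<bar>h x z\<bar> \<partial>lborel)"
        using \<delta>(2)[OF x] h[OF x] by simp
      also have "\<dots> \<le> 2 * C * (\<eta> / (4 * (C + 1))) + (\<eta> / (4 * (\<bar>M\<bar> + 1))) * \<bar>M\<bar>"
      proof (intro add_mono mult_left_mono)
        show "(\<integral>z. \<bar>h x z\<bar> \<partial>lborel) \<le> \<bar>M\<bar>" using M[OF x] by linarith
      qed (use \<delta>(3)[OF x] C \<eta>2 in auto)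
      also have "\<dots> < \<eta>"
      proof -
        have "2 * C * (\<eta> / (4 * (C + 1))) \<le> \<eta> / 2" using \<eta> C by (simp add: field_simps)
        moreover have "(\<eta> / (4 * (\<bar>M\<bar> + 1))) * \<bar>M\<bar> \<le> \<eta> / 4"
          using \<eta> by (simp add: divide_simps)
        ultimately show ?thesis using \<eta> by linarith
      qed
      finally show "dist (\<integral>z. keval k (eps n) (x - z) * h x z \<partial>lborel) (\<integral>z. keval k 0 (x - z) * h x z \<partial>lborel) < \<eta>"
        by (simp add: dist_real_def)
    qed
  qed
qed

section \<open>Uniform smallness near the diagonal\<close>

lemma lborel_reflect: "distr lborel borel (\<lambda>z. x - z) = (lborel :: 'a::euclidean_space measure)"
  using lborel_affine[of "-1" x] by (simp add: density_1 one_ennreal_def[symmetric])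

lemma integrable_lborel_reflect_iff:
  fixes g :: "'a::euclidean_space \<Rightarrow> real"
  assumes "g \<in> borel_measurable borel"
  shows "integrable lborel (\<lambda>z. g (x - z)) \<longleftrightarrow> integrable lborel g"
  using assms by (subst (2) lborel_reflect[of x, symmetric]) (simp add: integrable_distr_eq)

lemma integral_lborel_reflect:
  fixes g :: "'a::euclidean_space \<Rightarrow> real"
  assumes "g \<in> borel_measurable borel"
  shows "(\<integral>z. g (x - z) \<partial>lborel) = (\<integral>z. g z \<partial>lborel)"
  using assms by (subst (2) lborel_reflect[of x, symmetric]) (simp add: integral_distr)

lemma norm_powr_measurable [measurable]:
  "(\<lambda>y::'a::euclidean_space. norm (x - y) powr r) \<in> borel_measurable borel"
  by (intro powr_real_measurable) simp_all

lemma indicator_ball_measurable [measurable]: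
  "(\<lambda>z. indicator (ball x \<delta>) z :: real) \<in> borel_measurable borel"
  by (intro borel_measurable_indicator) simp

text \<open>The dyadic shell \<open>2\<^sup>-\<^sup>k\<^sup>-\<^sup>1 \<le> \<bar>y\<bar> < 2\<^sup>-\<^sup>k\<close> contributes at most a multiple of \<open>2\<^sup>k\<^sup>(\<^sup>s\<^sup>-\<^sup>d\<^sup>)\<close>, where \<open>d\<close> is the
  dimension, and these numbers form a convergent geometric series.\<close>

lemma integrable_norm_powr_ball:
  fixes s :: real
  assumes s: "0 \<le> s" "s < DIM('a)"
  shows "integrable lborel (\<lambda>y::'a::euclidean_space. indicator (ball 0 1) y * norm y powr - s)"
proof (rule integrableI_bounded)
  let ?V = "unit_ball_vol (DIM('a))"
  define c :: "nat \<Rightarrow> real" where "c k = ((1/2) ^ Suc k) powr - s" for k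
  let ?F = "\<lambda>k (y::'a). ennreal (c k) * indicator (ball 0 ((1/2) ^ k)) y"
  have tm: "c k * (?V * ((1/2) ^ k) ^ DIM('a)) = (2 powr s * ?V) * (2 powr (s - DIM('a))) ^ k" for k
  proof -
    have h: "(1/2::real) ^ j = 2 powr - real j" for j
      by (simp add: powr_minus powr_realpow power_one_over inverse_eq_divide)
    have "c k = 2 powr (s + s * k)" unfolding c_def h by (simp add: powr_powr algebra_simps)
    moreover have "((1/2::real) ^ k) ^ DIM('a) = 2 powr (- (real k * DIM('a)))"
      by (simp add: h powr_power mult.commute)
    moreover have "(2 powr (s - DIM('a))) ^ k = 2 powr ((s - DIM('a)) * k)"
      by (simp add: powr_realpow[symmetric] powr_powr)
    ultimately show ?thesis by (simp add: powr_add[symmetric] algebra_simps) 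
  qed
  have suminf_ge: "f k \<le> suminf f" for f :: "nat \<Rightarrow> ennreal" and k
    using sum_le_suminf[of f "{k}"] by simp
  have pt: "ennreal (norm (indicator (ball 0 1) y * norm y powr - s)) \<le> (\<Sum>k. ?F k y)" for y :: 'a
  proof (cases "y \<in> ball 0 1 \<and> y \<noteq> 0")
    case True
    have "\<exists>n. (1/2::real) ^ n < norm y"
      using True by (intro real_arch_pow_inv) auto
    then have ex: "\<exists>n. (1/2::real) ^ n \<le> norm y" by (meson less_imp_le)
    \<comment> \<open>The dyadic shell that contains \<open>y\<close>.\<close>
    define n where "n = (LEAST n. (1/2::real) ^ n \<le> norm y)"
    have n: "(1/2::real) ^ n \<le> norm y" unfolding n_def using ex by (rule LeastI_ex)
    then have "n \<noteq> 0" using True by (intro notI) simp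
    then obtain k where nk: "n = Suc k" by (metis not0_implies_Suc)
    then have k: "norm y < (1/2) ^ k" using not_less_Least[of k "\<lambda>n. (1/2::real) ^ n \<le> norm y"]
      unfolding n_def by auto
    have "norm y powr - s \<le> c k" unfolding c_def using n nk s by (intro powr_mono2') auto
    then have "ennreal (norm (indicator (ball 0 1) y * norm y powr - s)) \<le> ?F k y"
      using True k ennreal_leI[OF \<open>norm y powr - s \<le> c k\<close>] by simp
    also have "\<dots> \<le> (\<Sum>k. ?F k y)" by (rule suminf_ge)
    finally show ?thesis .
  next
    case False
    then have "indicator (ball 0 1) y * norm y powr - s = 0" by auto
    then show ?thesis by (simp only: norm_zero ennreal_0 zero_le)
  qed
  have "(\<integral>\<^sup>+(y::'a). ennreal (norm (indicator (ball 0 1) y * norm y powr - s)) \<partial>lborel) \<le> (\<integral>\<^sup>+y. (\<Sum>k. ?F k (y::'a)) \<partial>lborel)"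
    by (intro nn_integral_mono pt)
  also have "\<dots> = (\<Sum>k. \<integral>\<^sup>+y. ?F k y \<partial>lborel)"
  proof (rule nn_integral_suminf)
    fix k
    have "ball (0::'a) ((1/2) ^ k) \<in> sets lborel" by simp
    then show "?F k \<in> borel_measurable lborel"
      by (intro borel_measurable_times_ennreal borel_measurable_const borel_measurable_indicator)
  qed
  also have "\<dots> = (\<Sum>k. ennreal ((2 powr s * ?V) * (2 powr (s - DIM('a))) ^ k))"
  proof -
    have "(\<integral>\<^sup>+y. ?F k y \<partial>lborel) = ennreal (c k) * emeasure lborel (ball (0::'a) ((1/2) ^ k))" for k
      by (rule nn_integral_cmult_indicator) simp
    moreover have "ennreal (c k) * emeasure lborel (ball (0::'a) ((1/2) ^ k)) = ennreal (c k * (?V * ((1/2) ^ k) ^ DIM('a)))" for k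
      by (subst emeasure_ball, simp, rule ennreal_mult'[symmetric], simp add: c_def)
    ultimately show ?thesis by (simp only: tm)
  qed
  also have "\<dots> < \<infinity>"
  proof -
    have "2 powr (s - DIM('a)) < (1::real)" using s powr_less_mono[of "s - DIM('a)" 0 2] by simp
    then have "summable (\<lambda>k. (2 powr s * ?V) * (2 powr (s - DIM('a))) ^ k)"
      by (intro summable_mult summable_geometric) auto
    then show ?thesis by (simp add: less_top ennreal_suminf_neq_top)
  qed
  finally show "(\<integral>\<^sup>+y. ennreal (norm (indicator (ball 0 1) y * norm (y::'a) powr - s)) \<partial>lborel) < \<infinity>" .
next
  show "(\<lambda>y::'a. indicator (ball 0 1) y * norm y powr - s) \<in> borel_measurable lborel"
    using norm_powr_measurable[of 0 "- s"] indicator_ball_measurable[of "0::'a" 1] by simp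
qed

text \<open>There is room for a slightly larger exponent \<open>s + \<tau>\<close>, still below the dimension; the excess yields a
  factor \<open>\<delta>\<^sup>\<tau>\<close>.\<close>

lemma small_norm_powr:
  fixes s \<eta> :: real
  assumes s: "0 \<le> s" "s < DIM('a)" and \<eta>: "\<eta> > 0"
  obtains \<delta> where "0 < \<delta>" "\<delta> \<le> 1"
    "\<And>x::'a::euclidean_space. integrable lborel (\<lambda>z. indicator (ball x \<delta>) z * norm (x - z) powr - s)"
    "\<And>x::'a. (\<integral>z. indicator (ball x \<delta>) z * norm (x - z) powr - s \<partial>lborel) \<le> \<eta>"
proof -
  define \<tau> where "\<tau> = (DIM('a) - s) / 2"
  have \<tau>: "\<tau> > 0" "0 \<le> s + \<tau>" "s + \<tau> < DIM('a)" using s by (auto simp: \<tau>_def field_simps)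
  let ?g = "\<lambda>y::'a. indicator (ball 0 1) y * norm y powr - (s + \<tau>)"
  define I where "I = (\<integral>y. ?g y \<partial>lborel)"
  have int_g: "integrable lborel ?g" by (rule integrable_norm_powr_ball[OF \<tau>(2,3)])
  have g_meas: "?g \<in> borel_measurable borel" using int_g by simp
  have I: "I \<ge> 0" unfolding I_def by (rule integral_nonneg_AE) auto
  define \<delta> where "\<delta> = min 1 ((\<eta> / (I + 1)) powr (1 / \<tau>))"
  have q: "\<eta> / (I + 1) > 0" using \<eta> I by (intro divide_pos_pos) auto
  have \<delta>: "0 < \<delta>" "\<delta> \<le> 1" using q \<eta> I by (auto simp: \<delta>_def)
  have "\<delta> powr \<tau> \<le> ((\<eta> / (I + 1)) powr (1 / \<tau>)) powr \<tau>"
    using \<delta> \<tau> by (intro powr_mono2) (auto simp: \<delta>_def)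
  also have "\<dots> = \<eta> / (I + 1)" using \<tau> \<eta> I by (simp add: powr_powr)
  finally have "\<delta> powr \<tau> * I \<le> \<eta> / (I + 1) * I" using I by (rule mult_right_mono)
  also have "\<dots> \<le> \<eta>" using \<eta> I by (simp add: divide_simps)
  finally have small: "\<delta> powr \<tau> * I \<le> \<eta>" .
  have pt: "indicator (ball x \<delta>) z * norm (x - z) powr - s \<le> \<delta> powr \<tau> * ?g (x - z)" for x z
  proof (cases "z \<in> ball x \<delta> \<and> z \<noteq> x")
    case True
    then have n: "0 < norm (x - z)" "norm (x - z) < \<delta>" by (auto simp: dist_norm)
    have "norm (x - z) powr - s = norm (x - z) powr \<tau> * norm (x - z) powr - (s + \<tau>)"
      by (simp add: powr_add[symmetric])
    also have "\<dots> \<le> \<delta> powr \<tau> * norm (x - z) powr - (s + \<tau>)"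
      using n \<tau> by (intro mult_right_mono powr_mono2) auto
    finally have "norm (x - z) powr - s \<le> \<delta> powr \<tau> * norm (x - z) powr - (s + \<tau>)" .
    moreover have "x - z \<in> ball 0 1" using n \<delta> by simp
    ultimately show ?thesis using True by simp
  qed auto
  have int_r: "integrable lborel (\<lambda>z. \<delta> powr \<tau> * ?g (x - z))" for x
    using integrable_lborel_reflect_iff[OF g_meas, of x] int_g by simp
  show ?thesis
  proof (rule that[OF \<delta>])
    fix x :: 'a
    show i: "integrable lborel (\<lambda>z. indicator (ball x \<delta>) z * norm (x - z) powr - s)"
    proof (rule Bochner_Integration.integrable_bound[OF int_r])
      show "AE z in lborel. norm (indicator (ball x \<delta>) z * norm (x - z) powr - s) \<le> norm (\<delta> powr \<tau> * ?g (x - z))"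
        using pt by (intro AE_I2) (simp only: real_norm_def, simp add: abs_mult)
    qed measurable
    have "(\<integral>z. indicator (ball x \<delta>) z * norm (x - z) powr - s \<partial>lborel) \<le> (\<integral>z. \<delta> powr \<tau> * ?g (x - z) \<partial>lborel)"
      by (rule integral_mono[OF i int_r pt])
    also have "\<dots> = \<delta> powr \<tau> * I"
      unfolding I_def using integral_lborel_reflect[OF g_meas, of x] by simp
    finally show "(\<integral>z. indicator (ball x \<delta>) z * norm (x - z) powr - s \<partial>lborel) \<le> \<eta>"
      using small by simp
  qed
qed

text \<open>All sufficient conditions for densities with a pointwise bound near the diagonal reduce to this one.\<close>

lemma small_near_powr:
  fixes h :: "'a::euclidean_space \<Rightarrow> 'a \<Rightarrow> real" and s :: real
  assumes s: "0 \<le> s" "s < DIM('a)" and \<delta>0: "\<delta>0 > 0" and C: "C \<ge> 0"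
    and hm: "\<And>x. x \<in> B \<Longrightarrow> h x \<in> borel_measurable borel"
    and bd: "\<And>x z. x \<in> B \<Longrightarrow> z \<noteq> x \<Longrightarrow> norm (x - z) < \<delta>0 \<Longrightarrow> inv_norm_pow m (x - z) * \<bar>h x z\<bar> \<le> C * norm (x - z) powr - s"
  shows "small_near m B h"
  unfolding small_near_def
proof (intro allI impI)
  fix \<eta> :: real assume "\<eta> > 0"
  then have \<eta>C: "\<eta> / (C + 1) > 0" using C by auto
  obtain \<delta> where \<delta>: "0 < \<delta>" "\<delta> \<le> 1"
    "\<And>x::'a. integrable lborel (\<lambda>z. indicator (ball x \<delta>) z * norm (x - z) powr - s)"
    "\<And>x::'a. (\<integral>z. indicator (ball x \<delta>) z * norm (x - z) powr - s \<partial>lborel) \<le> \<eta> / (C + 1)"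
    using small_norm_powr[OF s \<eta>C] by blast
  let ?d = "min \<delta> \<delta>0"
  show "\<exists>\<delta>>0. \<forall>x\<in>B. integrable lborel (\<lambda>z. indicator (ball x \<delta>) z * (inv_norm_pow m (x - z) * \<bar>h x z\<bar>)) \<and>
    (\<integral>z. indicator (ball x \<delta>) z * (inv_norm_pow m (x - z) * \<bar>h x z\<bar>) \<partial>lborel) \<le> \<eta>"
  proof (intro exI[of _ ?d] conjI ballI)
    fix x assume x: "x \<in> B"
    note [measurable] = hm[OF x]
    have pt: "AE z in lborel. indicator (ball x ?d) z * (inv_norm_pow m (x - z) * \<bar>h x z\<bar>)
        \<le> C * (indicator (ball x \<delta>) z * norm (x - z) powr - s)"
      using AE_neq_lborel[of x]
    proof eventually_elim
      case (elim z)
      show ?case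
      proof (cases "z \<in> ball x ?d")
        case True
        then show ?thesis using bd[OF x elim] by (simp add: dist_norm)
      next
        case False
        then show ?thesis using C by simp
      qed
    qed
    have int: "integrable lborel (\<lambda>z. C * (indicator (ball x \<delta>) z * norm (x - z) powr - s))"
      using \<delta>(3) by simp
    show i: "integrable lborel (\<lambda>z. indicator (ball x ?d) z * (inv_norm_pow m (x - z) * \<bar>h x z\<bar>))"
    proof (rule Bochner_Integration.integrable_bound[OF int])
      show "AE z in lborel. norm (indicator (ball x ?d) z * (inv_norm_pow m (x - z) * \<bar>h x z\<bar>))
        \<le> norm (C * (indicator (ball x \<delta>) z * norm (x - z) powr - s))"
        using pt by eventually_elim (use C in \<open>simp add: abs_mult\<close>)
    qed measurable
    have "(\<integral>z. indicator (ball x ?d) z * (inv_norm_pow m (x - z) * \<bar>h x z\<bar>) \<partial>lborel)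
      \<le> (\<integral>z. C * (indicator (ball x \<delta>) z * norm (x - z) powr - s) \<partial>lborel)"
      by (rule integral_mono_AE[OF i int pt])
    also have "\<dots> \<le> C * (\<eta> / (C + 1))" using \<delta>(4)[of x] C by (simp add: mult_left_mono del: times_divide_eq_right)
    also have "\<dots> \<le> \<eta>" using \<open>\<eta> > 0\<close> C by (simp add: divide_simps)
    finally show "(\<integral>z. indicator (ball x ?d) z * (inv_norm_pow m (x - z) * \<bar>h x z\<bar>) \<partial>lborel) \<le> \<eta>" .
  qed (use \<delta> \<delta>0 in auto)
qed

lemma small_near_bounded:
  fixes h :: "'a::euclidean_space \<Rightarrow> 'a \<Rightarrow> real"
  assumes "m < DIM('a)" "\<delta>0 > 0" and hm: "\<And>x. x \<in> B \<Longrightarrow> h x \<in> borel_measurable borel"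
    and bd: "\<And>x z. x \<in> B \<Longrightarrow> norm (x - z) < \<delta>0 \<Longrightarrow> \<bar>h x z\<bar> \<le> C"
  shows "small_near m B h"
proof (rule small_near_powr[of "real m" \<delta>0 "\<bar>C\<bar>"])
  fix x z assume "x \<in> B" "z \<noteq> x" "norm (x - z) < \<delta>0"
  then have "\<bar>h x z\<bar> \<le> \<bar>C\<bar>" "norm (x - z) > 0" using bd by force+
  then show "inv_norm_pow m (x - z) * \<bar>h x z\<bar> \<le> \<bar>C\<bar> * norm (x - z) powr - real m"
    by (simp add: inv_norm_pow_eq_powr mult.commute mult_right_mono)
qed (use assms in auto)

lemma small_near_zero:
  fixes h :: "'a::euclidean_space \<Rightarrow> 'a \<Rightarrow> real"
  assumes "\<delta>0 > 0" and hm: "\<And>x. x \<in> B \<Longrightarrow> h x \<in> borel_measurable borel"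
    and bd: "\<And>x z. x \<in> B \<Longrightarrow> norm (x - z) < \<delta>0 \<Longrightarrow> h x z = 0"
  shows "small_near m B h"
  by (rule small_near_powr[of 0 \<delta>0 0]) (use assms in auto)

text \<open>Young's inequality with a free parameter: comparing \<open>\<bar>f z\<bar>\<close> with \<open>\<Lambda> \<bar>x - z\<bar>\<^sup>-\<^sup>m\<^sup>/\<^sup>(\<^sup>p\<^sup>-\<^sup>1\<^sup>)\<close> shows that
  \<open>\<bar>x - z\<bar>\<^sup>-\<^sup>m \<bar>f z\<bar>\<close> is at most \<open>\<Lambda> \<bar>x - z\<bar>\<^sup>-\<^sup>m\<^sup>-\<^sup>m\<^sup>/\<^sup>(\<^sup>p\<^sup>-\<^sup>1\<^sup>) + \<Lambda>\<^sup>1\<^sup>-\<^sup>p \<bar>f z\<bar>\<^sup>p\<close>. A large \<open>\<Lambda>\<close> makes the second term small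
  without reference to \<open>\<delta>\<close>, and then a small \<open>\<delta>\<close> makes the first one small.\<close>

lemma small_near_Lp:
  fixes f :: "'a::euclidean_space \<Rightarrow> real"
  assumes p: "p > 1" and mp: "m + m / (p - 1) < DIM('a)"
    and fm [measurable]: "f \<in> borel_measurable borel"
    and fp: "integrable lborel (\<lambda>z. indicator (cball 0 (R + 1)) z * \<bar>f z\<bar> powr p)"
  shows "small_near m (ball 0 R) (\<lambda>_. f)"
  unfolding small_near_def
proof (intro allI impI)
  fix \<eta> :: real assume \<eta>: "\<eta> > 0"
  let ?fp = "\<lambda>z. indicator (cball 0 (R + 1)) z * \<bar>f z\<bar> powr p"
  define A where "A = (\<integral>z. ?fp z \<partial>lborel)"
  have A: "A \<ge> 0" unfolding A_def by (rule integral_nonneg_AE) auto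
  let ?s = "m + m / (p - 1)"
  \<comment> \<open>Chosen so that the \<open>L\<^sup>p\<close> term is at most \<open>\<eta> / 2\<close>.\<close>
  define \<Lambda> where "\<Lambda> = (2 * (A + 1) / \<eta>) powr (1 / (p - 1))"
  have q: "2 * (A + 1) / \<eta> > 0" using A \<eta> by (intro divide_pos_pos) auto
  have \<Lambda>: "\<Lambda> > 0" unfolding \<Lambda>_def powr_gt_zero using q by linarith
  have \<Lambda>p: "\<Lambda> powr (p - 1) = 2 * (A + 1) / \<eta>" 
  proof -
    have "1 / (p - 1) * (p - 1) = 1" using p by simp
    then show ?thesis unfolding \<Lambda>_def powr_powr using powr_one[OF less_imp_le[OF q]] by simp
  qed
  have \<eta>\<Lambda>: "\<eta> / (2 * \<Lambda>) > 0" and s0: "0 \<le> ?s" using \<eta> \<Lambda> p by auto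
  obtain \<delta> where \<delta>: "0 < \<delta>" "\<delta> \<le> 1"
    "\<And>x::'a. integrable lborel (\<lambda>z. indicator (ball x \<delta>) z * norm (x - z) powr - ?s)"
    "\<And>x::'a. (\<integral>z. indicator (ball x \<delta>) z * norm (x - z) powr - ?s \<partial>lborel) \<le> \<eta> / (2 * \<Lambda>)"
    using small_norm_powr[OF s0 mp \<eta>\<Lambda>] by blast
  have split: "inv_norm_pow m y * a \<le> \<Lambda> * norm y powr - ?s + (\<Lambda> powr - (p - 1)) * a powr p"
    if y: "y \<noteq> 0" and a: "a \<ge> 0" for y :: 'a and a :: real
  proof -
    define t where "t = norm y powr - (m / (p - 1))"
    have t: "t > 0" using y by (simp add: t_def)
    have tp: "t powr (p - 1) = norm y powr - real m"
    proof -
      have "- (m / (p - 1)) * (p - 1) = - real m" using p by simp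
      then show ?thesis unfolding t_def powr_powr by simp
    qed
    have w: "inv_norm_pow m y = t powr (p - 1)"
      unfolding tp using y by (simp add: inv_norm_pow_eq_powr)
    have ts: "norm y powr - ?s = t powr (p - 1) * t"
      unfolding tp unfolding t_def by (simp add: powr_add[symmetric])
    show ?thesis
    proof (cases "a \<le> \<Lambda> * t")
      case True
      have "inv_norm_pow m y * a \<le> t powr (p - 1) * (\<Lambda> * t)" unfolding w using True t by (intro mult_left_mono) auto
      also have "\<dots> = \<Lambda> * norm y powr - ?s" unfolding ts by simp
      finally show ?thesis using a by (simp add: add_increasing2)
    next
      case False
      have "t \<le> a / \<Lambda>" using False \<Lambda> by (simp add: field_simps)
      then have "t powr (p - 1) \<le> (a / \<Lambda>) powr (p - 1)" using t p by (intro powr_mono2) auto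
      then have "inv_norm_pow m y * a \<le> (a / \<Lambda>) powr (p - 1) * a" unfolding w using a by (rule mult_right_mono)
      also have "\<dots> = (\<Lambda> powr - (p - 1)) * (a powr (p - 1) * a)"
        unfolding powr_minus using a \<Lambda> by (subst powr_divide) (simp_all add: field_simps)
      also have "a powr (p - 1) * a = a powr p"
        using a powr_mult_base[of a "p - 1"] by (simp add: mult.commute)
      finally show ?thesis using \<Lambda> by (simp add: add_increasing)
    qed
  qed
  show "\<exists>\<delta>>0. \<forall>x\<in>ball 0 R. integrable lborel (\<lambda>z. indicator (ball x \<delta>) z * (inv_norm_pow m (x - z) * \<bar>f z\<bar>)) \<and>
    (\<integral>z. indicator (ball x \<delta>) z * (inv_norm_pow m (x - z) * \<bar>f z\<bar>) \<partial>lborel) \<le> \<eta>"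
  proof (intro exI[of _ \<delta>] conjI ballI)
    fix x :: 'a assume x: "x \<in> ball 0 R"
    let ?g = "\<lambda>z. \<Lambda> * (indicator (ball x \<delta>) z * norm (x - z) powr - ?s) + (\<Lambda> powr - (p - 1)) * ?fp z"
    have pt: "AE z in lborel. indicator (ball x \<delta>) z * (inv_norm_pow m (x - z) * \<bar>f z\<bar>) \<le> ?g z"
      using AE_neq_lborel[of x]
    proof eventually_elim
      case (elim z)
      show ?case
      proof (cases "z \<in> ball x \<delta>")
        case True
        have "norm z \<le> norm x + norm (x - z)" by (metis norm_triangle_sub norm_minus_commute)
        with True x \<delta> have "z \<in> cball 0 (R + 1)" by (simp add: dist_norm)
        with split[of "x - z" "\<bar>f z\<bar>"] elim True show ?thesis by simp
      next
        case False
        then show ?thesis by simp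
      qed
    qed
    have int: "integrable lborel ?g" using \<delta>(3)[of x] fp by simp
    show i: "integrable lborel (\<lambda>z. indicator (ball x \<delta>) z * (inv_norm_pow m (x - z) * \<bar>f z\<bar>))"
    proof (rule Bochner_Integration.integrable_bound[OF int])
      show "AE z in lborel. norm (indicator (ball x \<delta>) z * (inv_norm_pow m (x - z) * \<bar>f z\<bar>)) \<le> norm (?g z)"
        using pt by eventually_elim (simp add: abs_mult)
    qed measurable
    have "(\<integral>z. indicator (ball x \<delta>) z * (inv_norm_pow m (x - z) * \<bar>f z\<bar>) \<partial>lborel) \<le> (\<integral>z. ?g z \<partial>lborel)"
      by (rule integral_mono_AE[OF i int pt])
    also have "\<dots> = \<Lambda> * (\<integral>z. indicator (ball x \<delta>) z * norm (x - z) powr - ?s \<partial>lborel) + (\<Lambda> powr - (p - 1)) * A"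
      unfolding A_def using \<delta>(3)[of x] fp by simp
    also have "\<dots> \<le> \<Lambda> * (\<eta> / (2 * \<Lambda>)) + (\<Lambda> powr - (p - 1)) * A"
      using \<delta>(4)[of x] \<Lambda> by (intro add_right_mono mult_left_mono) auto
    also have "\<dots> \<le> \<eta>"
    proof -
      have "(\<Lambda> powr - (p - 1)) * A = \<eta> / (2 * (A + 1)) * A" unfolding powr_minus \<Lambda>p by (simp add: field_simps)
      also have "\<dots> \<le> \<eta> / 2" using A \<eta> by (simp add: divide_simps)
      finally show ?thesis using \<Lambda> by simp
    qed
    finally show "(\<integral>z. indicator (ball x \<delta>) z * (inv_norm_pow m (x - z) * \<bar>f z\<bar>) \<partial>lborel) \<le> \<eta>" .
  qed (use \<delta> in auto)
qed

section \<open>Smoothness of the limit\<close>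

primrec kderivs :: "'a::euclidean_space list \<Rightarrow> 'a kernel \<Rightarrow> 'a kernel" where
  "kderivs [] k = k"
| "kderivs (b # bs) k = kderiv b (kderivs bs k)"

lemma kderivs_append: "kderivs (bs @ cs) k = kderivs bs (kderivs cs k)"
  by (induction bs) auto

lemma has_order_kderivs: "has_order k m \<Longrightarrow> has_order (kderivs bs k) (length bs + m)"
  by (induction bs) (auto intro: has_order_kderiv)

lemma kconv_uniform_limit:
  assumes "has_order k m" "small_near m B (\<lambda>_. f)" "integrable lborel f"
  shows "uniform_limit B (\<lambda>j. kconv k (eps j) f) (kconv k 0 f) sequentially"
  unfolding kconv_def[abs_def]
  by (rule uniform_limit_kernel_integral[OF assms(1,2), of "\<integral>z. \<bar>f z\<bar> \<partial>lborel"]) (use assms in auto)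

text \<open>The classical theorem on differentiating a sequence of functions whose derivatives converge
  uniformly. The limits \<open>L b\<close> are left abstract, as at the critical order they are not absolutely
  convergent integrals in general.\<close>

lemma kernel_limit_has_derivative:
  fixes f :: "'a::euclidean_space \<Rightarrow> real"
  assumes B: "open B" "convex B" and k: "has_order k m" and f: "integrable lborel f"
    and F: "uniform_limit B (\<lambda>j. kconv k (eps j) f) F sequentially"
    and L: "\<And>b. b \<in> Basis \<Longrightarrow> uniform_limit B (\<lambda>j. kconv (kderiv b k) (eps j) f) (L b) sequentially"
    and x: "x \<in> B"
  shows "(F has_derivative (\<lambda>v. \<Sum>b\<in>Basis. (v \<bullet> b) * L b x)) (at x)"
proof -
  have hd: "(kconv k (eps n) f has_derivative (\<lambda>v. kconv (kderiv v k) (eps n) f y)) (at y)" for n y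
    by (rule kconv_has_derivative[OF k eps_neq f])
  have e: "kconv (kderiv v k) (eps n) f y = (\<Sum>b\<in>Basis. (v \<bullet> b) * kconv (kderiv b k) (eps n) f y)" for v n y
    using linear_basis_expansion[OF has_derivative_linear[OF hd], where v=v] unfolding real_scaleR_def .
  have "\<exists>g. \<forall>y\<in>B. (\<lambda>n. kconv k (eps n) f y) \<longlonglongrightarrow> g y \<and>
      (g has_derivative (\<lambda>v. \<Sum>b\<in>Basis. (v \<bullet> b) * L b y)) (at y within B)"
  proof (rule has_derivative_sequence[OF B(2) has_derivative_at_withinI[OF hd] _ x tendsto_uniform_limitI[OF F x]])
    fix \<eta> :: real assume \<eta>: "\<eta> > 0"
    then have \<eta>d: "\<eta> / DIM('a) > 0" by simp
    have "\<forall>\<^sub>F n in sequentially. \<forall>b\<in>Basis. \<forall>y\<in>B. dist (kconv (kderiv b k) (eps n) f y) (L b y) < \<eta> / DIM('a)"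
      using L \<eta>d by (intro eventually_ball_finite) (auto simp: uniform_limit_iff)
    then show "\<forall>\<^sub>F n in sequentially. \<forall>y\<in>B. \<forall>h. norm (kconv (kderiv h k) (eps n) f y - (\<Sum>b\<in>Basis. (h \<bullet> b) * L b y)) \<le> \<eta> * norm h"
    proof eventually_elim
      case (elim n)
      show ?case
      proof (intro ballI allI)
        fix y h assume y: "y \<in> B"
        have "kconv (kderiv h k) (eps n) f y - (\<Sum>b\<in>Basis. (h \<bullet> b) * L b y)
            = (\<Sum>b\<in>Basis. (h \<bullet> b) * (kconv (kderiv b k) (eps n) f y - L b y))"
          unfolding e[of h] by (simp add: sum_subtractf right_diff_distrib)
        also have "norm \<dots> \<le> (\<Sum>b\<in>(Basis::'a set). norm h * (\<eta> / DIM('a)))"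
        proof (rule sum_norm_le)
          fix b :: 'a assume b: "b \<in> Basis"
          have "\<bar>kconv (kderiv b k) (eps n) f y - L b y\<bar> \<le> \<eta> / DIM('a)"
            using elim b y by (auto simp: dist_real_def intro: less_imp_le)
          with b show "norm ((h \<bullet> b) * (kconv (kderiv b k) (eps n) f y - L b y)) \<le> norm h * (\<eta> / DIM('a))"
            unfolding real_norm_def abs_mult by (intro mult_mono) (auto simp: Basis_le_norm)
        qed
        finally show "norm (kconv (kderiv h k) (eps n) f y - (\<Sum>b\<in>Basis. (h \<bullet> b) * L b y)) \<le> \<eta> * norm h"
          by (simp add: mult.commute)
      qed
    qed
  qed
  then obtain g where g: "\<And>y. y \<in> B \<Longrightarrow> (\<lambda>n. kconv k (eps n) f y) \<longlonglongrightarrow> g y"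
    "(g has_derivative (\<lambda>v. \<Sum>b\<in>Basis. (v \<bullet> b) * L b x)) (at x within B)" using x by blast
  have gF: "g y = F y" if "y \<in> B" for y
    using LIMSEQ_unique[OF g(1)[OF that] tendsto_uniform_limitI[OF F that]] .
  have "(g has_derivative (\<lambda>v. \<Sum>b\<in>Basis. (v \<bullet> b) * L b x)) (at x)"
    using g(2) at_within_open[OF x B(1)] by simp
  then show ?thesis by (rule has_derivative_transform_within_open[OF _ B(1) x]) (rule gF)
qed

text \<open>Regularity of a singular convolution is thereby reduced to uniform convergence of the
  regularized ones, all of whose derivatives are convolutions of \<open>f\<close> with regularized kernels.\<close>

theorem Ck_on_kernel_limit:
  fixes f :: "'a::euclidean_space \<Rightarrow> real"
  assumes B: "open B" "convex B" and f: "integrable lborel f"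
  shows "has_order k m \<Longrightarrow> uniform_limit B (\<lambda>j. kconv k (eps j) f) F sequentially \<Longrightarrow>
    (\<And>bs. set bs \<subseteq> Basis \<Longrightarrow> length bs \<le> n \<Longrightarrow> uniformly_convergent_on B (\<lambda>j. kconv (kderivs bs k) (eps j) f)) \<Longrightarrow>
    Ck_on n F B"
proof (induction n arbitrary: k m F)
  case 0
  have "continuous_on B (kconv k (eps j) f)" for j
    using kconv_has_derivative[OF "0.prems"(1) eps_neq f] has_derivative_continuous
    by (blast intro: continuous_at_imp_continuous_on)
  then have "continuous_on B F"
    by (intro uniform_limit_theorem[OF _ "0.prems"(2)]) auto
  then show ?case by (simp add: Ck_on_0)
next
  case (Suc n)
  have uc: "uniformly_convergent_on B (\<lambda>j. kconv (kderivs bs (kderiv b k)) (eps j) f)"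
    if "b \<in> Basis" "set bs \<subseteq> Basis" "length bs \<le> n" for b bs
    using Suc.prems(3)[of "bs @ [b]"] that by (simp add: kderivs_append)
  have "\<exists>L. uniform_limit B (\<lambda>j. kconv (kderiv b k) (eps j) f) L sequentially" if "b \<in> Basis" for b
    using uc[OF that, of "[]"] by (simp add: uniformly_convergent_on_def)
  then obtain L where L: "\<And>b. b \<in> Basis \<Longrightarrow> uniform_limit B (\<lambda>j. kconv (kderiv b k) (eps j) f) (L b) sequentially"
    by metis
  show ?case
  proof (rule Ck_on_SucI[OF B(1)])
    show "(F has_derivative (\<lambda>v. \<Sum>b\<in>Basis. (v \<bullet> b) * L b x)) (at x)" if "x \<in> B" for x
      by (rule kernel_limit_has_derivative[OF B Suc.prems(1) f Suc.prems(2) L that])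
    fix c :: 'a assume c: "c \<in> Basis"
    have "Ck_on n (L b) B" if "b \<in> Basis" for b
      by (rule Suc.IH[OF has_order_kderiv[OF Suc.prems(1)] L[OF that] uc[OF that]])
    then show "Ck_on n (\<lambda>x. \<Sum>b\<in>Basis. (c \<bullet> b) * L b x) B"
      using B by (intro Ck_on_sum Ck_on_mult Ck_on_const) auto
  qed
qed

lemma integrable_kconv:
  assumes "has_order k m" "\<epsilon> \<noteq> 0" "integrable lborel f"
  shows "integrable lborel (\<lambda>z. keval k \<epsilon> (x - z) * f z)"
proof -
  obtain C where C: "C \<ge> 0" "\<And>y. \<bar>keval k \<epsilon> y\<bar> \<le> C" using keval_bounded[OF assms(1,2)] by blast
  have [measurable]: "f \<in> borel_measurable lborel" using assms by simp
  show ?thesis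
  proof (rule Bochner_Integration.integrable_bound[of _ "\<lambda>z. C * f z"])
    show "AE z in lborel. norm (keval k \<epsilon> (x - z) * f z) \<le> norm (C * f z)"
      using C by (auto simp: abs_mult intro!: mult_right_mono)
  qed (use assms in auto)
qed

lemma kconv_add:
  assumes "has_order k m" "\<epsilon> \<noteq> 0" "integrable lborel f" "integrable lborel g"
  shows "kconv k \<epsilon> (\<lambda>z. f z + g z) x = kconv k \<epsilon> f x + kconv k \<epsilon> g x"
  unfolding kconv_def using integrable_kconv[OF assms(1,2)] assms(3,4) by (simp add: distrib_left)

section \<open>Integration by parts\<close>

lemma continuous_bounded_on_cball:
  fixes g :: "'a::euclidean_space \<Rightarrow> real"
  assumes "continuous_on UNIV g"
  shows "\<exists>C. \<forall>x\<in>cball 0 R. \<bar>g x\<bar> \<le> C"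
proof -
  have "compact (g ` cball 0 R)"
    using assms by (intro compact_continuous_image) (auto intro: continuous_on_subset)
  from compact_imp_bounded[OF this] show ?thesis unfolding bounded_iff by auto
qed

lemma bounded_compact_support:
  fixes g :: "'a::euclidean_space \<Rightarrow> real"
  assumes "continuous_on UNIV g" "\<And>z. norm z \<ge> S \<Longrightarrow> g z = 0"
  obtains C where "C \<ge> 0" "\<And>z. \<bar>g z\<bar> \<le> C"
proof -
  obtain C where C: "\<And>z. z \<in> cball 0 S \<Longrightarrow> \<bar>g z\<bar> \<le> C"
    using continuous_bounded_on_cball[OF assms(1), of S] by blast
  have "\<bar>g z\<bar> \<le> \<bar>C\<bar>" for z
    using C[of z] assms(2)[of z] by (cases "norm z \<ge> S") (auto simp: abs_le_iff)
  then show ?thesis using that[of "\<bar>C\<bar>"] by simp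
qed

lemma integrable_compact_support:
  fixes g :: "'a::euclidean_space \<Rightarrow> real"
  assumes "continuous_on UNIV g" "\<And>z. norm z \<ge> S \<Longrightarrow> g z = 0"
  shows "integrable lborel g"
proof -
  obtain C where C: "\<And>z. \<bar>g z\<bar> \<le> C" using bounded_compact_support[OF assms] by blast
  have [measurable]: "g \<in> borel_measurable borel" using assms(1) by (rule borel_measurable_continuous_onI)
  show ?thesis
  proof (rule Bochner_Integration.integrable_bound[of _ "\<lambda>z. C * indicator (cball 0 S) z"])
    show "integrable lborel (\<lambda>z::'a. C * indicator (cball 0 S) z)"
      using emeasure_lborel_cball_finite[of "0::'a" S] by (intro integrable_mult_right integrable_real_indicator) auto
    show "AE z in lborel. norm (g z) \<le> norm (C * indicator (cball 0 S) z)"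
    proof (rule AE_I2)
      fix z show "norm (g z) \<le> norm (C * indicator (cball 0 S) z)"
        using C[of z] assms(2)[of z] by (cases "norm z \<ge> S") auto
    qed
  qed simp
qed

lemma derivative_support:
  fixes g :: "'a::euclidean_space \<Rightarrow> real"
  assumes "\<And>z. norm z \<ge> S \<Longrightarrow> g z = 0" "(g has_derivative D) (at z)" "norm z > S"
  shows "D v = 0"
proof -
  have "open {z::'a. norm z > S}" by (intro open_Collect_less continuous_intros)
  then have "((\<lambda>_. 0) has_derivative D) (at z)"
    using assms by (intro has_derivative_transform_within_open[OF assms(2)]) auto
  from has_derivative_unique[OF this has_derivative_const] show ?thesis by simp
qed

text \<open>Translating \<open>H\<close> does not change its integral. A large ball on which \<open>H\<close> and its small
  translates live serves as the integrable density that differentiation under the integral requires.\<close>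

lemma integral_partial_derivative_zero:
  fixes H :: "'a::euclidean_space \<Rightarrow> real"
  assumes H: "\<And>y. (H has_derivative (\<lambda>v. D v y)) (at y)"
    and D: "\<And>b. b \<in> Basis \<Longrightarrow> continuous_on UNIV (D b)"
    and supp: "\<And>y. norm y \<ge> S \<Longrightarrow> H y = 0"
    and b: "b \<in> Basis"
  shows "(\<integral>y. D b y \<partial>lborel) = 0"
proof -
  have Hc: "continuous_on UNIV H"
    using H has_derivative_continuous by (blast intro: continuous_at_imp_continuous_on)
  have Dsupp: "D v y = 0" if "norm y \<ge> S + 1" for v y
    using derivative_support[of S H, OF supp H] that by auto
  obtain C0 where C0: "\<And>y. \<bar>H y\<bar> \<le> C0" using bounded_compact_support[OF Hc supp] by blast
  have "\<exists>C. \<forall>y. \<bar>D b y\<bar> \<le> C" if "b \<in> Basis" for b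
    using bounded_compact_support[OF D[OF that] Dsupp] by metis
  then obtain C where C: "\<And>b y. b \<in> Basis \<Longrightarrow> \<bar>D b y\<bar> \<le> C b" by metis
  have C': "\<bar>D b y\<bar> \<le> (\<Sum>b\<in>Basis. \<bar>C b\<bar>)" if "b \<in> Basis" for b y
    using C[OF that, of y] member_le_sum[OF that, of "\<lambda>b. \<bar>C b\<bar>"] by fastforce
  \<comment> \<open>The radius leaves room for translations by less than \<open>1\<close> and for the support of the derivative.\<close>
  let ?f = "indicator (ball 0 (S + 2)) :: 'a \<Rightarrow> real"
  have f: "integrable lborel ?f"
    using emeasure_lborel_ball_finite[of "0::'a" "S + 2"] by (intro integrable_real_indicator) auto
  have Hm: "H \<in> borel_measurable borel" using Hc by (rule borel_measurable_continuous_onI)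
  have Dm: "D c \<in> borel_measurable borel" if "c \<in> Basis" for c using D[OF that] by (rule borel_measurable_continuous_onI)
  have 1: "((\<lambda>x. \<integral>z. H (x - z) * ?f z \<partial>lborel) has_derivative (\<lambda>v. \<integral>z. D v (0 - z) * ?f z \<partial>lborel)) (at 0)"
    by (rule has_derivative_convolution[OF H C0 Dm C' f])
  have "(\<integral>z. H (x - z) * ?f z \<partial>lborel) = (\<integral>z. H z \<partial>lborel)" if "x \<in> ball 0 1" for x
  proof -
    have "H (x - z) * ?f z = H (x - z)" for z
    proof (cases "norm (x - z) \<ge> S")
      case False
      then have "norm z < S + 1" using that norm_triangle_sub[of z x] by (simp add: norm_minus_commute)
      then show ?thesis by simp
    qed (simp add: supp)
    then show ?thesis using integral_lborel_reflect[OF Hm, of x] by (simp only:)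
  qed
  then have "((\<lambda>x. \<integral>z. H z \<partial>lborel) has_derivative (\<lambda>v. \<integral>z. D v (0 - z) * ?f z \<partial>lborel)) (at 0)"
    by (intro has_derivative_transform_within_open[OF 1, of "ball 0 1"]) auto
  then have "(\<lambda>v. \<integral>z. D v (0 - z) * ?f z \<partial>lborel) = (\<lambda>v. 0)"
    by (rule has_derivative_unique[OF _ has_derivative_const])
  then have "(\<integral>z. D b (0 - z) * ?f z \<partial>lborel) = 0" by metis
  moreover have "D b (0 - z) * ?f z = D b (0 - z)" for z
    using Dsupp[of "0 - z" b] by (cases "norm z < S + 2") auto
  ultimately show ?thesis using integral_lborel_reflect[OF Dm[OF b], of 0] by (simp only:)
qed

text \<open>Derivatives move from the regularized kernel to a compactly supported density. For the singular
  kernel this would produce boundary terms at the diagonal as soon as the order reaches the dimension.\<close>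

lemma kconv_by_parts:
  fixes g :: "'a::euclidean_space \<Rightarrow> real"
  assumes k: "has_order k m" "\<epsilon> \<noteq> 0"
    and g: "\<And>z. g differentiable (at z)" "\<And>b. b \<in> Basis \<Longrightarrow> continuous_on UNIV (\<lambda>z. frechet_derivative g (at z) b)"
    and supp: "\<And>z. norm z \<ge> S \<Longrightarrow> g z = 0" and b: "b \<in> Basis"
  shows "kconv (kderiv b k) \<epsilon> g x = kconv k \<epsilon> (\<lambda>z. frechet_derivative g (at z) b) x"
proof -
  let ?g = "\<lambda>v z. frechet_derivative g (at z) v"
  have gd: "(g has_derivative (\<lambda>v. ?g v z)) (at z)" for z
    using g(1) frechet_derivative_works by blast
  have evc: "continuous_on UNIV (\<lambda>z. keval k \<epsilon> (x - z))" if "has_order k m" for k m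
  proof -
    have "continuous_on UNIV (keval k \<epsilon>)"
      using keval_has_derivative[OF k(2)] has_derivative_continuous by (blast intro: continuous_at_imp_continuous_on)
    then show ?thesis by (rule continuous_on_compose2) (auto intro: continuous_intros)
  qed
  have gc: "continuous_on UNIV g"
    using gd has_derivative_continuous by (blast intro: continuous_at_imp_continuous_on)
  have "(\<integral>z. keval k \<epsilon> (x - z) * ?g b z + - keval (kderiv b k) \<epsilon> (x - z) * g z \<partial>lborel) = 0"
  proof (rule integral_partial_derivative_zero[where H="\<lambda>z. keval k \<epsilon> (x - z) * g z" and S=S, OF _ _ _ b])
    fix z
    have "((\<lambda>z. x - z) has_derivative (\<lambda>v. 0 - v)) (at z)"
      by (intro has_derivative_diff has_derivative_const has_derivative_ident)
    from diff_chain_at[OF this keval_has_derivative[OF k(2), of k "x - z"]]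
    have 1: "((\<lambda>z. keval k \<epsilon> (x - z)) has_derivative (\<lambda>v. keval (kderiv (- v) k) \<epsilon> (x - z))) (at z)"
      by (simp add: o_def)
    have 2: "keval (kderiv (- v) k) \<epsilon> (x - z) = - keval (kderiv v k) \<epsilon> (x - z)" for v
      using linear_neg[OF has_derivative_linear[OF keval_has_derivative[OF k(2), of k "x - z"]]] .
    show "((\<lambda>z. keval k \<epsilon> (x - z) * g z) has_derivative
        (\<lambda>v. keval k \<epsilon> (x - z) * ?g v z + - keval (kderiv v k) \<epsilon> (x - z) * g z)) (at z)"
      using has_derivative_mult[OF 1 gd[of z]] unfolding 2 .
  next
    fix c :: 'a assume "c \<in> Basis"
    then show "continuous_on UNIV (\<lambda>z. keval k \<epsilon> (x - z) * ?g c z + - keval (kderiv c k) \<epsilon> (x - z) * g z)"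
      by (intro continuous_on_add continuous_on_mult continuous_on_minus g(2) gc evc[OF k(1)] evc[OF has_order_kderiv[OF k(1)]])
  qed (simp add: supp)
  moreover have "integrable lborel (?g b)"
    using derivative_support[of S g, OF supp gd]
    by (intro integrable_compact_support[OF g(2)[OF b], of "S + 1"]) auto
  moreover have "integrable lborel g" by (rule integrable_compact_support[OF gc supp])
  ultimately show ?thesis
    unfolding kconv_def using integrable_kconv[OF k] integrable_kconv[OF has_order_kderiv[OF k(1)] k(2), of g b x]
    by simp
qed

section \<open>Cutoff functions\<close>

lemma Ck_on_pos_part_power: "Ck_on n (\<lambda>t::real. max 0 t ^ Suc n) UNIV"
proof (induction n)
  case 0
  show ?case by (auto simp: Ck_on_0 intro!: continuous_intros)
next
  case (Suc n)
  show ?case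
  proof (rule Ck_on_SucI[OF open_UNIV, where D="\<lambda>v t. (v * real (Suc (Suc n))) * max 0 t ^ Suc n"])
    fix t :: real
    show "((\<lambda>t. max 0 t ^ Suc (Suc n)) has_derivative (\<lambda>v. (v * real (Suc (Suc n))) * max 0 t ^ Suc n)) (at t)"
    proof (cases "t = 0")
      case True
      have "((\<lambda>s::real. s *\<^sub>R (max 0 s ^ Suc n)) has_derivative (\<lambda>v. v *\<^sub>R (max 0 0 ^ Suc n))) (at 0)"
        by (rule has_derivative_mult_vanishing) (auto intro!: has_derivative_ident continuous_intros)
      moreover have "(\<lambda>s::real. s *\<^sub>R (max 0 s ^ Suc n)) = (\<lambda>s. max 0 s ^ Suc (Suc n))"
        by (auto simp: max_def fun_eq_iff)
      moreover have "(\<lambda>v::real. v *\<^sub>R (max 0 0 ^ Suc n)) = (\<lambda>v. (v * real (Suc (Suc n))) * max 0 (0::real) ^ Suc n)"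
        by simp
      ultimately show ?thesis using True by (simp only:)
    next
      case False
      show ?thesis
      proof (cases "t > 0")
        case True
        have "((\<lambda>t::real. t ^ Suc (Suc n)) has_derivative (\<lambda>v. (v * real (Suc (Suc n))) * max 0 t ^ Suc n)) (at t)"
          using True has_derivative_power[OF has_derivative_ident, of "Suc (Suc n)" t UNIV]
          by (simp only: max_absorb2 less_imp_le diff_Suc_1 mult.commute[of "real _"])
        then show ?thesis
          by (rule has_derivative_transform_within_open[of _ _ _ _ "{0<..}"]) (use True in auto)
      next
        case f: False
        have "((\<lambda>t::real. 0) has_derivative (\<lambda>v. (v * real (Suc (Suc n))) * max 0 t ^ Suc n)) (at t)"
          using f by simp
        then show ?thesis
          by (rule has_derivative_transform_within_open[of _ _ _ _ "{..<0}"]) (use f False in auto)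
      qed
    qed
  next
    fix b :: real
    show "Ck_on n (\<lambda>t. (b * real (Suc (Suc n))) * max 0 t ^ Suc n) UNIV"
      by (intro Ck_on_mult Ck_on_const Suc) auto
  qed
qed

text \<open>Composed of powers of the positive part so as to be of class \<open>C\<^sup>n\<close>, constant \<open>1\<close> on the ball of
  radius \<open>R\<close> and, for \<open>R \<ge> 0\<close>, \<open>0\<close> outside that of radius \<open>R + 1\<close>.\<close>

definition cutoff :: "nat \<Rightarrow> real \<Rightarrow> 'a::euclidean_space \<Rightarrow> real"
  where "cutoff n R x = max 0 (1 - max 0 (x \<bullet> x - R\<^sup>2) ^ Suc n) ^ Suc n"

lemma Ck_on_cutoff: "Ck_on n (cutoff n R :: 'a::euclidean_space \<Rightarrow> real) UNIV"
proof -
  have 1: "Ck_on n (\<lambda>x::'a. x \<bullet> x - R\<^sup>2) UNIV"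
  proof -
    have "Ck_on n (\<lambda>x::'a. (\<Sum>b\<in>Basis. (x \<bullet> b) * (x \<bullet> b)) + - R\<^sup>2) UNIV"
      by (intro Ck_on_add Ck_on_sum Ck_on_mult Ck_on_inner_left Ck_on_id Ck_on_const) auto
    then show ?thesis by (simp add: euclidean_inner[symmetric])
  qed
  have 2: "Ck_on n (\<lambda>x::'a. max 0 (x \<bullet> x - R\<^sup>2) ^ Suc n) UNIV"
    by (rule Ck_on_compose[OF _ _ _ Ck_on_pos_part_power 1]) auto
  have 3: "Ck_on n (\<lambda>x::'a. 1 - max 0 (x \<bullet> x - R\<^sup>2) ^ Suc n) UNIV"
    using Ck_on_add[OF open_UNIV Ck_on_const Ck_on_bounded_linear[OF bounded_linear_minus[OF bounded_linear_ident] open_UNIV 2], of 1]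
    by simp
  show ?thesis unfolding cutoff_def[abs_def]
    by (rule Ck_on_compose[OF _ _ _ Ck_on_pos_part_power 3]) auto
qed

lemma cutoff_eq_1:
  assumes "norm x \<le> R" shows "cutoff n R x = 1"
proof -
  have "x \<bullet> x \<le> R\<^sup>2" unfolding power2_norm_eq_inner[symmetric] using assms by (intro power_mono) auto
  then show ?thesis by (simp add: cutoff_def max_def)
qed

lemma cutoff_eq_0:
  assumes "norm x \<ge> R + 1" "R \<ge> 0" shows "cutoff n R x = 0"
proof -
  have "(R + 1)\<^sup>2 \<le> x \<bullet> x" unfolding power2_norm_eq_inner[symmetric] using assms by (intro power_mono) auto
  then have "x \<bullet> x - R\<^sup>2 \<ge> 1" using assms(2) by (simp add: power2_eq_square algebra_simps)
  then have "max 0 (x \<bullet> x - R\<^sup>2) ^ Suc n \<ge> 1" by (intro one_le_power) auto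
  then show ?thesis by (simp add: cutoff_def max_def del: power_Suc) 
qed

section \<open>Local Hoelder classes\<close>

text \<open>A recursive form of \<^const>\<open>Ck_Holder_loc\<close>, in which the first derivatives of a function of order
  \<open>k + 1\<close> are functions of order \<open>k\<close>. It permits a short proof that the class is closed under
  products, which is what the localization by cutoff functions requires.\<close>

primrec loc_Holder :: "nat \<Rightarrow> real \<Rightarrow> ('a::euclidean_space \<Rightarrow> real) \<Rightarrow> bool" where
  "loc_Holder 0 \<alpha> f \<longleftrightarrow> (\<forall>R. \<exists>C. \<forall>x\<in>cball 0 R. \<forall>y\<in>cball 0 R. \<bar>f x - f y\<bar> \<le> C * norm (x - y) powr \<alpha>)"
| "loc_Holder (Suc k) \<alpha> f \<longleftrightarrow> (\<forall>x. f differentiable (at x)) \<and> (\<forall>b\<in>Basis. loc_Holder k \<alpha> (\<lambda>x. frechet_derivative f (at x) b))"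

lemma loc_Holder_continuous:
  fixes f :: "'a::euclidean_space \<Rightarrow> real"
  assumes "0 < \<alpha>" "loc_Holder k \<alpha> f"
  shows "continuous_on UNIV f"
proof (cases k)
  case 0
  show ?thesis
  proof (rule continuous_at_imp_continuous_on, rule ballI)
    fix x :: 'a
    obtain C where C: "\<And>y z. y \<in> cball 0 (norm x + 1) \<Longrightarrow> z \<in> cball 0 (norm x + 1) \<Longrightarrow>
        \<bar>f y - f z\<bar> \<le> C * norm (y - z) powr \<alpha>"
      using assms(2) 0 by (metis loc_Holder.simps(1))
    have "((\<lambda>y. C * norm (y - x) powr \<alpha>) \<longlongrightarrow> C * norm (x - x) powr \<alpha>) (at x)"
      using assms(1) by (intro tendsto_intros) auto
    then have lim: "((\<lambda>y. C * norm (y - x) powr \<alpha>) \<longlongrightarrow> 0) (at x)" by simp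
    have "\<forall>\<^sub>F y in at x. y \<in> ball x 1" by (rule eventually_at_in_open') auto
    then have "\<forall>\<^sub>F y in at x. norm (f y - f x) \<le> C * norm (y - x) powr \<alpha>"
    proof eventually_elim
      case (elim y)
      then have "norm y \<le> norm x + 1" using norm_triangle_sub[of y x] by (simp add: dist_norm norm_minus_commute)
      then show ?case using C[of y x] by simp
    qed
    then have "((\<lambda>y. f y - f x) \<longlongrightarrow> 0) (at x)" using lim by (rule Lim_null_comparison)
    then show "isCont f x" by (simp add: isCont_def LIM_zero_iff)
  qed
next
  case (Suc m)
  then show ?thesis using assms(2)
    by (auto intro!: continuous_at_imp_continuous_on differentiable_imp_continuous_within)
qed

text \<open>On a ball of radius \<open>R\<close> the function is Lipschitz, and \<open>\<bar>x - y\<bar> \<le> (2 R)\<^sup>1\<^sup>-\<^sup>\<alpha> \<bar>x - y\<bar>\<^sup>\<alpha>\<close>.\<close>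

lemma loc_Holder_0I:
  fixes f :: "'a::euclidean_space \<Rightarrow> real"
  assumes \<alpha>: "0 < \<alpha>" "\<alpha> < 1" and d: "\<And>x. f differentiable (at x)"
    and c: "\<And>b. b \<in> Basis \<Longrightarrow> continuous_on UNIV (\<lambda>x. frechet_derivative f (at x) b)"
  shows "loc_Holder 0 \<alpha> f"
  unfolding loc_Holder.simps
proof
  fix R :: real
  have hd: "(f has_derivative frechet_derivative f (at x)) (at x)" for x
    using d frechet_derivative_works by blast
  have "\<exists>C. \<forall>x\<in>cball 0 R. \<bar>frechet_derivative f (at x) b\<bar> \<le> C" if "b \<in> Basis" for b
    by (rule continuous_bounded_on_cball[OF c[OF that]])
  then obtain C where C: "\<And>b x. b \<in> Basis \<Longrightarrow> x \<in> cball 0 R \<Longrightarrow> \<bar>frechet_derivative f (at x) b\<bar> \<le> C b" by metis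
  define K where "K = (\<Sum>b\<in>(Basis::'a set). \<bar>C b\<bar>)"
  have K: "K \<ge> 0" unfolding K_def by (intro sum_nonneg) auto
  have "onorm (frechet_derivative f (at x)) \<le> K" if x: "x \<in> cball 0 R" for x
  proof (rule onorm_le)
    fix v
    have "frechet_derivative f (at x) v = (\<Sum>b\<in>Basis. (v \<bullet> b) *\<^sub>R frechet_derivative f (at x) b)"
      by (rule linear_basis_expansion[OF has_derivative_linear[OF hd]])
    also have "norm \<dots> \<le> (\<Sum>b\<in>Basis. norm v * \<bar>C b\<bar>)"
    proof (rule sum_norm_le)
      fix b :: 'a assume b: "b \<in> Basis"
      show "norm ((v \<bullet> b) *\<^sub>R frechet_derivative f (at x) b) \<le> norm v * \<bar>C b\<bar>"
        unfolding norm_scaleR using C[OF b x] b by (intro mult_mono) (auto simp: Basis_le_norm)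
    qed
    finally show "norm (frechet_derivative f (at x) v) \<le> K * norm v"
      by (simp add: K_def sum_distrib_left mult.commute)
  qed
  then have lip: "\<bar>f x - f y\<bar> \<le> K * norm (x - y)" if "x \<in> cball 0 R" "y \<in> cball 0 R" for x y
    using differentiable_bound[OF convex_cball, of 0 R f "\<lambda>x. frechet_derivative f (at x)" K x y] that hd
    by (auto simp: has_derivative_at_withinI)
  show "\<exists>C. \<forall>x\<in>cball 0 R. \<forall>y\<in>cball 0 R. \<bar>f x - f y\<bar> \<le> C * norm (x - y) powr \<alpha>"
  proof (intro exI[of _ "K * (2 * R) powr (1 - \<alpha>)"] ballI)
    fix x y :: 'a assume xy: "x \<in> cball 0 R" "y \<in> cball 0 R"
    have "norm (x - y) = norm (x - y) powr (1 - \<alpha>) * norm (x - y) powr \<alpha>"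
      by (simp add: powr_add[symmetric])
    also have "\<dots> \<le> (2 * R) powr (1 - \<alpha>) * norm (x - y) powr \<alpha>"
      using \<alpha> xy norm_triangle_ineq4[of x y] by (intro mult_right_mono powr_mono2) auto
    finally have "K * norm (x - y) \<le> K * ((2 * R) powr (1 - \<alpha>) * norm (x - y) powr \<alpha>)"
      using K by (rule mult_left_mono)
    with lip[OF xy] show "\<bar>f x - f y\<bar> \<le> K * (2 * R) powr (1 - \<alpha>) * norm (x - y) powr \<alpha>"
      by (simp add: mult.assoc)
  qed
qed

lemma loc_Holder_Suc_imp:
  assumes \<alpha>: "0 < \<alpha>" "\<alpha> < 1"
  shows "loc_Holder (Suc k) \<alpha> f \<Longrightarrow> loc_Holder k \<alpha> f"
proof (induction k arbitrary: f)
  case 0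
  show ?case
    by (rule loc_Holder_0I[OF \<alpha>]) (use 0 loc_Holder_continuous[OF \<alpha>(1), of 0] in \<open>auto simp only: loc_Holder.simps(2)\<close>)
next
  case (Suc k)
  then show ?case unfolding loc_Holder.simps(2)[of "Suc k"] loc_Holder.simps(2)[of k \<alpha> f] by blast
qed

lemma loc_Holder_mono:
  assumes \<alpha>: "0 < \<alpha>" "\<alpha> < 1"
  shows "loc_Holder k \<alpha> f \<Longrightarrow> j \<le> k \<Longrightarrow> loc_Holder j \<alpha> f"
  by (induction k) (auto simp: le_Suc_eq simp del: loc_Holder.simps(2) dest: loc_Holder_Suc_imp[OF \<alpha>])

lemma loc_Holder_add:
  assumes \<alpha>: "0 < \<alpha>"
  shows "loc_Holder k \<alpha> f \<Longrightarrow> loc_Holder k \<alpha> g \<Longrightarrow> loc_Holder k \<alpha> (\<lambda>x. f x + g x)"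
proof (induction k arbitrary: f g)
  case 0
  show ?case unfolding loc_Holder.simps
  proof
    fix R
    obtain C D where "\<And>x y. x \<in> cball 0 R \<Longrightarrow> y \<in> cball 0 R \<Longrightarrow> \<bar>f x - f y\<bar> \<le> C * norm (x - y) powr \<alpha>"
      "\<And>x y. x \<in> cball 0 R \<Longrightarrow> y \<in> cball 0 R \<Longrightarrow> \<bar>g x - g y\<bar> \<le> D * norm (x - y) powr \<alpha>"
      using 0 unfolding loc_Holder.simps by metis
    then show "\<exists>C. \<forall>x\<in>cball 0 R. \<forall>y\<in>cball 0 R. \<bar>(f x + g x) - (f y + g y)\<bar> \<le> C * norm (x - y) powr \<alpha>"
      by (intro exI[of _ "C + D"] ballI) (smt (verit) distrib_right)
  qed
next
  case (Suc k)
  have e: "frechet_derivative (\<lambda>x. f x + g x) (at x) = (\<lambda>v. frechet_derivative f (at x) v + frechet_derivative g (at x) v)" for x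
    using Suc.prems by (intro frechet_derivative_at[symmetric] has_derivative_add)
      (auto simp: frechet_derivative_works[symmetric])
  show ?case using Suc unfolding loc_Holder.simps e by (auto intro: differentiable_add)
qed

lemma loc_Holder_mult:
  assumes \<alpha>: "0 < \<alpha>" "\<alpha> < 1"
  shows "loc_Holder k \<alpha> f \<Longrightarrow> loc_Holder k \<alpha> g \<Longrightarrow> loc_Holder k \<alpha> (\<lambda>x. f x * g x)"
proof (induction k arbitrary: f g)
  case 0
  show ?case unfolding loc_Holder.simps
  proof
    fix R
    obtain C D where CD: "\<And>x y. x \<in> cball 0 R \<Longrightarrow> y \<in> cball 0 R \<Longrightarrow> \<bar>f x - f y\<bar> \<le> C * norm (x - y) powr \<alpha>"
      "\<And>x y. x \<in> cball 0 R \<Longrightarrow> y \<in> cball 0 R \<Longrightarrow> \<bar>g x - g y\<bar> \<le> D * norm (x - y) powr \<alpha>"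
      using 0 unfolding loc_Holder.simps by metis
    obtain M N where MN: "\<And>x. x \<in> cball 0 R \<Longrightarrow> \<bar>f x\<bar> \<le> M" "\<And>x. x \<in> cball 0 R \<Longrightarrow> \<bar>g x\<bar> \<le> N"
      using 0 loc_Holder_continuous[OF \<alpha>(1)] continuous_bounded_on_cball by metis
    show "\<exists>C. \<forall>x\<in>cball 0 R. \<forall>y\<in>cball 0 R. \<bar>f x * g x - f y * g y\<bar> \<le> C * norm (x - y) powr \<alpha>"
    proof (intro exI[of _ "M * D + C * N"] ballI)
      fix x y :: 'a assume x: "x \<in> cball 0 R" and y: "y \<in> cball 0 R"
      have "f x * g x - f y * g y = f x * (g x - g y) + (f x - f y) * g y" by (simp add: algebra_simps)
      also have "\<bar>\<dots>\<bar> \<le> \<bar>f x\<bar> * \<bar>g x - g y\<bar> + \<bar>f x - f y\<bar> * \<bar>g y\<bar>"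
        by (metis abs_mult abs_triangle_ineq)
      also have "\<dots> \<le> M * (D * norm (x - y) powr \<alpha>) + (C * norm (x - y) powr \<alpha>) * N"
      proof (intro add_mono mult_mono)
        show "0 \<le> M" using MN(1)[OF x] by linarith
        show "0 \<le> C * norm (x - y) powr \<alpha>" using CD(1)[OF x y] by linarith
      qed (use CD MN x y in auto)
      finally show "\<bar>f x * g x - f y * g y\<bar> \<le> (M * D + C * N) * norm (x - y) powr \<alpha>"
        by (simp add: algebra_simps)
    qed
  qed
next
  case (Suc k)
  have e: "frechet_derivative (\<lambda>x. f x * g x) (at x) = (\<lambda>v. f x * frechet_derivative g (at x) v + frechet_derivative f (at x) v * g x)" for x
    using Suc.prems by (intro frechet_derivative_at[symmetric] has_derivative_mult)
      (auto simp: frechet_derivative_works[symmetric])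
  have "loc_Holder k \<alpha> f" "loc_Holder k \<alpha> g" using loc_Holder_Suc_imp[OF \<alpha>] Suc.prems by blast+
  then show ?case using Suc.prems Suc.IH unfolding loc_Holder.simps(2) e
    by (auto intro!: differentiable_mult loc_Holder_add[OF \<alpha>(1)])
qed

lemma Ck_on_imp_loc_Holder:
  assumes \<alpha>: "0 < \<alpha>" "\<alpha> < 1"
  shows "Ck_on (Suc k) f UNIV \<Longrightarrow> loc_Holder k \<alpha> f"
proof (induction k arbitrary: f)
  case 0
  then show ?case by (intro loc_Holder_0I[OF \<alpha>]) (auto simp: Ck_on_Suc Ck_on_0)
next
  case (Suc k)
  then show ?case unfolding loc_Holder.simps by (subst (asm) (2) Ck_on_Suc) auto
qed

lemma Ck_Holder_loc_imp_loc_Holder: "Ck_Holder_loc k \<alpha> f \<Longrightarrow> loc_Holder k \<alpha> f"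
proof (induction k arbitrary: f)
  case 0
  show ?case unfolding loc_Holder.simps
  proof
    fix R :: real
    have "compact (cball (0::'a) R)" by simp
    then show "\<exists>C. \<forall>x\<in>cball 0 R. \<forall>y\<in>cball 0 R. \<bar>f x - f y\<bar> \<le> C * norm (x - y) powr \<alpha>"
      using 0 unfolding Ck_Holder_loc_def by force
  qed
next
  case (Suc k)
  have C: "Ck_on (Suc k) f UNIV" using Suc.prems by (simp add: Ck_Holder_loc_def)
  have "Ck_Holder_loc k \<alpha> (\<lambda>x. frechet_derivative f (at x) b)" if b: "b \<in> Basis" for b
    unfolding Ck_Holder_loc_def
  proof (intro conjI allI impI)
    show "Ck_on k (\<lambda>x. frechet_derivative f (at x) b) UNIV" using C b by (simp add: Ck_on_Suc)
    fix K :: "'a set" and bs :: "'a list" assume K: "compact K"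
    have P: "bounded (iterated_partial cs f ` K)" if "set cs \<subseteq> Basis" "length cs \<le> Suc k" for cs
      using Suc.prems K that unfolding Ck_Holder_loc_def by blast
    have Q: "\<exists>C. \<forall>x\<in>K. \<forall>y\<in>K. \<bar>iterated_partial cs f x - iterated_partial cs f y\<bar> \<le> C * norm (x - y) powr \<alpha>"
      if "set cs \<subseteq> Basis" "length cs = Suc k" for cs
      using Suc.prems K that unfolding Ck_Holder_loc_def by blast
    show "bounded (iterated_partial bs (\<lambda>x. frechet_derivative f (at x) b) ` K)" if "set bs \<subseteq> Basis \<and> length bs \<le> k"
      using P[of "bs @ [b]"] that b unfolding iterated_partial_snoc by simp
    show "\<exists>C. \<forall>x\<in>K. \<forall>y\<in>K. \<bar>iterated_partial bs (\<lambda>x. frechet_derivative f (at x) b) x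
        - iterated_partial bs (\<lambda>x. frechet_derivative f (at x) b) y\<bar> \<le> C * norm (x - y) powr \<alpha>"
      if "set bs \<subseteq> Basis \<and> length bs = k"
      using Q[of "bs @ [b]"] that b unfolding iterated_partial_snoc by simp
  qed
  then show ?case using C Suc.IH by (simp add: Ck_on_Suc)
qed

section \<open>Kernels of critical order and beyond\<close>

lemma uniform_limit_mult_bounded:
  fixes g :: "'a \<Rightarrow> real" and u :: "nat \<Rightarrow> 'a \<Rightarrow> real"
  assumes "uniform_limit B u l sequentially" "\<And>x. x \<in> B \<Longrightarrow> \<bar>g x\<bar> \<le> G"
  shows "uniform_limit B (\<lambda>n x. g x * u n x) (\<lambda>x. g x * l x) sequentially"
  unfolding uniform_limit_iff
proof (intro allI impI)
  fix e :: real assume e: "e > 0"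
  have "\<forall>\<^sub>F n in sequentially. \<forall>x\<in>B. dist (u n x) (l x) < e / (\<bar>G\<bar> + 1)"
    using assms(1) e unfolding uniform_limit_iff by (auto simp: divide_pos_pos add_nonneg_pos)
  then show "\<forall>\<^sub>F n in sequentially. \<forall>x\<in>B. dist (g x * u n x) (g x * l x) < e"
  proof eventually_elim
    case (elim n)
    show ?case
    proof
      fix x assume x: "x \<in> B"
      have "\<bar>g x\<bar> * \<bar>u n x - l x\<bar> \<le> \<bar>G\<bar> * (e / (\<bar>G\<bar> + 1))"
        using elim x assms(2)[OF x] by (intro mult_mono) (auto simp: dist_real_def intro: less_imp_le)
      also have "\<dots> < e" using e by (simp add: divide_simps)
      finally show "dist (g x * u n x) (g x * l x) < e"
        by (simp add: dist_real_def right_diff_distrib[symmetric] abs_mult)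
    qed
  qed
qed

text \<open>A kernel of order \<open>d\<close>, the dimension, need not be locally integrable, and only cancellation can
  help. Let \<open>\<chi>\<close> be a cutoff function that is \<open>1\<close> near \<open>x\<close>. In \<open>g z - g x * \<chi> z\<close> the Hoelder condition gains a factor
  \<open>\<bar>x - z\<bar>\<^sup>\<alpha>\<close>, which suffices. The subtracted term is \<open>g x\<close> times the convolution of \<open>\<partial>\<^sub>b k\<close> with \<open>\<chi>\<close>, and
  an integration by parts turns the latter into the convolution of \<open>k\<close>, of order \<open>d - 1\<close>, with \<open>\<partial>\<^sub>b \<chi>\<close>.\<close>

lemma kernel_convergent_critical_order:
  fixes g :: "'a::euclidean_space \<Rightarrow> real"
  assumes \<alpha>: "0 < \<alpha>" "\<alpha> < 1" and k: "has_order k (DIM('a) - 1)" and b: "b \<in> Basis"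
    and g: "loc_Holder 0 \<alpha> g" and supp: "\<And>z. norm z \<ge> S \<Longrightarrow> g z = 0" and R: "R \<ge> 0"
  shows "uniformly_convergent_on (ball 0 R) (\<lambda>j. kconv (kderiv b k) (eps j) g)"
proof -
  let ?\<chi> = "cutoff 1 (R + 1) :: 'a \<Rightarrow> real" and ?B = "ball (0::'a) R"
  let ?\<chi>' = "\<lambda>z. frechet_derivative ?\<chi> (at z) b"
  have gc: "continuous_on UNIV g" by (rule loc_Holder_continuous[OF \<alpha>(1) g])
  have gm: "g \<in> borel_measurable borel" using gc by (rule borel_measurable_continuous_onI)
  have gi: "integrable lborel g" by (rule integrable_compact_support[OF gc supp])
  obtain G where G: "G \<ge> 0" "\<And>z. \<bar>g z\<bar> \<le> G" using bounded_compact_support[OF gc supp] by blast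
  have \<chi>C: "Ck_on (Suc 0) ?\<chi> UNIV" using Ck_on_cutoff[of 1] by simp
  have \<chi>d: "?\<chi> differentiable (at z)" for z using \<chi>C by (simp add: Ck_on_Suc)
  have \<chi>'c: "continuous_on UNIV (\<lambda>z. frechet_derivative ?\<chi> (at z) c)" if "c \<in> Basis" for c
    using \<chi>C that by (simp add: Ck_on_Suc Ck_on_0)
  have \<chi>c: "continuous_on UNIV ?\<chi>" using \<chi>C by (rule Ck_on_continuous)
  have \<chi>0: "?\<chi> z = 0" if "norm z \<ge> R + 2" for z by (rule cutoff_eq_0) (use that R in auto)
  have \<chi>i: "integrable lborel ?\<chi>" by (rule integrable_compact_support[OF \<chi>c \<chi>0])
  have \<chi>'0: "?\<chi>' z = 0" if "norm z \<ge> R + 3" for z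
    using \<chi>d[of z] that by (intro derivative_support[where z=z and S="R + 2" and g="?\<chi>", OF \<chi>0]) (auto simp: frechet_derivative_works[symmetric])
  have \<chi>'i: "integrable lborel ?\<chi>'" by (rule integrable_compact_support[OF \<chi>'c[OF b] \<chi>'0])
  obtain X where X: "\<And>z. \<bar>?\<chi>' z\<bar> \<le> X" using bounded_compact_support[OF \<chi>'c[OF b] \<chi>'0] by blast
  have ord: "has_order (kderiv b k) (DIM('a))" using has_order_kderiv[OF k, of b] by simp
  \<comment> \<open>The subtracted term converges after one integration by parts.\<close>
  have "small_near (DIM('a) - 1) ?B (\<lambda>_. ?\<chi>')"
    by (rule small_near_bounded[of _ 1 _ _ X]) (use X borel_measurable_continuous_onI[OF \<chi>'c[OF b]] in auto)
  then have "uniform_limit ?B (\<lambda>j. kconv k (eps j) ?\<chi>') (kconv k 0 ?\<chi>') sequentially"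
    by (rule kconv_uniform_limit[OF k _ \<chi>'i])
  moreover have "kconv k (eps j) ?\<chi>' = kconv (kderiv b k) (eps j) ?\<chi>" for j
    by (rule ext, rule kconv_by_parts[symmetric, OF k eps_neq \<chi>d \<chi>'c \<chi>0 b])
  ultimately have "uniform_limit ?B (\<lambda>j. kconv (kderiv b k) (eps j) ?\<chi>) (kconv k 0 ?\<chi>') sequentially" by simp
  then have 1: "uniform_limit ?B (\<lambda>j x. g x * kconv (kderiv b k) (eps j) ?\<chi> x) (\<lambda>x. g x * kconv k 0 ?\<chi>' x) sequentially"
    by (rule uniform_limit_mult_bounded[where G=G]) (use G in auto)
  \<comment> \<open>The difference falls under the pointwise criterion with exponent \<open>d - \<alpha>\<close>.\<close>
  define h where "h x z = g z - g x * ?\<chi> z" for x z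
  have hm: "h x \<in> borel_measurable borel" for x
    unfolding h_def using gm borel_measurable_continuous_onI[OF \<chi>c] by simp
  have hi: "integrable lborel (h x)" for x unfolding h_def using gi \<chi>i by simp
  obtain C where C: "\<And>x y. x \<in> cball 0 (R + 1) \<Longrightarrow> y \<in> cball 0 (R + 1) \<Longrightarrow> \<bar>g x - g y\<bar> \<le> C * norm (x - y) powr \<alpha>"
    using g unfolding loc_Holder.simps by metis
  have "small_near (DIM('a)) ?B h"
  proof (rule small_near_powr[of "DIM('a) - \<alpha>" 1 "\<bar>C\<bar>"])
    fix x z :: 'a assume xz: "x \<in> ?B" "z \<noteq> x" "norm (x - z) < 1"
    have zR: "norm z \<le> R + 1" using xz norm_triangle_sub[of z x] by (simp add: norm_minus_commute)
    have "\<bar>h x z\<bar> = \<bar>g x - g z\<bar>" using cutoff_eq_1[OF zR, of 1] by (simp add: h_def abs_minus_commute)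
    also have "\<dots> \<le> \<bar>C\<bar> * norm (x - z) powr \<alpha>"
      using C[of x z] xz zR by (auto intro: order_trans[OF _ mult_right_mono])
    finally have "inv_norm_pow (DIM('a)) (x - z) * \<bar>h x z\<bar> \<le> inv_norm_pow (DIM('a)) (x - z) * (\<bar>C\<bar> * norm (x - z) powr \<alpha>)"
      by (rule mult_left_mono) simp
    also have "inv_norm_pow (DIM('a)) (x - z) * (\<bar>C\<bar> * norm (x - z) powr \<alpha>) = \<bar>C\<bar> * norm (x - z) powr - (DIM('a) - \<alpha>)"
    proof -
      have "inv_norm_pow (DIM('a)) (x - z) = norm (x - z) powr - real (DIM('a))"
        using xz by (simp add: inv_norm_pow_eq_powr)
      then show ?thesis by (simp add: powr_add[symmetric])
    qed
    finally show "inv_norm_pow (DIM('a)) (x - z) * \<bar>h x z\<bar> \<le> \<bar>C\<bar> * norm (x - z) powr - (DIM('a) - \<alpha>)" .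
  next
    have "real (DIM('a)) \<ge> 1" using DIM_positive[where 'a='a] by linarith
    then show "0 \<le> real (DIM('a)) - \<alpha>" using \<alpha> by linarith
  qed (use \<alpha> hm in auto)
  moreover have "(\<integral>z. \<bar>h x z\<bar> \<partial>lborel) \<le> (\<integral>z. \<bar>g z\<bar> \<partial>lborel) + G * (\<integral>z. \<bar>?\<chi> z\<bar> \<partial>lborel)" for x
  proof -
    have "(\<integral>z. \<bar>h x z\<bar> \<partial>lborel) \<le> (\<integral>z. \<bar>g z\<bar> + G * \<bar>?\<chi> z\<bar> \<partial>lborel)"
    proof (rule integral_mono)
      fix z
      have "\<bar>h x z\<bar> \<le> \<bar>g z\<bar> + \<bar>g x\<bar> * \<bar>?\<chi> z\<bar>" unfolding h_def abs_mult[symmetric] by (rule abs_triangle_ineq4)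
      also have "\<dots> \<le> \<bar>g z\<bar> + G * \<bar>?\<chi> z\<bar>" using G(2)[of x] by (intro add_left_mono mult_right_mono) auto
      finally show "\<bar>h x z\<bar> \<le> \<bar>g z\<bar> + G * \<bar>?\<chi> z\<bar>" .
    qed (use hi gi \<chi>i in auto)
    then show ?thesis using gi \<chi>i by simp
  qed
  ultimately have 2: "uniform_limit ?B (\<lambda>j x. \<integral>z. keval (kderiv b k) (eps j) (x - z) * h x z \<partial>lborel)
      (\<lambda>x. \<integral>z. keval (kderiv b k) 0 (x - z) * h x z \<partial>lborel) sequentially"
    by (intro uniform_limit_kernel_integral[OF ord]) (use hi in auto)
  have "(\<integral>z. keval (kderiv b k) (eps j) (x - z) * h x z \<partial>lborel) + g x * kconv (kderiv b k) (eps j) ?\<chi> x = kconv (kderiv b k) (eps j) g x" for j x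
  proof -
    note i = integrable_kconv[OF ord eps_neq, of _ j x]
    have "(\<integral>z. keval (kderiv b k) (eps j) (x - z) * h x z \<partial>lborel)
      = (\<integral>z. keval (kderiv b k) (eps j) (x - z) * g z - g x * (keval (kderiv b k) (eps j) (x - z) * ?\<chi> z) \<partial>lborel)"
      by (simp add: h_def algebra_simps)
    also have "\<dots> = kconv (kderiv b k) (eps j) g x - g x * kconv (kderiv b k) (eps j) ?\<chi> x"
      unfolding kconv_def using i[OF gi] i[OF \<chi>i] by simp
    finally show ?thesis by simp
  qed
  with uniform_limit_add[OF 2 1] show ?thesis
    unfolding uniformly_convergent_on_def by auto
qed

text \<open>All derivatives in excess of the critical order are moved from the kernel to \<open>g\<close>.\<close>

lemma kernel_convergent_above_critical_order:
  fixes g :: "'a::euclidean_space \<Rightarrow> real"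
  assumes \<alpha>: "0 < \<alpha>" "\<alpha> < 1" and k: "has_order k (DIM('a) - 1)" and R: "R \<ge> 0"
  shows "loc_Holder j \<alpha> g \<Longrightarrow> (\<And>z. norm z \<ge> S \<Longrightarrow> g z = 0) \<Longrightarrow> set bs \<subseteq> Basis \<Longrightarrow> length bs = Suc j \<Longrightarrow>
    uniformly_convergent_on (ball 0 R) (\<lambda>n. kconv (kderivs bs k) (eps n) g)"
proof (induction j arbitrary: g bs S)
  case 0
  then obtain b where "bs = [b]" "b \<in> Basis" by (cases bs) auto
  then show ?case using kernel_convergent_critical_order[OF \<alpha> k _ "0.prems"(1,2) R] by simp
next
  case (Suc j)
  then obtain b cs where bs: "bs = b # cs" "b \<in> Basis" "set cs \<subseteq> Basis" "length cs = Suc j"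
    by (cases bs) auto
  let ?g = "\<lambda>b z. frechet_derivative g (at z) b"
  have gd: "g differentiable (at z)" and gH: "c \<in> Basis \<Longrightarrow> loc_Holder j \<alpha> (?g c)" for z c
    using Suc.prems(1) by auto
  have "kconv (kderivs bs k) (eps n) g x = kconv (kderivs cs k) (eps n) (?g b) x" for n x
    unfolding bs kderivs.simps
    by (rule kconv_by_parts[OF has_order_kderivs[OF k] eps_neq gd loc_Holder_continuous[OF \<alpha>(1) gH] Suc.prems(2) bs(2)])
  moreover have "uniformly_convergent_on (ball 0 R) (\<lambda>n. kconv (kderivs cs k) (eps n) (?g b))"
  proof (rule Suc.IH[OF gH[OF bs(2)] _ bs(3,4)])
    show "?g b z = 0" if "norm z \<ge> S + 1" for z
      using that gd[of z] by (intro derivative_support[where z=z and S=S and g=g, OF Suc.prems(2)])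
        (auto simp: frechet_derivative_works[symmetric])
  qed
  ultimately show ?case by (simp add: fun_eq_iff uniformly_convergent_on_def)
qed

text \<open>Only the part of \<open>f\<close> near the ball matters for regularity there: the remainder stays away from
  the diagonal, where the kernels are harmless to every order. The cutoff function makes the near part
  compactly supported, as the integrations by parts require.\<close>

theorem kernel_convergent_Ck_Holder:
  fixes f :: "'a::euclidean_space \<Rightarrow> real"
  assumes \<alpha>: "0 < \<alpha>" "\<alpha> < 1" and f: "Ck_Holder_loc q \<alpha> f" and fi: "integrable lborel f" and R: "R \<ge> 0"
    and k: "has_order k 0" and bs: "set bs \<subseteq> Basis" "length bs \<le> q + DIM('a)"
  shows "uniformly_convergent_on (ball 0 R) (\<lambda>n. kconv (kderivs bs k) (eps n) f)"
proof -
  let ?\<chi> = "cutoff (Suc q) (R + 1) :: 'a \<Rightarrow> real"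
  define g where "g z = ?\<chi> z * f z" for z
  define r where "r z = f z - g z" for z
  have g: "loc_Holder q \<alpha> g" unfolding g_def
    by (intro loc_Holder_mult[OF \<alpha>] Ck_on_imp_loc_Holder[OF \<alpha>] Ck_on_cutoff Ck_Holder_loc_imp_loc_Holder f)
  have supp: "g z = 0" if "norm z \<ge> R + 2" for z
    unfolding g_def using cutoff_eq_0[of "R + 1" z "Suc q"] that R by simp
  have gc: "continuous_on UNIV g" by (rule loc_Holder_continuous[OF \<alpha>(1) g])
  have gi: "integrable lborel g" by (rule integrable_compact_support[OF gc supp])
  have ri: "integrable lborel r" unfolding r_def using fi gi by simp
  have h: "has_order (kderivs cs k) (length cs)" for cs using has_order_kderivs[OF k, of cs] by simp
  have "small_near (length bs) (ball 0 R) (\<lambda>_. r)"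
  proof (rule small_near_zero[of 1])
    show "r z = 0" if "x \<in> ball 0 R" "norm (x - z) < 1" for x z
    proof -
      have "norm z \<le> R + 1" using that norm_triangle_sub[of z x] by (simp add: norm_minus_commute)
      then show ?thesis by (simp add: r_def g_def cutoff_eq_1)
    qed
  qed (use ri in auto)
  then have far: "uniformly_convergent_on (ball 0 R) (\<lambda>n. kconv (kderivs bs k) (eps n) r)"
    using kconv_uniform_limit[OF h _ ri] unfolding uniformly_convergent_on_def by blast
  have near: "uniformly_convergent_on (ball 0 R) (\<lambda>n. kconv (kderivs bs k) (eps n) g)"
  proof (cases "length bs < DIM('a)")
    case True
    obtain G where "\<And>z. \<bar>g z\<bar> \<le> G" using bounded_compact_support[OF gc supp] by blast
    then have "small_near (length bs) (ball 0 R) (\<lambda>_. g)"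
      using True gc by (intro small_near_bounded[of _ 1 _ _ G]) (auto intro: borel_measurable_continuous_onI)
    then show ?thesis
      using kconv_uniform_limit[OF h _ gi] unfolding uniformly_convergent_on_def by blast
  next
    case False
    define j where "j = length bs - DIM('a)"
    \<comment> \<open>The innermost \<open>d - 1\<close> derivatives stay on the kernel; the outer \<open>j + 1\<close> lead to the critical order and past it.\<close>
    let ?cs = "take (Suc j) bs" and ?ds = "drop (Suc j) bs"
    have "DIM('a) \<ge> 1" using DIM_positive[where 'a='a] by linarith
    then have "length bs = j + DIM('a)" "Suc j \<le> length bs" "j \<le> q"
      using False bs(2) unfolding j_def by linarith+
    then have len: "length ?cs = Suc j" "length ?ds = DIM('a) - 1" "j \<le> q" by auto
    have "uniformly_convergent_on (ball 0 R) (\<lambda>n. kconv (kderivs ?cs (kderivs ?ds k)) (eps n) g)"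
    proof (rule kernel_convergent_above_critical_order[OF \<alpha> _ R loc_Holder_mono[OF \<alpha> g len(3)] supp _ len(1)])
      show "has_order (kderivs ?ds k) (DIM('a) - 1)" using h[of ?ds] len(2) by simp
      show "set ?cs \<subseteq> Basis" using bs(1) set_take_subset by fast
    qed
    then show ?thesis unfolding kderivs_append[symmetric] by simp
  qed
  have "kconv (kderivs bs k) (eps n) g x + kconv (kderivs bs k) (eps n) r x = kconv (kderivs bs k) (eps n) f x" for n x
    using kconv_add[OF h eps_neq gi ri, of bs n x] by (simp add: r_def)
  then show ?thesis using uniformly_convergent_add[OF near far] by simp
qed

section \<open>The spatial rank map\<close>

text \<open>The spatial rank map of the distribution with density \<open>f\<close>. Since \<^term>\<open>sgn (x - z)\<close> is the gradient of
  the distance to \<open>z\<close>, it is the gradient of the expected distance.\<close>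

definition spatial_rank :: "('a::euclidean_space \<Rightarrow> real) \<Rightarrow> 'a \<Rightarrow> 'a"
  where "spatial_rank f x = (\<integral>z. f z *\<^sub>R sgn (x - z) \<partial>lborel)"

lemma sgn_measurable [measurable]: "(sgn :: 'a::euclidean_space \<Rightarrow> 'a) \<in> borel_measurable borel"
  unfolding sgn_div_norm[abs_def] by measurable

lemma integrable_density_bounded:
  fixes g :: "'a::euclidean_space \<Rightarrow> real"
  assumes "integrable lborel f" "g \<in> borel_measurable borel" "\<And>z. \<bar>g z\<bar> \<le> C"
  shows "integrable lborel (\<lambda>z. f z * g z)"
proof (rule Bochner_Integration.integrable_bound[of _ "\<lambda>z. C * f z"])
  have "C \<ge> 0" using assms(3)[of undefined] by linarith
  then show "AE z in lborel. norm (f z * g z) \<le> norm (C * f z)"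
    using mult_right_mono[OF assms(3) abs_ge_zero] by (simp add: abs_mult mult.commute)
qed (use assms in auto)

lemma integrable_sgn:
  fixes f :: "'a::euclidean_space \<Rightarrow> real"
  assumes "integrable lborel f"
  shows "integrable lborel (\<lambda>z. f z *\<^sub>R sgn (x - z))"
proof (rule Bochner_Integration.integrable_bound[OF assms])
  show "AE z in lborel. norm (f z *\<^sub>R sgn (x - z)) \<le> norm (f z)"
    by (auto simp: norm_sgn)
qed (use assms in measurable)

lemma spatial_rank_inner:
  assumes "integrable lborel f"
  shows "spatial_rank f x \<bullet> v = (\<integral>z. f z * (sgn (x - z) \<bullet> v) \<partial>lborel)"
    "integrable lborel (\<lambda>z. f z * (sgn (x - z) \<bullet> v))"
  using integral_inner_left[OF integrable_sgn[OF assms, of x], of v]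
    integrable_inner_left[OF integrable_sgn[OF assms, of x], of v]
  by (auto simp: spatial_rank_def)

lemma spatial_rank_eq_kconv:
  assumes "integrable lborel f"
  shows "spatial_rank f x \<bullet> v = kconv (KDir v) 0 f x"
  unfolding spatial_rank_inner(1)[OF assms] kconv_def
  by (intro Bochner_Integration.integral_cong) (auto simp: sgn_div_norm divide_inverse)

text \<open>The Cauchy--Schwarz inequality; the norm is differentiable except at the origin, and there \<open>0\<close>,
  the value of \<^const>\<open>sgn\<close>, is a subgradient.\<close>

lemma norm_ge_subgradient:
  fixes a b :: "'a::real_inner"
  shows "norm b \<ge> norm a + sgn a \<bullet> (b - a)"
proof (cases "a = 0")
  case False
  have "sgn a \<bullet> b \<le> norm b"
    using norm_cauchy_schwarz[of "sgn a" b] False by (simp add: norm_sgn)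
  moreover have "sgn a \<bullet> a = norm a"
    using False by (simp add: sgn_div_norm power2_norm_eq_inner[symmetric] power2_eq_square)
  ultimately show ?thesis by (simp add: inner_diff_right)
qed simp

lemma AE_not_in_line:
  fixes x w :: "'a::euclidean_space"
  assumes "DIM('a) \<ge> 2"
  shows "AE z in lborel. x - z \<notin> span {w}"
proof -
  have "dim (span {w}) \<le> 1" unfolding dim_span using dim_le_card[of "{w}" "{w}"] by (simp add: span_superset)
  then have "negligible (span {w})" using assms by (intro negligible_lowdim) simp
  then have "span {w} \<in> null_sets lborel"
    using closed_span[of "{w}"] negligible_iff_null_sets null_sets_completion_iff by (metis borel_closed sets_lborel)
  then have "AE v in lborel. v \<notin> span {w}" by (rule AE_not_in)
  then have "AE v in distr lborel borel (\<lambda>z. x - z). v \<notin> span {w}" unfolding lborel_reflect .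
  moreover have "{v. v \<notin> span {w}} \<in> sets borel"
    using closed_span[of "{w}"] by (intro borel_open) (simp add: closed_def Compl_eq)
  ultimately show ?thesis by (subst (asm) AE_distr_iff) simp_all
qed

lemma integral_density_pos:
  fixes f g :: "'a::euclidean_space \<Rightarrow> real"
  assumes f: "\<And>z. f z \<ge> 0" "integrable lborel f" "(\<integral>z. f z \<partial>lborel) = 1"
    and g: "AE z in lborel. g z > 0" "integrable lborel (\<lambda>z. f z * g z)"
  shows "(\<integral>z. f z * g z \<partial>lborel) > 0"
proof -
  have nn: "AE z in lborel. 0 \<le> f z * g z" using g(1) by eventually_elim (simp add: f)
  have "(\<integral>z. f z * g z \<partial>lborel) \<noteq> 0"
  proof
    assume "(\<integral>z. f z * g z \<partial>lborel) = 0"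
    then have "AE z in lborel. f z * g z = 0" using integral_nonneg_eq_0_iff_AE[OF g(2) nn] by simp
    then have "AE z in lborel. f z = 0" using g(1) by eventually_elim simp
    then have "(\<integral>z. f z \<partial>lborel) = 0" by (rule integral_eq_zero_AE)
    with f(3) show False by simp
  qed
  moreover have "(\<integral>z. f z * g z \<partial>lborel) \<ge> 0" by (rule integral_nonneg_AE[OF nn])
  ultimately show ?thesis by simp
qed

text \<open>Adding the subgradient inequalities for \<open>x - z\<close> and \<open>y - z\<close> gives monotonicity. Equality would
  force these vectors to be parallel, which puts \<open>z\<close> on the line through \<open>x\<close> and \<open>y\<close>.\<close>

lemma sgn_strictly_monotone:
  fixes x y z :: "'a::euclidean_space"
  assumes "x \<noteq> y" "x - z \<notin> span {x - y}"
  shows "(sgn (x - z) - sgn (y - z)) \<bullet> (x - y) > 0"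
proof -
  let ?a = "x - z" and ?b = "y - z"
  have 1: "norm ?b \<ge> norm ?a + sgn ?a \<bullet> (?b - ?a)" and 2: "norm ?a \<ge> norm ?b + sgn ?b \<bullet> (?a - ?b)"
    by (rule norm_ge_subgradient)+
  have a0: "?a \<noteq> 0" using assms(2) span_zero by metis
  have "norm ?b \<noteq> norm ?a + sgn ?a \<bullet> (?b - ?a)"
  proof
    assume "norm ?b = norm ?a + sgn ?a \<bullet> (?b - ?a)"
    moreover have "sgn ?a \<bullet> ?a = norm ?a"
      using a0 by (simp add: sgn_div_norm power2_norm_eq_inner[symmetric] power2_eq_square)
    ultimately have "sgn ?a \<bullet> ?b = norm ?b" by (simp add: inner_diff_right)
    then have "inverse (norm ?a) * (?a \<bullet> ?b) = norm ?b" unfolding sgn_div_norm inner_scaleR_left .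
    moreover have "?a \<bullet> ?b = norm ?a * (inverse (norm ?a) * (?a \<bullet> ?b))" using a0 by simp
    ultimately have "?a \<bullet> ?b = norm ?a * norm ?b" by (simp only:)
    then have e: "norm ?a *\<^sub>R ?b = norm ?b *\<^sub>R ?a" by (simp add: norm_cauchy_schwarz_eq)
    have "(norm ?a - norm ?b) *\<^sub>R ?a = norm ?a *\<^sub>R ?a - norm ?a *\<^sub>R ?b"
      by (simp only: scaleR_diff_left e)
    also have "\<dots> = norm ?a *\<^sub>R (x - y)" by (simp add: scaleR_diff_right[symmetric])
    finally have e2: "(norm ?a - norm ?b) *\<^sub>R ?a = norm ?a *\<^sub>R (x - y)" .
    then have ne: "norm ?a - norm ?b \<noteq> 0" using a0 assms(1) by auto
    have "?a = (1 / (norm ?a - norm ?b)) *\<^sub>R ((norm ?a - norm ?b) *\<^sub>R ?a)" using ne by simp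
    also have "\<dots> = (norm ?a / (norm ?a - norm ?b)) *\<^sub>R (x - y)" unfolding e2 by simp
    finally have "?a \<in> span {x - y}" by (metis span_base span_scale singletonI)
    with assms(2) show False by simp
  qed
  with 1 2 show ?thesis by (simp add: inner_diff_left inner_diff_right)
qed

lemma spatial_rank_strictly_monotone:
  fixes f :: "'a::euclidean_space \<Rightarrow> real"
  assumes dim: "DIM('a) \<ge> 2" and f: "\<And>z. f z \<ge> 0" "integrable lborel f" "(\<integral>z. f z \<partial>lborel) = 1"
    and "x \<noteq> y"
  shows "(spatial_rank f x - spatial_rank f y) \<bullet> (x - y) > 0"
proof -
  note i = spatial_rank_inner[OF f(2)]
  have e: "f z * ((sgn (x - z) - sgn (y - z)) \<bullet> (x - y)) = f z * (sgn (x - z) \<bullet> (x - y)) - f z * (sgn (y - z) \<bullet> (x - y))" for z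
    by (simp add: inner_diff_left right_diff_distrib)
  have "(\<integral>z. f z * ((sgn (x - z) - sgn (y - z)) \<bullet> (x - y)) \<partial>lborel) > 0"
  proof (rule integral_density_pos[OF f])
    show "AE z in lborel. (sgn (x - z) - sgn (y - z)) \<bullet> (x - y) > 0"
      using AE_not_in_line[OF dim, of x "x - y"] by eventually_elim (rule sgn_strictly_monotone[OF assms(5)])
    show "integrable lborel (\<lambda>z. f z * ((sgn (x - z) - sgn (y - z)) \<bullet> (x - y)))"
      unfolding e using i(2) by simp
  qed
  also have "(\<integral>z. f z * ((sgn (x - z) - sgn (y - z)) \<bullet> (x - y)) \<partial>lborel) = (spatial_rank f x - spatial_rank f y) \<bullet> (x - y)"
    unfolding e by (subst Bochner_Integration.integral_diff[OF i(2) i(2)]) (simp only: i(1) inner_diff_left[of "spatial_rank f x"])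
  finally show ?thesis .
qed

section \<open>Quantiles as solutions of the gradient equation\<close>

definition objective :: "('a::euclidean_space \<Rightarrow> real) \<Rightarrow> real \<Rightarrow> 'a \<Rightarrow> 'a \<Rightarrow> real"
  where "objective f \<beta> u x = (\<integral>z. f z * (norm (x - z) - norm z) \<partial>lborel) - (\<beta> *\<^sub>R u) \<bullet> x"

lemma geometric_objective_density:
  assumes "f \<in> borel_measurable borel" "\<And>z. f z \<ge> 0"
  shows "geometric_objective (density lborel (\<lambda>x. ennreal (f x))) \<beta> u x = objective f \<beta> u x"
  unfolding geometric_objective_def objective_def using assms
  by (subst integral_density) auto

lemma integrable_objective:
  fixes f :: "'a::euclidean_space \<Rightarrow> real"
  assumes "integrable lborel f"
  shows "integrable lborel (\<lambda>z. f z * (norm (x - z) - norm z))"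
proof (rule integrable_density_bounded[OF assms, of _ "norm x"])
  show "\<bar>norm (x - z) - norm z\<bar> \<le> norm x" for z
    using norm_triangle_ineq4[of x z] norm_triangle_sub[of z x] by (simp add: norm_minus_commute)
qed measurable

lemma objective_subgradient:
  fixes f :: "'a::euclidean_space \<Rightarrow> real"
  assumes f: "\<And>z. f z \<ge> 0" "integrable lborel f"
  shows "objective f \<beta> u y \<ge> objective f \<beta> u x + (spatial_rank f x - \<beta> *\<^sub>R u) \<bullet> (y - x)"
proof -
  have "(\<integral>z. f z * (norm (x - z) - norm z) \<partial>lborel) + spatial_rank f x \<bullet> (y - x)
     = (\<integral>z. f z * (norm (x - z) - norm z) + f z * (sgn (x - z) \<bullet> (y - x)) \<partial>lborel)"
    using spatial_rank_inner[OF f(2)] integrable_objective[OF f(2)] by simp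
  also have "\<dots> \<le> (\<integral>z. f z * (norm (y - z) - norm z) \<partial>lborel)"
  proof (rule integral_mono)
    fix z
    have "norm (x - z) + sgn (x - z) \<bullet> (y - x) \<le> norm (y - z)"
      using norm_ge_subgradient[of "x - z" "y - z"] by simp
    then have "f z * (norm (x - z) + sgn (x - z) \<bullet> (y - x)) \<le> f z * norm (y - z)"
      using f(1) by (rule mult_left_mono)
    then show "f z * (norm (x - z) - norm z) + f z * (sgn (x - z) \<bullet> (y - x)) \<le> f z * (norm (y - z) - norm z)"
      by (simp add: algebra_simps)
  qed (use spatial_rank_inner[OF f(2)] integrable_objective[OF f(2)] in auto)
  finally show ?thesis by (simp add: objective_def inner_diff_left inner_diff_right)
qed

lemma norm_spatial_rank_le_1:
  fixes f :: "'a::euclidean_space \<Rightarrow> real"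
  assumes f: "\<And>z. f z \<ge> 0" "integrable lborel f" "(\<integral>z. f z \<partial>lborel) = 1"
  shows "norm (spatial_rank f x) \<le> 1"
proof -
  have "norm (spatial_rank f x) \<le> (\<integral>z. norm (f z *\<^sub>R sgn (x - z)) \<partial>lborel)"
    unfolding spatial_rank_def by (rule integral_norm_bound)
  also have "\<dots> \<le> (\<integral>z. f z \<partial>lborel)"
    using f by (intro integral_mono integrable_norm integrable_sgn) (auto simp: norm_sgn)
  finally show ?thesis using f(3) by simp
qed

lemma objective_continuous:
  fixes f :: "'a::euclidean_space \<Rightarrow> real"
  assumes f: "\<And>z. f z \<ge> 0" "integrable lborel f" "(\<integral>z. f z \<partial>lborel) = 1"
  shows "continuous_on UNIV (objective f \<beta> u)"
proof (rule continuous_at_imp_continuous_on, rule ballI)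
  fix x
  let ?K = "1 + norm (\<beta> *\<^sub>R u)"
  have up: "objective f \<beta> u x - objective f \<beta> u y \<le> ?K * norm (x - y)" for x y
  proof -
    have "objective f \<beta> u x - objective f \<beta> u y \<le> (spatial_rank f x - \<beta> *\<^sub>R u) \<bullet> (x - y)"
      using objective_subgradient[OF f(1,2), where x=x and y=y and \<beta>=\<beta> and u=u] by (simp add: inner_diff_right)
    also have "\<dots> \<le> norm (spatial_rank f x - \<beta> *\<^sub>R u) * norm (x - y)" by (rule norm_cauchy_schwarz)
    also have "\<dots> \<le> ?K * norm (x - y)"
      using norm_spatial_rank_le_1[OF f, of x] norm_triangle_ineq4[of "spatial_rank f x" "\<beta> *\<^sub>R u"] by (intro mult_right_mono) auto
    finally show ?thesis .
  qed
  have "norm (objective f \<beta> u y - objective f \<beta> u x) \<le> ?K * norm (y - x)" for y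
    using up[of x y] up[of y x] by (simp add: abs_le_iff norm_minus_commute)
  then have "\<forall>\<^sub>F y in at x. norm (objective f \<beta> u y - objective f \<beta> u x) \<le> ?K * norm (y - x)"
    by (intro always_eventually allI)
  moreover have "((\<lambda>y. ?K * norm (y - x)) \<longlongrightarrow> 0) (at x)"
    by (intro tendsto_mult_right_zero tendsto_norm_zero) (simp add: LIM_zero)
  ultimately have "((\<lambda>y. objective f \<beta> u y - objective f \<beta> u x) \<longlongrightarrow> 0) (at x)"
    by (rule Lim_null_comparison)
  then show "isCont (objective f \<beta> u) x" by (simp add: isCont_def LIM_zero_iff)
qed

text \<open>By the triangle inequality \<open>\<bar>x - z\<bar> - \<bar>z\<bar>\<close> is at least \<open>\<bar>x\<bar> - 2 \<bar>z\<bar>\<close> and at least \<open>- \<bar>x\<bar>\<close>. The second bound is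
  used only outside a ball so large that its complement has mass below \<open>(1 - \<beta>) / 4\<close>.\<close>

lemma objective_coercive:
  fixes f :: "'a::euclidean_space \<Rightarrow> real"
  assumes f: "\<And>z. f z \<ge> 0" "integrable lborel f" "(\<integral>z. f z \<partial>lborel) = 1"
    and \<beta>: "0 \<le> \<beta>" "\<beta> < 1" and u: "norm u = 1"
  obtains r where "r \<ge> 0" "\<And>x. objective f \<beta> u x \<ge> (1 - \<beta>) / 2 * norm x - 2 * r"
proof -
  have [measurable]: "f \<in> borel_measurable borel" using f(2) by simp
  have "(\<lambda>n. \<integral>z. f z * indicator (- cball 0 (real n)) z \<partial>lborel) \<longlonglongrightarrow> (\<integral>(z::'a). 0 \<partial>lborel)"
  proof (rule integral_dominated_convergence[where w=f])
    show "AE z in lborel. (\<lambda>n. f z * indicator (- cball 0 (real n)) z) \<longlonglongrightarrow> 0"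
    proof (rule AE_I2)
      fix z :: 'a
      obtain N where "norm z \<le> real N" using real_arch_simple by blast
      then have "\<forall>\<^sub>F n in sequentially. f z * indicator (- cball 0 (real n)) z = 0"
        by (intro eventually_sequentiallyI[of N]) auto
      then show "(\<lambda>n. f z * indicator (- cball 0 (real n)) z) \<longlonglongrightarrow> 0" by (rule tendsto_eventually)
    qed
    show "AE z in lborel. norm (f z * indicator (- cball 0 (real n)) z) \<le> f z" for n
      using f(1) by (auto simp: indicator_def)
  qed (use f in auto)
  then have "\<forall>\<^sub>F n in sequentially. (\<integral>z. f z * indicator (- cball 0 (real n)) z \<partial>lborel) < (1 - \<beta>) / 4"
    using \<beta> by (intro order_tendstoD(2)[where y=0]) auto
  then obtain n where n: "(\<integral>z. f z * indicator (- cball 0 (real n)) z \<partial>lborel) < (1 - \<beta>) / 4"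
    by (auto simp: eventually_sequentially)
  let ?\<eta> = "\<integral>z. f z * indicator (- cball 0 (real n)) z \<partial>lborel"
  have ii: "integrable lborel (\<lambda>z. f z * indicator (- cball 0 (real n)) z)"
    by (rule integrable_density_bounded[OF f(2), of _ 1]) (auto simp: indicator_def)
  show ?thesis
  proof (rule that[of "real n"])
    fix x :: 'a
    have "norm x - 2 * real n - 2 * norm x * ?\<eta> =
       (\<integral>z. (norm x - 2 * real n) * f z - (2 * norm x) * (f z * indicator (- cball 0 (real n)) z) \<partial>lborel)"
      using f ii by simp
    also have "\<dots> \<le> (\<integral>z. f z * (norm (x - z) - norm z) \<partial>lborel)"
    proof (rule integral_mono)
      fix z
      have "norm x - 2 * real n - 2 * norm x * indicator (- cball 0 (real n)) z \<le> norm (x - z) - norm z"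
        using norm_triangle_sub[of x z] norm_triangle_sub[of z x] 
        by (cases "z \<in> cball 0 (real n)") (auto simp: norm_minus_commute)
      then have "f z * (norm x - 2 * real n - 2 * norm x * indicator (- cball 0 (real n)) z) \<le> f z * (norm (x - z) - norm z)"
        using f(1) by (rule mult_left_mono)
      moreover have "f z * (norm x - 2 * real n - 2 * norm x * i) = (norm x - 2 * real n) * f z - (2 * norm x) * (f z * i)" for i
        by (simp add: algebra_simps)
      ultimately show "(norm x - 2 * real n) * f z - (2 * norm x) * (f z * indicator (- cball 0 (real n)) z) \<le> f z * (norm (x - z) - norm z)"
        by (simp only:)
    qed (use f ii integrable_objective[OF f(2)] in auto)
    finally have 1: "norm x - 2 * real n - 2 * norm x * ?\<eta> \<le> (\<integral>z. f z * (norm (x - z) - norm z) \<partial>lborel)" .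
    have 2: "(\<beta> *\<^sub>R u) \<bullet> x \<le> \<beta> * norm x"
      using norm_cauchy_schwarz[of "\<beta> *\<^sub>R u" x] \<beta> u by simp
    have 3: "2 * norm x * ?\<eta> \<le> 2 * norm x * ((1 - \<beta>) / 4)"
      using n by (intro mult_left_mono) auto
    show "objective f \<beta> u x \<ge> (1 - \<beta>) / 2 * norm x - 2 * real n"
    proof -
      have "(1 - \<beta>) / 2 * norm x = norm x - 2 * norm x * ((1 - \<beta>) / 4) - \<beta> * norm x"
        by (simp add: field_simps)
      with 1 2 3 show ?thesis unfolding objective_def by linarith
    qed
  qed simp
qed

lemma objective_has_minimizer:
  fixes f :: "'a::euclidean_space \<Rightarrow> real"
  assumes f: "\<And>z. f z \<ge> 0" "integrable lborel f" "(\<integral>z. f z \<partial>lborel) = 1"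
    and \<beta>: "0 \<le> \<beta>" "\<beta> < 1" and u: "norm u = 1"
  shows "\<exists>x. \<forall>y. objective f \<beta> u x \<le> objective f \<beta> u y"
proof -
  obtain r where r: "r \<ge> 0" "\<And>x. objective f \<beta> u x \<ge> (1 - \<beta>) / 2 * norm x - 2 * r"
    using objective_coercive[OF assms] by blast
  \<comment> \<open>Beyond radius \<open>\<rho>\<close> the lower bound exceeds \<open>0\<close>, the value of the objective at the origin.\<close>
  define \<rho> where "\<rho> = 4 * r / (1 - \<beta>)"
  have \<rho>: "\<rho> \<ge> 0" using r \<beta> by (simp add: \<rho>_def)
  have "\<exists>x\<in>cball 0 \<rho>. \<forall>y\<in>cball 0 \<rho>. objective f \<beta> u x \<le> objective f \<beta> u y"
    using \<rho> by (intro continuous_attains_inf continuous_on_subset[OF objective_continuous[OF f]]) auto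
  then obtain x where x: "\<And>y. y \<in> cball 0 \<rho> \<Longrightarrow> objective f \<beta> u x \<le> objective f \<beta> u y" by blast
  have "objective f \<beta> u x \<le> objective f \<beta> u y" for y
  proof (cases "y \<in> cball 0 \<rho>")
    case False
    have "objective f \<beta> u x \<le> objective f \<beta> u 0" using \<rho> by (intro x) simp
    also have "objective f \<beta> u 0 = 0" by (simp add: objective_def)
    also have "0 \<le> (1 - \<beta>) / 2 * norm y - 2 * r"
      using False \<beta> by (simp add: \<rho>_def field_simps)
    also have "\<dots> \<le> objective f \<beta> u y" by (rule r)
    finally show ?thesis .
  qed (rule x)
  then show ?thesis by blast
qed

text \<open>One direction is the subgradient inequality at the minimizer. For the other, the
  inequality at the points \<open>x + t v\<close>, compared with minimality at \<open>x\<close>, gives a sign for \<open>t > 0\<close> that survives in the limit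
  \<open>t \<longlongrightarrow> 0\<close> by continuity.\<close>

lemma minimizer_iff_spatial_rank:
  fixes f :: "'a::euclidean_space \<Rightarrow> real"
  assumes f: "\<And>z. f z \<ge> 0" "integrable lborel f" and c: "isCont (spatial_rank f) x"
  shows "(\<forall>y. objective f \<beta> u x \<le> objective f \<beta> u y) \<longleftrightarrow> spatial_rank f x = \<beta> *\<^sub>R u"
proof
  assume "spatial_rank f x = \<beta> *\<^sub>R u"
  then show "\<forall>y. objective f \<beta> u x \<le> objective f \<beta> u y"
    using objective_subgradient[OF f, where x=x and \<beta>=\<beta> and u=u] by simp
next
  assume min: "\<forall>y. objective f \<beta> u x \<le> objective f \<beta> u y"
  define v where "v = \<beta> *\<^sub>R u - spatial_rank f x"
  have pos: "0 \<le> (spatial_rank f (x + t *\<^sub>R v) - \<beta> *\<^sub>R u) \<bullet> v" if "t > 0" for t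
  proof -
    have "objective f \<beta> u (x + t *\<^sub>R v) + (spatial_rank f (x + t *\<^sub>R v) - \<beta> *\<^sub>R u) \<bullet> (x - (x + t *\<^sub>R v)) \<le> objective f \<beta> u x"
      by (rule objective_subgradient[OF f])
    then have "objective f \<beta> u (x + t *\<^sub>R v) - t * ((spatial_rank f (x + t *\<^sub>R v) - \<beta> *\<^sub>R u) \<bullet> v) \<le> objective f \<beta> u x"
      by simp
    with min have "0 \<le> t * ((spatial_rank f (x + t *\<^sub>R v) - \<beta> *\<^sub>R u) \<bullet> v)" by (smt (verit))
    then show ?thesis using that by (simp add: zero_le_mult_iff)
  qed
  have "((\<lambda>t. x + t *\<^sub>R v) \<longlongrightarrow> x + 0 *\<^sub>R v) (at_right 0)" by (intro tendsto_intros)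
  then have "((\<lambda>t. x + t *\<^sub>R v) \<longlongrightarrow> x) (at_right 0)" by simp
  then have "((\<lambda>t. spatial_rank f (x + t *\<^sub>R v)) \<longlongrightarrow> spatial_rank f x) (at_right 0)"
    using c by (rule isCont_tendsto_compose[rotated])
  then have "((\<lambda>t. (spatial_rank f (x + t *\<^sub>R v) - \<beta> *\<^sub>R u) \<bullet> v) \<longlongrightarrow> (spatial_rank f x - \<beta> *\<^sub>R u) \<bullet> v) (at_right 0)"
    by (intro tendsto_intros)
  then have "0 \<le> (spatial_rank f x - \<beta> *\<^sub>R u) \<bullet> v"
    by (rule tendsto_lowerbound) (use pos in \<open>auto simp: eventually_at_right_field intro!: exI[of _ 1]\<close>)
  also have "\<dots> = - (v \<bullet> v)" by (simp add: v_def inner_diff_left)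
  finally have "v = 0" by (metis inner_ge_zero inner_eq_zero_iff neg_0_le_iff_le order_antisym)
  then show "spatial_rank f x = \<beta> *\<^sub>R u" by (simp add: v_def)
qed

text \<open>Strict monotonicity makes the spatial rank map injective, so that the minimizer in direction \<open>u\<close>
  is the unique solution of \<open>spatial_rank f x = \<beta> u\<close>, and the definite description picks it.\<close>

theorem geometric_contour_eq_level_set:
  fixes f :: "'a::euclidean_space \<Rightarrow> real"
  assumes dim: "DIM('a) \<ge> 2" and f: "\<And>z. f z \<ge> 0" "integrable lborel f" "(\<integral>z. f z \<partial>lborel) = 1"
    and c: "continuous_on UNIV (spatial_rank f)" and \<beta>: "0 < \<beta>" "\<beta> < 1"
  shows "geometric_contour (density lborel (\<lambda>x. ennreal (f x))) \<beta> = {x. norm (spatial_rank f x) = \<beta>}"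
proof -
  let ?P = "density lborel (\<lambda>x. ennreal (f x))"
  have fm: "f \<in> borel_measurable borel" using f(2) by simp
  have co: "isCont (spatial_rank f) x" for x using c by (simp add: continuous_on_eq_continuous_at)
  have am: "is_arg_min (geometric_objective ?P \<beta> u) (\<lambda>_. True) x \<longleftrightarrow> spatial_rank f x = \<beta> *\<^sub>R u" for u x
    using minimizer_iff_spatial_rank[OF f(1,2) co, of \<beta> u x]
    by (simp add: is_arg_min_def geometric_objective_density[OF fm f(1)] not_less)
  have inj: "x = y" if "spatial_rank f x = spatial_rank f y" for x y
    using spatial_rank_strictly_monotone[OF dim f, of x y] that by auto
  have q: "geometric_quantile ?P \<beta> u = x" if "spatial_rank f x = \<beta> *\<^sub>R u" for u x
    unfolding geometric_quantile_def by (rule the_equality) (use am inj that in metis)+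
  show ?thesis
  proof (intro equalityI subsetI)
    fix x assume "x \<in> geometric_contour ?P \<beta>"
    then obtain u where u: "norm u = 1" "x = geometric_quantile ?P \<beta> u"
      by (auto simp: geometric_contour_def)
    obtain y where "\<forall>z. objective f \<beta> u y \<le> objective f \<beta> u z"
      using objective_has_minimizer[OF f _ \<beta>(2) u(1)] \<beta> by auto
    then have y: "spatial_rank f y = \<beta> *\<^sub>R u" using minimizer_iff_spatial_rank[OF f(1,2) co] by blast
    then show "x \<in> {x. norm (spatial_rank f x) = \<beta>}" using q[OF y] u \<beta> by simp
  next
    fix x assume x: "x \<in> {x. norm (spatial_rank f x) = \<beta>}"
    let ?u = "(1 / \<beta>) *\<^sub>R spatial_rank f x"
    have "geometric_quantile ?P \<beta> ?u = x" by (rule q) (use \<beta> in simp)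
    moreover have "?u \<in> sphere 0 1" using x \<beta> by simp
    ultimately show "x \<in> geometric_contour ?P \<beta>" unfolding geometric_contour_def by (metis imageI)
  qed
qed

section \<open>Regularity of the contour\<close>

lemma Ck_on_UNIV_if_balls:
  assumes "\<And>R. R \<ge> 0 \<Longrightarrow> Ck_on n f (ball (0::'a::euclidean_space) R)"
  shows "Ck_on n f UNIV"
proof -
  have x: "x \<in> ball 0 (norm x + 1)" for x :: 'a by simp
  have C: "Ck_on n f (ball 0 (norm x + 1))" for x :: 'a by (rule assms) simp
  show ?thesis unfolding Ck_on_def
  proof (intro conjI allI impI ballI)
    fix bs :: "'a list" and x :: 'a assume "set bs \<subseteq> Basis \<and> length bs < n"
    then show "iterated_partial bs f differentiable (at x)" using C[of x] x unfolding Ck_on_def by blast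
  next
    fix bs :: "'a list" assume bs: "set bs \<subseteq> Basis \<and> length bs \<le> n"
    show "continuous_on UNIV (iterated_partial bs f)"
    proof (rule continuous_at_imp_continuous_on, rule ballI)
      fix x :: 'a
      have "continuous_on (ball 0 (norm x + 1)) (iterated_partial bs f)" using C[of x] bs unfolding Ck_on_def by blast
      then show "isCont (iterated_partial bs f) x" using x open_ball continuous_on_eq_continuous_at by blast
    qed
  qed
qed

text \<open>The quadratic form of the Hessian of the norm, evaluated at \<open>w\<close>.\<close>

lemma kderiv_KDir_contract:
  fixes w y :: "'a::euclidean_space"
  shows "(\<Sum>c\<in>Basis. (w \<bullet> c) * keval (kderiv c (KDir w)) 0 y) = ((norm w)\<^sup>2 - (y \<bullet> w / norm y)\<^sup>2) / norm y"
proof -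
  have "(\<Sum>c\<in>Basis. (w \<bullet> c) * keval (kderiv c (KDir w)) 0 y)
    = (\<Sum>c\<in>Basis. ((w \<bullet> c) * (w \<bullet> c) - (y \<bullet> w / norm y) / norm y * ((w \<bullet> c) * (y \<bullet> c))) / norm y)"
    by (intro sum.cong) (simp_all add: inner_commute diff_divide_distrib algebra_simps)
  also have "\<dots> = ((w \<bullet> w) - (y \<bullet> w / norm y) / norm y * (w \<bullet> y)) / norm y"
    by (simp only: sum_divide_distrib[symmetric] sum_subtractf sum_distrib_left[symmetric] euclidean_inner[symmetric])
  finally show ?thesis
    unfolding power2_norm_eq_inner by (simp add: power2_eq_square inner_commute)
qed

text \<open>The contour is the level set of the squared norm of the spatial rank map. It is regular, because the derivative
  of that map is positive definite: its quadratic form is the mean of the Hessians of the distances to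
  the points \<open>z\<close>, and each of them is positive on \<open>w\<close> unless \<open>z\<close> lies on the line through \<open>x\<close> with
  direction \<open>w\<close>. At a point of the contour \<open>w\<close> is taken to be the value of the spatial rank map, which is nonzero as \<open>\<beta> > 0\<close>.\<close>

theorem geometric_contour_submanifold:
  fixes f :: "'a::euclidean_space \<Rightarrow> real"
  assumes dim: "DIM('a) \<ge> 2" and f: "\<And>z. f z \<ge> 0" "integrable lborel f" "(\<integral>z. f z \<partial>lborel) = 1"
    and \<beta>: "0 < \<beta>" "\<beta> < 1"
    and small: "\<And>R m. R \<ge> 0 \<Longrightarrow> m \<le> 1 \<Longrightarrow> small_near m (ball 0 R) (\<lambda>_. f)"
    and conv: "\<And>R b bs. R \<ge> 0 \<Longrightarrow> b \<in> Basis \<Longrightarrow> set bs \<subseteq> Basis \<Longrightarrow> length bs \<le> Suc n \<Longrightarrow>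
       uniformly_convergent_on (ball 0 R) (\<lambda>j. kconv (kderivs bs (KDir b)) (eps j) f)"
  shows "Ck_submanifold (Suc n) (DIM('a) - 1) (geometric_contour (density lborel (\<lambda>x. ennreal (f x))) \<beta>)"
proof -
  have hK: "has_order (KDir w) 0" for w :: 'a by simp
  have Fb: "(\<lambda>x. spatial_rank f x \<bullet> b) = kconv (KDir b) 0 f" for b using spatial_rank_eq_kconv[OF f(2)] by (simp add: fun_eq_iff)
  have lim: "uniform_limit (ball 0 R) (\<lambda>j. kconv (KDir w) (eps j) f) (kconv (KDir w) 0 f) sequentially" if "R \<ge> 0" for R and w
    by (rule kconv_uniform_limit[OF hK small[OF that] f(2)]) simp
  have "Ck_on (Suc n) (\<lambda>x. spatial_rank f x \<bullet> b) UNIV" if b: "b \<in> Basis" for b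
    unfolding Fb
    by (rule Ck_on_UNIV_if_balls, rule Ck_on_kernel_limit[OF open_ball convex_ball f(2) hK lim conv[OF _ b]])
  then have CF: "Ck_on (Suc n) (spatial_rank f) UNIV" using Ck_on_euclidean_iff[of UNIV "Suc n" "spatial_rank f"] by simp
  define G where "G x = spatial_rank f x \<bullet> spatial_rank f x" for x
  have CG: "Ck_on (Suc n) G UNIV"
  proof -
    have "Ck_on (Suc n) (\<lambda>x. \<Sum>b\<in>Basis. (spatial_rank f x \<bullet> b) * (spatial_rank f x \<bullet> b)) UNIV"
      using CF by (intro Ck_on_sum Ck_on_mult Ck_on_inner_left) auto
    then show ?thesis unfolding G_def[abs_def] by (simp add: euclidean_inner[symmetric])
  qed
  have "\<exists>v. frechet_derivative G (at x) v \<noteq> 0" if x: "G x = \<beta>\<^sup>2" for x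
  proof -
    define w where "w = spatial_rank f x"
    have w0: "w \<noteq> 0" using x \<beta> by (auto simp: G_def w_def)
    let ?D = "frechet_derivative (spatial_rank f) (at x)"
    let ?L = "\<lambda>c. kconv (kderiv c (KDir w)) 0 f"
    let ?R = "norm x + 1"
    have hF: "(spatial_rank f has_derivative ?D) (at x)" by (rule Ck_on_has_derivative[OF CF]) simp
    have "(G has_derivative (\<lambda>v. spatial_rank f x \<bullet> ?D v + ?D v \<bullet> spatial_rank f x)) (at x)"
      unfolding G_def[abs_def] by (rule has_derivative_inner[OF hF hF])
    then have DG: "frechet_derivative G (at x) = (\<lambda>v. spatial_rank f x \<bullet> ?D v + ?D v \<bullet> spatial_rank f x)"
      by (rule frechet_derivative_at[symmetric])
    have hom1: "has_order (kderiv c (KDir w)) 1" for c using has_order_kderiv[OF hK, of c w] by simp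
    have sm1: "small_near 1 (ball 0 ?R) (\<lambda>_. f)" by (rule small) auto
    have i: "integrable lborel (\<lambda>z. keval (kderiv c (KDir w)) 0 (x - z) * f z)" for c
      by (rule integrable_kernel[where h="\<lambda>_. f", OF hom1 sm1 _ f(2)]) simp
    have L: "uniform_limit (ball 0 ?R) (\<lambda>j. kconv (kderiv c (KDir w)) (eps j) f) (?L c) sequentially" for c
      by (rule kconv_uniform_limit[OF hom1 sm1 f(2)])
    have "((\<lambda>y. spatial_rank f y \<bullet> w) has_derivative (\<lambda>v. \<Sum>c\<in>Basis. (v \<bullet> c) * ?L c x)) (at x)"
      unfolding Fb by (rule kernel_limit_has_derivative[OF open_ball convex_ball hK f(2) lim L]) auto
    moreover have "((\<lambda>y. spatial_rank f y \<bullet> w) has_derivative (\<lambda>v. ?D v \<bullet> w)) (at x)"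
      by (rule has_derivative_inner_left[OF hF])
    ultimately have "(\<lambda>v. ?D v \<bullet> w) = (\<lambda>v. \<Sum>c\<in>Basis. (v \<bullet> c) * ?L c x)"
      by (rule has_derivative_unique[rotated])
    then have "?D w \<bullet> w = (\<Sum>c\<in>Basis. (w \<bullet> c) * ?L c x)" by metis
    also have "\<dots> = (\<integral>z. (\<Sum>c\<in>Basis. (w \<bullet> c) * (keval (kderiv c (KDir w)) 0 (x - z) * f z)) \<partial>lborel)"
      unfolding kconv_def
      by (simp only: Bochner_Integration.integral_sum[OF integrable_mult_right[OF i]] integral_mult_right_zero)
    also have "\<dots> = (\<integral>z. f z * (((norm w)\<^sup>2 - ((x - z) \<bullet> w / norm (x - z))\<^sup>2) / norm (x - z)) \<partial>lborel)"
      unfolding kderiv_KDir_contract[symmetric] by (simp only: sum_distrib_left mult_ac)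
    also have "\<dots> > 0"
    proof (rule integral_density_pos[OF f])
      show "AE z in lborel. ((norm w)\<^sup>2 - ((x - z) \<bullet> w / norm (x - z))\<^sup>2) / norm (x - z) > 0"
        using AE_not_in_line[OF dim, of x w]
      proof eventually_elim
        case (elim z)
        let ?y = "x - z"
        have y0: "?y \<noteq> 0" using elim span_zero by metis
        have "\<bar>?y \<bullet> w\<bar> \<noteq> norm ?y * norm w"
        proof
          assume "\<bar>?y \<bullet> w\<bar> = norm ?y * norm w"
          then have "norm ?y *\<^sub>R w = norm w *\<^sub>R ?y \<or> norm ?y *\<^sub>R w = - norm w *\<^sub>R ?y"
            by (simp add: norm_cauchy_schwarz_abs_eq)
          then have "norm w *\<^sub>R ?y = norm ?y *\<^sub>R w \<or> norm w *\<^sub>R ?y = (- norm ?y) *\<^sub>R w"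
            by (metis minus_equation_iff scaleR_minus_left)
          then have "norm w *\<^sub>R ?y \<in> span {w}" by (metis span_base span_scale singletonI)
          then have "(1 / norm w) *\<^sub>R (norm w *\<^sub>R ?y) \<in> span {w}" by (rule span_scale)
          then have "?y \<in> span {w}" using w0 by simp
          with elim show False by simp
        qed
        then have "\<bar>?y \<bullet> w\<bar> < norm ?y * norm w" using Cauchy_Schwarz_ineq2[of ?y w] by linarith
        then have "\<bar>?y \<bullet> w / norm ?y\<bar> < norm w" using y0 by (simp add: pos_divide_less_eq mult.commute)
        then have "\<bar>?y \<bullet> w / norm ?y\<bar>\<^sup>2 < (norm w)\<^sup>2" by (intro power_strict_mono) auto
        then have "(?y \<bullet> w / norm ?y)\<^sup>2 < (norm w)\<^sup>2" by (simp only: power2_abs)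
        then show ?case using y0 by simp
      qed
      have "integrable lborel (\<lambda>z. \<Sum>c\<in>Basis. (w \<bullet> c) * (keval (kderiv c (KDir w)) 0 (x - z) * f z))"
        using i by (intro Bochner_Integration.integrable_sum integrable_mult_right) auto
      then show "integrable lborel (\<lambda>z. f z * (((norm w)\<^sup>2 - ((x - z) \<bullet> w / norm (x - z))\<^sup>2) / norm (x - z)))"
        unfolding kderiv_KDir_contract[symmetric] by (simp only: sum_distrib_left mult_ac)
    qed
    finally have "?D w \<bullet> w > 0" .
    then show ?thesis unfolding DG by (intro exI[of _ w]) (simp add: w_def inner_commute)
  qed
  from Ck_submanifold_level_set[OF CG this]
  have "Ck_submanifold (Suc n) (DIM('a) - 1) {x. G x = \<beta>\<^sup>2}" .
  moreover have "G x = \<beta>\<^sup>2 \<longleftrightarrow> norm (spatial_rank f x) = \<beta>" for x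
    unfolding G_def power2_norm_eq_inner[symmetric] using \<beta> by (simp add: power2_eq_iff_nonneg)
  ultimately show ?thesis
    using geometric_contour_eq_level_set[OF dim f Ck_on_continuous[OF CF] \<beta>] by simp
qed

text \<open>An essentially bounded function is locally in \<open>L\<^sup>r\<close> for every finite \<open>r\<close>, which
  reduces the case \<open>p = \<infinity>\<close> to finite exponents.\<close>

lemma Lp_loc_finite_exponent:
  fixes f :: "'a::euclidean_space \<Rightarrow> real" and q :: real
  assumes "Lp_loc p f" "0 < q" "ereal q < p"
  obtains r where "q < r" "\<And>R. integrable lborel (\<lambda>z. indicator (cball 0 R) z * \<bar>f z\<bar> powr r)"
proof (cases p)
  case (real r)
  have "integrable lborel (\<lambda>z. indicator (cball 0 R) z * \<bar>f z\<bar> powr r)" for R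
    using assms(1) compact_cball[of "0::'a" R] unfolding Lp_loc_def real set_integrable_def by auto
  with assms(3) real that[of r] show ?thesis by simp
next
  case PInf
  have [measurable]: "f \<in> borel_measurable borel" using assms(1) by (simp add: Lp_loc_def)
  show ?thesis
  proof (rule that[of "q + 1"])
    fix R :: real
    obtain C where C: "AE z in lborel. z \<in> cball 0 R \<longrightarrow> \<bar>f z\<bar> \<le> C"
      using assms(1) compact_cball[of "0::'a" R] unfolding Lp_loc_def PInf by (simp only: refl if_True) blast
    show "integrable lborel (\<lambda>z. indicator (cball 0 R) z * \<bar>f z\<bar> powr (q + 1))"
    proof (rule Bochner_Integration.integrable_bound[of _ "\<lambda>z. \<bar>C\<bar> powr (q + 1) * indicator (cball 0 R) z"])
      show "integrable lborel (\<lambda>z::'a. \<bar>C\<bar> powr (q + 1) * indicator (cball 0 R) z)"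
        using emeasure_lborel_cball_finite[of "0::'a" R] by (intro integrable_mult_right integrable_real_indicator) auto
      show "AE z in lborel. norm (indicator (cball 0 R) z * \<bar>f z\<bar> powr (q + 1)) \<le> norm (\<bar>C\<bar> powr (q + 1) * indicator (cball 0 R) z)"
        using C
      proof eventually_elim
        case (elim z)
        show ?case
        proof (cases "z \<in> cball 0 R")
          case True
          with elim have "\<bar>f z\<bar> powr (q + 1) \<le> \<bar>C\<bar> powr (q + 1)" using assms(2) by (intro powr_mono2) auto
          with True show ?thesis by simp
        qed simp
      qed
      have "(\<lambda>z::'a. indicator (cball 0 R) z :: real) \<in> borel_measurable borel"
        by (intro borel_measurable_indicator) simp
      moreover have "(\<lambda>z. \<bar>f z\<bar> powr (q + 1)) \<in> borel_measurable borel" by (rule measurable_abs_powr) simp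
      ultimately show "(\<lambda>z. indicator (cball 0 R) z * \<bar>f z\<bar> powr (q + 1)) \<in> borel_measurable lborel"
        by simp
    qed
  qed simp
qed (use assms in auto)

text \<open>The exponent \<open>m + m / (r - 1) = m r / (r - 1)\<close> is below the dimension \<open>d\<close> exactly if \<open>r (d - m) > d\<close>.\<close>

lemma small_near_Lp_loc:
  fixes f :: "'a::euclidean_space \<Rightarrow> real"
  assumes l: "1 \<le> l" "l \<le> DIM('a) - 1"
    and p: "ereal (real DIM('a) / (real DIM('a) - real l)) < p" and f: "Lp_loc p f" and m: "m \<le> l"
  shows "small_near m (ball 0 R) (\<lambda>_. f)"
proof -
  let ?d = "real DIM('a)"
  have dl: "?d - real l > 0" using l by linarith
  have q: "?d / (?d - real l) > 1" using dl l by (simp add: divide_simps)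
  obtain r where r: "?d / (?d - real l) < r" "\<And>R. integrable lborel (\<lambda>z. indicator (cball 0 R) z * \<bar>f z\<bar> powr r)"
    using Lp_loc_finite_exponent[OF f _ p] q by auto
  have r1: "r > 1" using r(1) q by linarith
  have "?d < r * (?d - real l)" using r(1) dl by (simp add: pos_divide_less_eq)
  moreover have "r * real m \<le> r * real l" using m r1 by (intro mult_left_mono) auto
  ultimately have "real m * r < ?d * (r - 1)" by (simp add: algebra_simps)
  then have "real m * r / (r - 1) < ?d" using r1 by (simp add: pos_divide_less_eq)
  moreover have "real m + real m / (r - 1) = real m * r / (r - 1)" using r1 by (simp add: field_simps)
  ultimately have "real m + real m / (r - 1) < ?d" by simp
  moreover have "f \<in> borel_measurable borel" using f by (simp add: Lp_loc_def)
  ultimately show ?thesis using small_near_Lp[OF r1 _ _ r(2)] by blast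
qed

theorem corollary6p5:
  fixes P :: "'a::euclidean_space measure"
    and f :: "'a \<Rightarrow> real"
    and \<beta> :: real
  assumes "DIM('a) \<ge> 2"
    and "prob_space P"
    and "sets P = sets borel"
    and "f \<in> borel_measurable borel"
    and "\<And>x. f x \<ge> 0"
    and "P = density lborel (\<lambda>x. ennreal (f x))"
    and "0 < \<beta>" and "\<beta> < 1"
  shows
    "(\<forall>(p::ereal) (l::nat).
        1 \<le> l \<and> l \<le> DIM('a) - 1 \<and>
        ereal (real DIM('a) / (real DIM('a) - real l)) < p \<and> Lp_loc p f \<longrightarrow>
        Ck_submanifold l (DIM('a) - 1) (geometric_contour P \<beta>)) \<and>
     (\<forall>(k::nat) (\<alpha>::real).
        0 < \<alpha> \<and> \<alpha> < 1 \<and> Ck_Holder_loc k \<alpha> f \<longrightarrow>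
        Ck_submanifold (k + DIM('a)) (DIM('a) - 1) (geometric_contour P \<beta>))"
proof -
  note dim = assms(1) and \<beta> = assms(7,8)
  have nn: "(\<integral>\<^sup>+x. ennreal (f x) \<partial>lborel) = 1"
    using prob_space.emeasure_space_1[OF assms(2)] assms(4) unfolding assms(6)
    by (simp add: emeasure_density)
  have fi: "integrable lborel f"
    using assms(4,5) nn by (intro integrableI_nonneg) auto
  have f1: "(\<integral>x. f x \<partial>lborel) = 1"
    using nn assms(4,5) by (simp add: integral_eq_nn_integral)
  note f = assms(5) fi f1
  have h: "has_order (kderivs bs (KDir b)) (length bs)" for bs and b :: 'a using has_order_kderivs[of "KDir b" 0 bs] by simp
  show ?thesis unfolding assms(6)
  proof (intro conjI allI impI)
    fix p :: ereal and l :: nat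
    assume A: "1 \<le> l \<and> l \<le> DIM('a) - 1 \<and> ereal (real DIM('a) / (real DIM('a) - real l)) < p \<and> Lp_loc p f"
    then have sm: "small_near m (ball 0 R) (\<lambda>_. f)" if "m \<le> l" for m R
      using small_near_Lp_loc[of l p f m R] that by blast
    obtain n where n: "l = Suc n" using A by (cases l) auto
    show "Ck_submanifold l (DIM('a) - 1) (geometric_contour (density lborel (\<lambda>x. ennreal (f x))) \<beta>)"
      unfolding n
    proof (rule geometric_contour_submanifold[OF dim f \<beta>])
      show "small_near m (ball 0 R) (\<lambda>_. f)" if "m \<le> 1" for m R using sm[of m R] that A by linarith
      show "uniformly_convergent_on (ball 0 R) (\<lambda>j. kconv (kderivs bs (KDir b)) (eps j) f)"
        if "length bs \<le> Suc n" for R b bs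
        using kconv_uniform_limit[OF h sm fi] that unfolding n uniformly_convergent_on_def by blast
    qed
  next
    fix k :: nat and \<alpha> :: real
    assume A: "0 < \<alpha> \<and> \<alpha> < 1 \<and> Ck_Holder_loc k \<alpha> f"
    have fc: "continuous_on UNIV f" using A Ck_on_continuous by (auto simp: Ck_Holder_loc_def)
    have sm: "small_near m (ball 0 R) (\<lambda>_. f)" if m: "m \<le> 1" for m R
    proof -
      obtain C where C: "\<And>z. z \<in> cball 0 (R + 1) \<Longrightarrow> \<bar>f z\<bar> \<le> C"
        using continuous_bounded_on_cball[OF fc, of "R + 1"] by blast
      show ?thesis
      proof (rule small_near_bounded[of m 1 _ _ C])
        show "\<bar>f z\<bar> \<le> C" if "x \<in> ball 0 R" "norm (x - z) < 1" for x z
          using that norm_triangle_sub[of z x] by (intro C) (simp add: norm_minus_commute)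
      qed (use m dim assms(4) in auto)
    qed
    obtain n where n: "k + DIM('a) = Suc n" using dim by (cases "k + DIM('a)") auto
    show "Ck_submanifold (k + DIM('a)) (DIM('a) - 1) (geometric_contour (density lborel (\<lambda>x. ennreal (f x))) \<beta>)"
      unfolding n
    proof (rule geometric_contour_submanifold[OF dim f \<beta> sm])
      show "uniformly_convergent_on (ball 0 R) (\<lambda>j. kconv (kderivs bs (KDir b)) (eps j) f)"
        if "R \<ge> 0" "set bs \<subseteq> Basis" "length bs \<le> Suc n" for R b bs
        using kernel_convergent_Ck_Holder[OF _ _ _ fi that(1) _ that(2), of \<alpha> k "KDir b"] A that(3) n by simp
    qed
  qed
qed

end
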